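(* Let $M=\{r=0\}$ be a germ at $p$ of a $\mathcal C^\infty$ real hypersurface in $\mathbb C^n$, where $r$ is a real-valued $\mathcal C^\infty$ local defining function with $r(p)=0$ and $dr(p)\neq 0$, and let $p\in M$. Then $\Delta(M,p)=\infty$ if and only if there exists a nonconstant formal complex curve $\zeta(t)=(\zeta_1(t),\dots,\zeta_n(t))$ with $\zeta(0)=p$ such that $r\circ\zeta$ vanishes to infinite order at $0$.
   Context: For a germ of a nonconstant holomorphic curve $\zeta:(\mathbb C,0)\to(\mathbb C^n,p)$, $\nu(\zeta)$ denotes the order of vanishing at $0$ of $|\zeta_1(t)-\zeta_1(0)|+\cdots+|\zeta_n(t)-\zeta_n(0)|$, and $\nu(\zeta^*r)$ denotes the order of vanishing of $r\circ\zeta$ at $0$. The D'Angelo type is $\Delta(M,p)=\sup_\zeta \nu(\zeta^*r)/\nu(\zeta)$, the supremum over all such germs $\zeta$. A formal complex curve through $p$ is an $n$-tuple $\zeta=(\zeta_1,\dots,\zeta_n)$ of formal power series in one complex variable $t$ with $\zeta(0)=p$; $r\circ\zeta$ means the composition of the formal Taylor series of $r$ at $p$ (in $z-p$ and $\overline{z-p}$) with $\zeta$, a formal power series in $t,\bar t$, and "vanishes to infinite order" means all its coefficients are zero. *)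

theory Defs
  imports "HOL-Analysis.Analysis" "HOL-Library.Landau_Symbols"
    "HOL-Computational_Algebra.Formal_Power_Series"
begin

fun dd :: "'a::real_normed_vector list \<Rightarrow> ('a \<Rightarrow> 'b::real_normed_vector) \<Rightarrow> 'a \<Rightarrow> 'b" where
  "dd [] f = f"
| "dd (v # vs) f = (\<lambda>z. frechet_derivative (dd vs f) (at z) v)"

definition smooth_on :: "'a::real_normed_vector set \<Rightarrow> ('a \<Rightarrow> 'b::real_normed_vector) \<Rightarrow> bool" where
  "smooth_on U f \<longleftrightarrow> (\<forall>vs. \<forall>z\<in>U. dd vs f differentiable (at z))"

definition ord_vanish :: "(complex \<Rightarrow> real) \<Rightarrow> enat" where
  "ord_vanish f = Sup {enat k | k. f \<in> O[at (0::complex)](\<lambda>t. cmod t ^ k)}"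

definition nu_curve :: "(complex \<Rightarrow> complex^'n::finite) \<Rightarrow> enat" where
  "nu_curve \<zeta> = ord_vanish (\<lambda>t. \<Sum>j\<in>UNIV. cmod (\<zeta> t $ j - \<zeta> 0 $ j))"

definition hol_curve_germs :: "complex^'n::finite \<Rightarrow> (complex \<Rightarrow> complex^'n) set" where
  "hol_curve_germs p = {\<zeta>. (\<forall>j. (\<lambda>t. \<zeta> t $ j) analytic_on {0}) \<and> \<zeta> 0 = p
      \<and> \<not> (\<forall>\<^sub>F t in nhds 0. \<zeta> t = p)}"

definition DAngelo_type :: "(complex^'n::finite \<Rightarrow> real) \<Rightarrow> complex^'n \<Rightarrow> ereal" where
  "DAngelo_type r p =
     (SUP \<zeta>\<in>hol_curve_germs p.
        ereal_of_enat (ord_vanish (\<lambda>t. r (\<zeta> t))) / ereal_of_enat (nu_curve \<zeta>))"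

text \<open>Wirtinger derivatives: b = False gives d/dz_j = (d/dx_j - i d/dy_j)/2,
  b = True gives d/d(conj z_j) = (d/dx_j + i d/dy_j)/2.\<close>
definition wirt :: "'n::finite \<Rightarrow> bool \<Rightarrow> (complex^'n \<Rightarrow> complex) \<Rightarrow> complex^'n \<Rightarrow> complex" where
  "wirt j b g z = (frechet_derivative g (at z) (axis j 1)
       + (if b then \<i> else - \<i>) * frechet_derivative g (at z) (axis j \<i>)) / 2"

definition wirts :: "('n::finite \<times> bool) list \<Rightarrow> (complex^'n \<Rightarrow> complex) \<Rightarrow> complex^'n \<Rightarrow> complex" where
  "wirts L g = foldr (\<lambda>(j, b) h. wirt j b h) L g"

text \<open>A list of derivations realising the multi-indices alpha (holomorphic) and
  beta (antiholomorphic); the order is irrelevant for smooth functions.\<close>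
definition mixed_list :: "('n::finite \<Rightarrow> nat) \<Rightarrow> ('n \<Rightarrow> nat) \<Rightarrow> ('n \<times> bool) list" where
  "mixed_list \<alpha> \<beta> = (SOME L. \<forall>j. count_list L (j, False) = \<alpha> j \<and> count_list L (j, True) = \<beta> j)"

definition taylor_coeff :: "(complex^'n::finite \<Rightarrow> real) \<Rightarrow> complex^'n \<Rightarrow> ('n \<Rightarrow> nat) \<Rightarrow> ('n \<Rightarrow> nat) \<Rightarrow> complex" where
  "taylor_coeff r p \<alpha> \<beta> =
     wirts (mixed_list \<alpha> \<beta>) (\<lambda>z. complex_of_real (r z)) p
       / (of_nat (\<Prod>j\<in>UNIV. fact (\<alpha> j)) * of_nat (\<Prod>j\<in>UNIV. fact (\<beta> j)))"

definition formal_curve_through :: "('n::finite \<Rightarrow> complex fps) \<Rightarrow> complex^'n \<Rightarrow> bool" where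
  "formal_curve_through \<zeta> p \<longleftrightarrow> (\<forall>j. fps_nth (\<zeta> j) 0 = p $ j)"

definition formal_nonconstant :: "('n::finite \<Rightarrow> complex fps) \<Rightarrow> bool" where
  "formal_nonconstant \<zeta> \<longleftrightarrow> (\<exists>j k. k > 0 \<and> fps_nth (\<zeta> j) k \<noteq> 0)"

text \<open>Coefficient of t^a (conj t)^b in the formal series r \<circ> zeta, for a formal curve
  zeta through p: the sum over all alpha, beta of taylor_coeff alpha beta times
  [t^a] (zeta-p)^alpha times conj([t^b] (zeta-p)^beta).  Since zeta-p has no
  constant term, only |alpha| \<le> a and |beta| \<le> b contribute, so the sum is finite.\<close>
definition formal_comp_coeff ::
  "(complex^'n::finite \<Rightarrow> real) \<Rightarrow> complex^'n \<Rightarrow> ('n \<Rightarrow> complex fps) \<Rightarrow> nat \<Rightarrow> nat \<Rightarrow> complex" where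
  "formal_comp_coeff r p \<zeta> a b =
     (\<Sum>\<alpha>\<in>{\<alpha>. sum \<alpha> UNIV \<le> a}. \<Sum>\<beta>\<in>{\<beta>. sum \<beta> UNIV \<le> b}.
        taylor_coeff r p \<alpha> \<beta>
        * fps_nth (\<Prod>j\<in>UNIV. (\<zeta> j - fps_const (p $ j)) ^ \<alpha> j) a
        * cnj (fps_nth (\<Prod>j\<in>UNIV. (\<zeta> j - fps_const (p $ j)) ^ \<beta> j) b))"

end

theory Submission
  imports Defs
    "HOL-Complex_Analysis.Complex_Analysis"
    "HOL-Computational_Algebra.Fundamental_Theorem_Algebra"
    "HOL-Combinatorics.Multiset_Permutations"
begin

text \<open>If a formal curve annihilates \<open>r\<close>, its truncations are polynomial curves of bounded multiplicity
  along which \<open>r\<close> vanishes to arbitrarily high order, by Taylor's theorem.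

  Conversely, a curve \<open>\<zeta>\<close> of multiplicity \<open>m\<close> with \<open>r \<circ> \<zeta> = O(t\<^sup>K)\<close>, \<open>K > 2km\<close>, yields the functionals
  \<open>f \<mapsto> [t\<^sup>a] f(\<zeta>(t))\<close>, \<open>a \<le> km\<close>, on the ring \<open>A\<close> of formal power series at \<open>p\<close>. They are finitely
  supported on monomials, they span an \<open>A\<close>-submodule of the dual of \<open>A\<close> containing elements of every
  degree up to \<open>k\<close>, and the sesquilinear form given by the Taylor coefficients of \<open>r\<close> vanishes on
  this span. The multiplicities of these curves may be unbounded, so one passes to the limit not with
  the curves but with the spans, and obtains a submodule \<open>N\<close> of unbounded degree that is still
  isotropic.

  In a minimal submodule of unbounded degree some coordinate \<open>x\<close> acts surjectively, and with a
  finite-dimensional kernel. Lifting along \<open>x\<close> gives a series \<open>L\<close> with coefficients in \<open>N\<close> and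
  \<open>x L = t L\<close> on which, by finiteness of the kernel, every coordinate is algebraic over the power series
  in \<open>t\<close>. Puiseux's theorem then provides a common eigenvector of all coordinates over a ramified
  extension; its eigenvalues are the components of a formal curve, and isotropy of \<open>N\<close> says that
  this curve annihilates \<open>r\<close>.\<close>

section \<open>Ramified roots of polynomials over power series\<close>

text \<open>The submodules are Macaulay's inverse systems. Under Matlis duality they correspond to
  ideals of the power series ring, and bounded degree means that the quotient has finite length. A
  minimal unbounded submodule thus corresponds to a prime ideal of coheight one, that is, to an
  irreducible formal curve, which the eigenvector argument parametrises. The dual side is what
  permits the limit: functionals of bounded degree form a finite-dimensional space, whereas
  parametrisations of growing multiplicity have no evident limit. The danger in the limit is a
  collapse of the degree. It is averted by elements that vanish on all monomials of degree at most
  \<open>d\<close> but have degree bounded by a number depending on \<open>d\<close> alone; once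
  normalised, they keep a nonzero limit. The bound \<open>2km\<close> serves the two conjugate
  factors: \<open>a, b \<le> km\<close> gives \<open>a + b < K\<close>, so all coefficients of
  \<open>t^a cnj t^b\<close> in that range vanish. Isotropy is inherited by submodules and by
  limits, since each value of the form involves finitely many coefficients.\<close>

locale coeff_hom =
  fixes h :: "'a::comm_ring_1 \<Rightarrow> 'b::comm_ring_1"
  assumes hom_one: "h 1 = 1" and hom_add: "h (a + b) = h a + h b" and hom_mult: "h (a * b) = h a * h b"
begin

lemma hom_zero: "h 0 = 0"
  using hom_add[of 0 0] by simp

lemma coeff_map: "coeff (map_poly h p) i = h (coeff p i)"
  by (simp add: coeff_map_poly hom_zero)

lemma map_poly_plus: "map_poly h (p + q) = map_poly h p + map_poly h q"
  by (rule poly_eqI) (simp add: coeff_map hom_add)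

lemma map_pCons: "map_poly h (pCons a p) = pCons (h a) (map_poly h p)"
  by (rule poly_eqI) (simp add: coeff_map coeff_pCons split: nat.split)

lemma map_poly_smult: "map_poly h (smult a p) = smult (h a) (map_poly h p)"
  by (rule poly_eqI) (simp add: coeff_map hom_mult)

lemma map_poly_times: "map_poly h (p * q) = map_poly h p * map_poly h q"
  by (induction p) (simp_all add: map_pCons map_poly_plus map_poly_smult hom_zero)

lemma map_poly_pcompose: "map_poly h (pcompose p q) = pcompose (map_poly h p) (map_poly h q)"
  by (induction p) (simp_all add: map_pCons pcompose_pCons map_poly_plus map_poly_times hom_zero)

end

section \<open>Reduction modulo \<open>t\<close> and the ramification that substitutes
  \<open>t^q\<close> for \<open>t\<close>\<close>

lemma coeff_hom_const_term: "coeff_hom (\<lambda>a :: 'a::comm_ring_1 fps. fps_nth a 0)"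
  by unfold_locales auto

lemma coeff_hom_ramify:
  "q > 0 \<Longrightarrow> coeff_hom (\<lambda>a :: 'a::idom fps. a oo fps_X ^ q)"
  by unfold_locales (auto simp: fps_compose_add_distrib fps_compose_mult_distrib)

abbreviation const_terms :: "'a::comm_ring_1 fps poly \<Rightarrow> 'a poly" where
  "const_terms \<equiv> map_poly (\<lambda>a. fps_nth a 0)"

abbreviation ramify :: "nat \<Rightarrow> 'a::idom fps poly \<Rightarrow> 'a fps poly" where
  "ramify q \<equiv> map_poly (\<lambda>a. a oo fps_X ^ q)"

lemma ramify_ramify:
  fixes p :: "'a::idom fps poly"
  assumes "q > 0" "q' > 0"
  shows "ramify q' (ramify q p) = ramify (q * q') p"
proof (rule poly_eqI)
  fix i
  have "(a oo fps_X ^ q) oo fps_X ^ q' = a oo fps_X ^ (q * q')" for a :: "'a fps"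
    using assms by (simp add: fps_compose_assoc[symmetric] fps_X_power_compose power_mult[symmetric] mult.commute)
  then show "coeff (ramify q' (ramify q p)) i = coeff (ramify (q * q') p) i"
    by (simp add: coeff_map_poly)
qed

lemma fps_nth_0_poly:
  "fps_nth a 0 = 0 \<Longrightarrow> fps_nth (poly p a) 0 = fps_nth (coeff p 0) 0" for a :: "'a::comm_ring_1 fps"
  by (cases p) auto

section \<open>Newton iteration for power series roots\<close>

lemma poly_add_first_order:
  fixes p :: "'a::idom poly"
  shows "\<exists>r. poly p (a + h) = poly p a + h * poly (pderiv p) a + h^2 * r"
proof (induction p)
  case (pCons c p)
  then obtain r where r: "poly p (a + h) = poly p a + h * poly (pderiv p) a + h^2 * r" by blast
  show ?case
    by (rule exI[of _ "poly (pderiv p) a + (a + h) * r"])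
       (simp add: r pderiv_pCons algebra_simps power2_eq_square)
qed auto

text \<open>Newton's iteration, one coefficient at a time: the derivative at an approximate root has
  a nonzero constant term, so a correction by \<open>c * fps_X ^ Suc n\<close> moves the coefficient
  \<open>Suc n\<close> freely, and the quadratic error starts only at order
  \<open>2 * Suc n\<close>.\<close>

lemma fps_simple_root:
  fixes p :: "'a::field fps poly"
  assumes "fps_nth (coeff p 0) 0 = 0" "fps_nth (coeff p 1) 0 \<noteq> 0"
  shows "\<exists>a. fps_nth a 0 = 0 \<and> poly p a = 0"
proof -
  define P where "P n a \<longleftrightarrow> fps_nth a 0 = 0 \<and> (\<forall>k\<le>n. fps_nth (poly p a) k = 0)" for n a
  have "\<exists>s. \<forall>n. P n (s n) \<and> fps_X ^ Suc n dvd s (Suc n) - s n"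
  proof (rule dependent_nat_choice)
    show "\<exists>x. P 0 x" by (rule exI[of _ 0]) (use assms in \<open>auto simp: P_def poly_0_coeff_0\<close>)
  next
    fix a n assume a: "P n a"
    define d where "d = fps_nth (poly (pderiv p) a) 0"
    have d: "d \<noteq> 0" using a assms(2) by (simp add: d_def P_def fps_nth_0_poly coeff_pderiv)
    define c where "c = - fps_nth (poly p a) (Suc n) / d"
    define h where "h = fps_const c * fps_X ^ Suc n"
    obtain r where r: "poly p (a + h) = poly p a + h * poly (pderiv p) a + h^2 * r"
      using poly_add_first_order by blast
    have h2: "h^2 * r = fps_X ^ (2 * Suc n) * (fps_const (c^2) * r)"
      unfolding h_def power_mult_distrib power_mult[symmetric] fps_const_power by (simp only: mult_ac)
    have "fps_nth (poly p (a + h)) k = 0" if k: "k \<le> Suc n" for k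
    proof -
      have 1: "fps_nth (h^2 * r) k = 0"
      proof -
        have "k < 2 * Suc n" using k by simp
        then show ?thesis unfolding h2 fps_X_power_mult_nth by simp
      qed
      have 2: "fps_nth (h * poly (pderiv p) a) k = (if k = Suc n then c * d else 0)"
        unfolding h_def mult.assoc fps_mult_left_const_nth fps_X_power_mult_nth
        using k by (auto simp: d_def)
      show ?thesis
        using a k d by (auto simp: r 1 2 P_def c_def le_Suc_eq)
    qed
    moreover have "fps_nth (a + h) 0 = 0" using a by (simp add: P_def h_def)
    moreover have "fps_X ^ Suc n dvd (a + h) - a" by (simp add: h_def)
    ultimately show "\<exists>b. P (Suc n) b \<and> fps_X ^ Suc n dvd b - a" unfolding P_def by blast
  qed
  then obtain s where s: "\<And>n. P n (s n)" "\<And>n. fps_X ^ Suc n dvd s (Suc n) - s n" by blast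
  \<comment> \<open>Successive iterates differ by multiples of \<open>fps_X ^ Suc n\<close>, so
    reading off the diagonal gives their limit.\<close>
  define a where "a = Abs_fps (\<lambda>k. fps_nth (s k) k)"
  have st: "fps_nth (s (n + m)) k = fps_nth (s n) k" if "k \<le> n" for n m k
  proof (induction m)
    case (Suc m)
    obtain u where "s (Suc (n + m)) - s (n + m) = fps_X ^ Suc (n + m) * u" using s(2) by blast
    then have "fps_nth (s (Suc (n + m)) - s (n + m)) k = fps_nth (fps_X ^ Suc (n + m) * u) k" by simp
    with that Suc show ?case by (simp add: fps_X_power_mult_nth del: power_Suc)
  qed simp
  have eqn: "fps_nth a k = fps_nth (s n) k" if "k \<le> n" for k n
    using st[of k k "n - k"] that by (simp add: a_def)
  have "fps_nth (poly p a) n = 0" for n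
  proof -
    have "fps_nth (poly q a) k = fps_nth (poly q (s n)) k" if "k \<le> n" for q k
      using that by (induction q arbitrary: k) (auto simp: fps_mult_nth eqn[of _ n] intro!: sum.cong)
    with s(1)[of n] show ?thesis by (simp add: P_def)
  qed
  moreover have "fps_nth a 0 = 0" using s(1)[of 0] by (simp add: a_def P_def)
  ultimately show ?thesis by (auto simp: fps_eq_iff)
qed

section \<open>Newton-Puiseux: translation, rescaling and ramification\<close>

lemma higher_pderiv_pcompose_shift:
  "(pderiv ^^ n) (pcompose p [:a, 1:]) = pcompose ((pderiv ^^ n) p) [:a, 1:]" for a :: "'a::idom"
  by (induction n) (simp_all add: pderiv_pcompose pderiv_pCons)

text \<open>Taylor's formula at \<open>a\<close>: a root of the derivative of order
  \<open>m - 1\<close> becomes, after translation, a vanishing coefficient of degree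
  \<open>m - 1\<close>.\<close>

lemma coeff_pcompose_shift:
  fixes a :: "'a::{idom,semiring_char_0}"
  shows "fact n * coeff (pcompose p [:a, 1:]) n = poly ((pderiv ^^ n) p) a"
proof -
  have "poly ((pderiv ^^ n) (pcompose p [:a, 1:])) 0 = poly ((pderiv ^^ n) p) a"
    by (simp add: higher_pderiv_pcompose_shift poly_pcompose)
  then show ?thesis
    by (simp add: poly_0_coeff_0 coeff_higher_pderiv pochhammer_fact)
qed

text \<open>Lets the substitution \<open>x = w y\<close>, followed by division by \<open>u\<close>,
  be carried out without fractions; in the Newton polygon step both are powers of the
  variable.\<close>

lemma poly_rescale:
  fixes A B :: "'a::idom poly"
  assumes "\<And>i. coeff B i * u = w ^ i * coeff A i"
  shows "u * poly B y = poly A (w * y)"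
proof -
  define N where "N = max (degree A) (degree B)"
  have "poly B y = (\<Sum>i\<le>N. coeff B i * y ^ i)" "poly A (w * y) = (\<Sum>i\<le>N. coeff A i * (w * y) ^ i)"
    unfolding poly_altdef
    by (rule sum.mono_neutral_left; auto simp: N_def coeff_eq_0)+
  moreover have "u * (coeff B i * y ^ i) = coeff A i * (w * y) ^ i" for i
    using assms[of i] by (simp add: power_mult_distrib) (metis (no_types, lifting) mult.assoc mult.commute)
  ultimately show ?thesis by (simp add: sum_distrib_left)
qed

lemma coeff_monom_lower:
  fixes p q :: "'a::comm_semiring_1 poly"
  assumes "p = monom 1 m * q"
  shows "\<forall>i<m. coeff p i = 0" "coeff p m = coeff q 0"
  using assms by (auto simp: coeff_monom_mult simp del: coeff_0_reflect_poly)

text \<open>Induction on the multiplicity \<open>m\<close> of the root 0 of the reduction modulo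
  \<open>t\<close>. A translation removes the coefficient of degree \<open>m - 1\<close>; rescaling
  along an edge of the Newton polygon then gives a reduction of degree \<open>m\<close> that still
  lacks this coefficient but has a nonzero one further below. It is no multiple of a power of one
  linear factor, so each of its roots has multiplicity less than \<open>m\<close>.\<close>

lemma ramified_root:
  fixes p :: "complex fps poly"
  assumes "m > 0" "\<forall>i<m. coeff (const_terms p) i = 0" "coeff (const_terms p) m \<noteq> 0"
  shows "\<exists>q y. q > 0 \<and> fps_nth y 0 = 0 \<and> poly (ramify q p) y = 0"
  using assms
proof (induction m arbitrary: p rule: less_induct)
  case (less m)
  interpret ct: coeff_hom "\<lambda>a :: complex fps. fps_nth a 0" by (rule coeff_hom_const_term)
  \<comment> \<open>Modulo \<open>t\<close> this derivative has a simple root at 0: its linear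
    coefficient is \<open>fact m\<close> times the coefficient of degree \<open>m\<close> of
    \<open>p\<close>.\<close>
  have "\<exists>a. fps_nth a 0 = 0 \<and> poly ((pderiv ^^ (m - 1)) p) a = 0"
  proof (rule fps_simple_root)
    show "fps_nth (coeff ((pderiv ^^ (m - 1)) p) 0) 0 = 0"
      using less.prems by (simp add: coeff_higher_pderiv ct.coeff_map)
    have "pochhammer (of_nat (Suc 1)) (m - 1) = (fps_const (fact m) :: complex fps)"
    proof -
      have "fact m = (pochhammer 1 (Suc (m - 1)) :: complex fps)"
        using less.prems(1) by (simp add: pochhammer_fact)
      then have "pochhammer (of_nat (Suc 1)) (m - 1) = (of_nat (fact m) :: complex fps)"
        by (simp add: pochhammer_rec)
      then show ?thesis by (simp only: fps_of_nat[symmetric] of_nat_fact)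
    qed
    then show "fps_nth (coeff ((pderiv ^^ (m - 1)) p) 1) 0 \<noteq> 0"
      using less.prems by (simp add: coeff_higher_pderiv ct.coeff_map)
  qed
  then obtain a where a: "fps_nth a 0 = 0" "poly ((pderiv ^^ (m - 1)) p) a = 0" by blast
  define A where "A = pcompose p [:a, 1:]"
  have root_p: "\<exists>y. fps_nth y 0 = 0 \<and> poly (ramify q p) y = 0"
    if q: "q > 0" and y: "fps_nth y 0 = 0" "poly (ramify q A) y = 0" for q y
  proof -
    interpret rh: coeff_hom "\<lambda>a :: complex fps. a oo fps_X ^ q" by (rule coeff_hom_ramify) fact
    have "poly (ramify q p) ((a oo fps_X ^ q) + y) = 0"
      using y(2) by (simp add: A_def rh.map_poly_pcompose poly_pcompose rh.map_pCons rh.hom_one)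
    then show ?thesis using y a by (intro exI[of _ "(a oo fps_X ^ q) + y"]) simp
  qed
  have "const_terms A = const_terms p"
    by (simp add: A_def ct.map_poly_pcompose ct.map_pCons a pcompose_idR)
  then have A: "\<forall>i<m. fps_nth (coeff A i) 0 = 0" "fps_nth (coeff A m) 0 \<noteq> 0"
    using less.prems by (simp_all add: ct.coeff_map[symmetric])
  have Am1: "coeff A (m - 1) = 0"
    using coeff_pcompose_shift[of "m - 1" p a] a by (simp add: A_def)
  show ?case
  proof (cases "\<forall>i<m. coeff A i = 0")
    case True
    then have "poly (ramify 1 A) 0 = 0" using less.prems(1) by (simp add: poly_0_coeff_0 coeff_map_poly)
    from root_p[OF _ _ this] show ?thesis using zero_less_one by fastforce
  next
    case False
    \<comment> \<open>\<open>sl i\<close> is minus the slope of the line from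
      \<open>(i, subdegree (coeff A i))\<close> to \<open>(m, 0)\<close>; its minimum
      \<open>s / q\<close> singles out the edge of the Newton polygon that ends at
      \<open>(m, 0)\<close>.\<close>
    define sl where "sl i = real (subdegree (coeff A i)) / real (m - i)" for i
    define I where "I = {i. i < m \<and> coeff A i \<noteq> 0}"
    have "finite I" "I \<noteq> {}" using False by (auto simp: I_def)
    then obtain i0 where i0: "i0 \<in> I" "\<And>i. i \<in> I \<Longrightarrow> sl i0 \<le> sl i"
      by (metis arg_min_if_finite(1) arg_min_least)
    define q where "q = m - i0"
    define s where "s = subdegree (coeff A i0)"
    have i0m: "i0 < m" "coeff A i0 \<noteq> 0" using i0 by (auto simp: I_def)
    have q0: "q > 0" using i0m by (simp add: q_def)
    have s0: "s > 0" using A(1) i0m unfolding s_def by (metis fps_nonzero_nth gr0I nth_subdegree_nonzero)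
    interpret rh: coeff_hom "\<lambda>a :: complex fps. a oo fps_X ^ q" by (rule coeff_hom_ramify) fact
    have slope: "s * (m - i) \<le> subdegree (coeff A i) * q" if "i < m" "coeff A i \<noteq> 0" for i
    proof -
      have "sl i0 \<le> sl i" using that i0 by (auto simp: I_def)
      then have "real s * real (m - i) \<le> real (subdegree (coeff A i)) * real q"
        using that i0m by (simp add: sl_def s_def q_def field_simps)
      then show ?thesis by (metis of_nat_le_iff of_nat_mult)
    qed
    \<comment> \<open>The coefficients of \<open>A\<close> after ramification by \<open>q\<close>,
      substitution of \<open>t^s y\<close> and division by \<open>t^(s m)\<close>. The two cases
      keep the exponents natural; for \<open>i < m\<close> the division is exact by
      \<open>slope\<close>.\<close>
    define b where "b i = (if i < m then fps_shift (s * (m - i)) (coeff A i oo fps_X ^ q)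
      else fps_X ^ (s * (i - m)) * (coeff A i oo fps_X ^ q))" for i
    define B where "B = Abs_poly b"
    have "coeff B = b"
    proof -
      have "\<forall>\<^sub>\<infinity>i. b i = 0"
        using MOST_coeff_eq_0[of A] unfolding cofinite_eq_sequentially[symmetric]
        by eventually_elim (auto simp: b_def)
      then show ?thesis by (simp add: B_def Abs_poly_inverse)
    qed
    have b: "b i * fps_X ^ (s * m) = (fps_X ^ s) ^ i * (coeff A i oo fps_X ^ q)" for i
    proof (cases "i < m")
      case True
      have "fps_X ^ (s * (m - i)) * b i = (coeff A i oo fps_X ^ q)"
      proof (cases "coeff A i = 0")
        case False
        then show ?thesis
          using slope[OF True False] q0 True
          by (simp add: b_def mult.commute[of "fps_X ^ (s * (m - i))"] fps_shift_times_fps_X_power)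
      qed (simp add: b_def)
      moreover have "s * m = s * i + s * (m - i)" using True by (simp add: diff_mult_distrib2)
      then have "b i * fps_X ^ (s * m) = fps_X ^ (s * i) * (fps_X ^ (s * (m - i)) * b i)"
        by (simp only: power_add mult_ac)
      ultimately show ?thesis by (simp only: power_mult)
    next
      case False
      then have "s * i = s * (i - m) + s * m" by (simp add: diff_mult_distrib2)
      then have "(fps_X ^ s) ^ i = (fps_X ^ (s * (i - m)) * fps_X ^ (s * m) :: complex fps)"
        by (simp only: power_mult[symmetric] power_add)
      then show ?thesis using False by (simp add: b_def mult_ac)
    qed
    have cB: "coeff (const_terms B) i = fps_nth (b i) 0" for i
      by (simp add: ct.coeff_map \<open>coeff B = b\<close>)
    have top: "coeff (const_terms B) i = 0" if "i > m" for i
      using that s0 by (simp add: cB b_def)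
    have cm: "coeff (const_terms B) m \<noteq> 0" using A by (simp add: cB b_def)
    have cm1: "coeff (const_terms B) (m - 1) = 0" using less.prems(1) Am1 by (simp add: cB b_def)
    have ci0: "coeff (const_terms B) i0 \<noteq> 0"
    proof -
      have "subdegree (coeff A i0 oo fps_X ^ q) = s * (m - i0)" using q0 by (simp add: s_def q_def)
      moreover have "coeff A i0 oo fps_X ^ q \<noteq> 0" using i0m q0 by (simp add: fps_compose_eq_0_iff)
      ultimately show ?thesis using i0m by (simp add: cB b_def) (metis nth_subdegree_nonzero)
    qed
    have degB: "degree (const_terms B) = m"
      using top cm by (intro antisym degree_le le_degree) auto
    obtain c where c: "poly (const_terms B) c = 0"
      using alg_closed_imp_poly_has_root[of "const_terms B"] degB less.prems(1) by auto
    define m' where "m' = order c (const_terms B)"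
    have cB0: "const_terms B \<noteq> 0" using degB less.prems(1) by auto
    obtain u where u: "const_terms B = [:-c, 1:] ^ m' * u" "\<not> [:-c, 1:] dvd u"
      using order_decomp[OF cB0] unfolding m'_def by blast
    have m'0: "m' > 0" using c cB0 by (simp add: m'_def order_root)
    have u0: "u \<noteq> 0" using u(2) by auto
    have deg_eq: "m = m' + degree u"
      using u u0 degB by (simp add: degree_mult_eq degree_linear_power)
    \<comment> \<open>If \<open>c\<close> were the only root, the reduction would be
      \<open>v (x - c)^m\<close>; the missing coefficient of degree \<open>m - 1\<close> would force
      \<open>c = 0\<close>, contrary to the nonzero coefficient at \<open>i0 < m\<close>.\<close>
    have "m' \<noteq> m"
    proof
      assume [simp]: "m' = m"
      then obtain v where v: "u = [:v:]" using deg_eq by (metis add_cancel_right_right degree_eq_zeroE)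
      have co: "coeff (const_terms B) i = v * (of_nat (m choose i) * (-c) ^ (m - i))" if "i \<le> m" for i
        using that by (simp add: u(1) v coeff_linear_poly_power mult_ac)
      have "c = 0" using co[of "m - 1"] cm1 less.prems(1) v u0 by auto
      then show False using co[of i0] ci0 i0m by simp
    qed
    then have m'm: "m' < m" using deg_eq by simp
    define C where "C = pcompose B [:fps_const c, 1:]"
    have pcompose_pow: "pcompose (r ^ k) w = pcompose r w ^ k" for r w :: "complex poly" and k
      by (induction k) (simp_all add: pcompose_1 pcompose_mult)
    have ctC: "const_terms C = monom 1 m' * pcompose u [:c, 1:]"
      by (simp add: C_def ct.map_poly_pcompose ct.map_pCons u(1) pcompose_mult pcompose_pow monom_altdef
         pcompose_pCons)
    have "\<exists>q' y. q' > 0 \<and> fps_nth y 0 = 0 \<and> poly (ramify q' C) y = 0"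
    proof (rule less.IH[OF m'm m'0])
      show "\<forall>i<m'. coeff (const_terms C) i = 0" using coeff_monom_lower(1)[OF ctC] .
      show "coeff (const_terms C) m' \<noteq> 0"
        unfolding coeff_monom_lower(2)[OF ctC] poly_0_coeff_0[symmetric] poly_pcompose
        using u(2) by (simp add: poly_eq_0_iff_dvd)
    qed
    then obtain q' y where y: "q' > 0" "fps_nth y 0 = 0" "poly (ramify q' C) y = 0" by blast
    interpret rh': coeff_hom "\<lambda>a :: complex fps. a oo fps_X ^ q'" by (rule coeff_hom_ramify) fact
    have "poly (ramify q' B) (fps_const c + y) = 0"
      using y(3) by (simp add: C_def rh'.map_poly_pcompose poly_pcompose rh'.map_pCons rh'.hom_one)
    moreover have "((fps_X ^ (s * m)) oo fps_X ^ q') * poly (ramify q' B) Y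
        = poly (ramify q' (ramify q A)) (((fps_X ^ s) oo fps_X ^ q') * Y)" for Y
    proof (rule poly_rescale)
      fix i
      have "(b i * fps_X ^ (s * m)) oo fps_X ^ q' = ((fps_X ^ s) ^ i * (coeff A i oo fps_X ^ q)) oo fps_X ^ q'"
        by (simp only: b)
      moreover have "((fps_X ^ s) ^ i :: complex fps) oo fps_X ^ q' = ((fps_X ^ s) oo fps_X ^ q') ^ i"
        using y(1) by (simp add: fps_compose_power)
      ultimately show "coeff (ramify q' B) i * (fps_X ^ (s * m) oo fps_X ^ q') =
         (fps_X ^ s oo fps_X ^ q') ^ i * coeff (ramify q' (ramify q A)) i"
        by (simp add: rh'.hom_mult rh'.coeff_map rh.coeff_map \<open>coeff B = b\<close>)
    qed
    ultimately have "poly (ramify (q * q') A) (((fps_X ^ s) oo fps_X ^ q') * (fps_const c + y)) = 0"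
      by (metis mult_zero_right ramify_ramify[OF q0 y(1)])
    from root_p[OF _ _ this] show ?thesis using q0 y(1) s0 by (intro exI[of _ "q * q'"]) auto
  qed
qed

section \<open>Inverse systems\<close>

text \<open>Elimination without division: after the choice of a pivot \<open>k\<close>,
  cross-multiplication clears the equation \<open>a\<close>. Working over a domain covers both
  complex coefficients and power series.\<close>

lemma homogeneous_system_nontrivial:
  fixes v :: "'i \<Rightarrow> 'a \<Rightarrow> 'r::idom"
  assumes "finite A" "finite I" "card A < card I"
  shows "\<exists>c. (\<exists>i\<in>I. c i \<noteq> 0) \<and> (\<forall>\<alpha>\<in>A. (\<Sum>i\<in>I. c i * v i \<alpha>) = 0)"
  using assms
proof (induction A arbitrary: I v rule: finite_induct)
  case empty
  then obtain i where "i \<in> I" by (metis card_gt_0_iff card.empty ex_in_conv)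
  then show ?case by (intro exI[of _ "\<lambda>_. 1"]) auto
next
  case (insert a A)
  show ?case
  proof (cases "\<forall>i\<in>I. v i a = 0")
    case True
    from insert.IH[of I v] insert.prems insert.hyps
    obtain c where "\<exists>i\<in>I. c i \<noteq> 0" "\<forall>\<alpha>\<in>A. (\<Sum>i\<in>I. c i * v i \<alpha>) = 0" by fastforce
    with True show ?thesis by (intro exI[of _ c]) auto
  next
    case False
    then obtain k where k: "k \<in> I" "v k a \<noteq> 0" by blast
    define J where "J = I - {k}"
    define w where "w i \<alpha> = v k a * v i \<alpha> - v i a * v k \<alpha>" for i \<alpha>
    have "card A < card J" using insert.prems insert.hyps k by (simp add: J_def)
    then obtain c where c: "\<exists>i\<in>J. c i \<noteq> 0" "\<forall>\<alpha>\<in>A. (\<Sum>i\<in>J. c i * w i \<alpha>) = 0"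
      using insert.IH[of J w] insert.prems by (auto simp: J_def)
    define d where "d i = (if i = k then - (\<Sum>i\<in>J. c i * v i a) else v k a * c i)" for i
    have "(\<Sum>i\<in>I. d i * v i \<alpha>) = (\<Sum>i\<in>J. c i * w i \<alpha>)" for \<alpha>
    proof -
      have "(\<Sum>i\<in>I. d i * v i \<alpha>) = d k * v k \<alpha> + (\<Sum>i\<in>J. d i * v i \<alpha>)"
        using insert.prems k by (simp add: J_def sum.remove)
      also have "(\<Sum>i\<in>J. d i * v i \<alpha>) = (\<Sum>i\<in>J. v k a * c i * v i \<alpha>)"
        by (rule sum.cong) (auto simp: d_def J_def)
      finally show ?thesis
        by (simp add: d_def w_def algebra_simps sum_subtractf sum_distrib_left sum_distrib_right)
    qed
    moreover have "(\<Sum>i\<in>J. c i * w i a) = 0" by (simp add: w_def mult.commute)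
    moreover have "\<exists>i\<in>I. d i \<noteq> 0" using c(1) k by (auto simp: d_def J_def)
    ultimately show ?thesis using c(2) by (intro exI[of _ d]) auto
  qed
qed

text \<open>A function on multi-indices is viewed as a linear functional on power series, sending
  \<open>z\<^sup>\<alpha>\<close> to its value at \<open>\<alpha>\<close>; multiplication by the coordinate \<open>z\<^sub>j\<close> then dualises to
  \<open>shift j\<close>.\<close>

definition inc :: "'n \<Rightarrow> ('n \<Rightarrow> nat) \<Rightarrow> 'n \<Rightarrow> nat" where
  "inc j \<alpha> = \<alpha>(j := Suc (\<alpha> j))"

definition shift :: "'n \<Rightarrow> (('n \<Rightarrow> nat) \<Rightarrow> 'c) \<Rightarrow> ('n \<Rightarrow> nat) \<Rightarrow> 'c" where
  "shift j f = (\<lambda>\<alpha>. f (inc j \<alpha>))"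

definition deg_le :: "nat \<Rightarrow> (('n::finite \<Rightarrow> nat) \<Rightarrow> 'c::zero) \<Rightarrow> bool" where
  "deg_le d f \<longleftrightarrow> (\<forall>\<alpha>. d < sum \<alpha> UNIV \<longrightarrow> f \<alpha> = 0)"

text \<open>The degree bound, which may vary with the element, makes each functional finitely
  supported and hence defined on power series, not only on polynomials.\<close>

definition inverse_system :: "(('n::finite \<Rightarrow> nat) \<Rightarrow> complex) set \<Rightarrow> bool" where
  "inverse_system N \<longleftrightarrow> (\<lambda>_. 0) \<in> N
     \<and> (\<forall>f\<in>N. \<forall>g\<in>N. \<forall>c. (\<lambda>\<alpha>. c * f \<alpha> + g \<alpha>) \<in> N)
     \<and> (\<forall>f\<in>N. \<forall>j. shift j f \<in> N) \<and> (\<forall>f\<in>N. \<exists>d. deg_le d f)"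

text \<open>For an inverse system this amounts to finite dimension.\<close>

definition bounded_system :: "(('n::finite \<Rightarrow> nat) \<Rightarrow> complex) set \<Rightarrow> bool" where
  "bounded_system N \<longleftrightarrow> (\<exists>d. \<forall>f\<in>N. deg_le d f)"

lemma sum_inc [simp]: "sum (inc j \<alpha>) UNIV = Suc (sum \<alpha> (UNIV :: 'n::finite set))"
proof -
  have "sum (inc j \<alpha>) UNIV = Suc (\<alpha> j) + sum (inc j \<alpha>) (UNIV - {j})"
    by (subst sum.remove[of _ j]) (auto simp: inc_def)
  also have "sum (inc j \<alpha>) (UNIV - {j}) = sum \<alpha> (UNIV - {j})" by (rule sum.cong) (auto simp: inc_def)
  also have "Suc (\<alpha> j) + \<dots> = Suc (sum \<alpha> UNIV)" by (subst sum.remove[of UNIV j \<alpha>]) auto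
  finally show ?thesis .
qed

lemma inc_commute: "inc i (inc j \<alpha>) = inc j (inc i \<alpha>)"
  by (auto simp: inc_def fun_eq_iff)

lemma deg_le_shift: "deg_le (Suc d) f \<Longrightarrow> deg_le d (shift j f)"
  by (simp add: deg_le_def shift_def)

lemma deg_le_mono: "deg_le d f \<Longrightarrow> d \<le> e \<Longrightarrow> deg_le e f"
  by (auto simp: deg_le_def)

lemma finite_multi_index: "finite {\<alpha> :: 'n::finite \<Rightarrow> nat. sum \<alpha> UNIV \<le> d}"
proof (rule finite_subset)
  show "{\<alpha> :: 'n \<Rightarrow> nat. sum \<alpha> UNIV \<le> d} \<subseteq> PiE UNIV (\<lambda>_. {..d})"
  proof
    fix \<alpha> :: "'n \<Rightarrow> nat" assume "\<alpha> \<in> {\<alpha>. sum \<alpha> UNIV \<le> d}"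
    then have "\<alpha> i \<le> d" for i using member_le_sum[of i UNIV \<alpha>] by simp
    then show "\<alpha> \<in> PiE UNIV (\<lambda>_. {..d})" by (auto simp: PiE_def)
  qed
qed (rule finite_PiE; simp)

lemma decrement_multi_index:
  fixes \<alpha> :: "'n::finite \<Rightarrow> nat"
  assumes "sum \<alpha> UNIV > 0"
  obtains j \<beta> where "\<alpha> = inc j \<beta>"
proof -
  obtain j where j: "\<alpha> j > 0" using assms by (metis gr0I less_irrefl sum.neutral)
  then have "\<alpha> = inc j (\<alpha>(j := \<alpha> j - 1))" by (auto simp: inc_def)
  with that show ?thesis by blast
qed

lemma multi_index_induct [case_names zero Suc]:
  fixes \<alpha> :: "'n::finite \<Rightarrow> nat"
  assumes "P (\<lambda>_. 0)" "\<And>\<beta> j. P \<beta> \<Longrightarrow> P (inc j \<beta>)"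
  shows "P \<alpha>"
proof (induction "sum \<alpha> UNIV" arbitrary: \<alpha>)
  case 0
  then have "\<alpha> = (\<lambda>_. 0)" by (auto simp: fun_eq_iff)
  then show ?case using assms by simp
next
  case (Suc n)
  then obtain j \<beta> where "\<alpha> = inc j \<beta>" by (metis decrement_multi_index zero_less_Suc)
  with Suc assms show ?case by (simp add: )
qed

text \<open>A shift in a coordinate that occurs in a top-degree index of the support lowers the
  degree by exactly one. Starting from an element of degree above \<open>d\<close>, this descends to
  \<open>d\<close>.\<close>

lemma exact_degree_element:
  assumes N: "inverse_system N" "\<not> bounded_system N"
  shows "\<exists>f\<in>N. deg_le d f \<and> (\<exists>\<alpha>. sum \<alpha> UNIV = d \<and> f \<alpha> \<noteq> 0)"
proof -
  have step: "\<exists>g\<in>N. deg_le d g \<and> (\<exists>\<alpha>. sum \<alpha> UNIV = d \<and> g \<alpha> \<noteq> 0)"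
    if "f \<in> N" "deg_le (d + k) f" "sum \<alpha> UNIV = d + k" "f \<alpha> \<noteq> 0" for f k \<alpha>
    using that
  proof (induction k arbitrary: f \<alpha>)
    case (Suc k)
    obtain j \<beta> where \<beta>: "\<alpha> = inc j \<beta>"
      using Suc.prems(3) by (metis add_Suc_right decrement_multi_index zero_less_Suc)
    show ?case
    proof (rule Suc.IH)
      show "shift j f \<in> N" using N(1) Suc.prems by (simp add: inverse_system_def)
      show "deg_le (d + k) (shift j f)" using Suc.prems by (simp add: deg_le_shift)
      show "sum \<beta> UNIV = d + k" using Suc.prems by (simp add: \<beta> )
      show "shift j f \<beta> \<noteq> 0" using Suc.prems by (simp add: \<beta> shift_def)
    qed
  qed auto
  obtain f where f: "f \<in> N" "\<not> deg_le d f" using N(2) by (auto simp: bounded_system_def)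
  define e where "e = (LEAST e. deg_le e f)"
  have e: "deg_le e f" using N(1) f unfolding e_def inverse_system_def by (metis LeastI_ex)
  have "d < e" using e f(2) deg_le_mono by (metis not_le)
  then have "\<not> deg_le (e - 1) f" unfolding e_def using not_less_Least[of "e - 1" "\<lambda>e. deg_le e f"]
    by (metis diff_less e_def less_nat_zero_code not_gr0 zero_less_one)
  then obtain \<alpha> where "e - 1 < sum \<alpha> UNIV" "f \<alpha> \<noteq> 0" by (auto simp: deg_le_def)
  moreover from this e have "sum \<alpha> UNIV \<le> e" by (auto simp: deg_le_def not_less[symmetric])
  ultimately have "sum \<alpha> UNIV = d + (e - d)" using \<open>d < e\<close> by linarith
  with step[of f "e - d" \<alpha>] f e \<open>f \<alpha> \<noteq> 0\<close> \<open>d < e\<close> show ?thesis by simp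
qed


section \<open>Minimal unbounded systems\<close>

lemma inverse_system_sum:
  assumes "inverse_system N" "finite I" "\<And>i. i \<in> I \<Longrightarrow> f i \<in> N"
  shows "(\<lambda>\<alpha>. \<Sum>i\<in>I. c i * f i \<alpha>) \<in> N"
  using assms(2,3)
proof (induction I rule: finite_induct)
  case (insert i I)
  then have "(\<lambda>\<alpha>. c i * f i \<alpha> + (\<Sum>i\<in>I. c i * f i \<alpha>)) \<in> N"
    using assms(1) by (simp add: inverse_system_def)
  with insert show ?case by simp
qed (use assms in \<open>simp add: inverse_system_def\<close>)

lemma inverse_system_scale: "inverse_system N \<Longrightarrow> f \<in> N \<Longrightarrow> (\<lambda>\<alpha>. c * f \<alpha>) \<in> N"
  using inverse_system_sum[of N "{()}" "\<lambda>_. f" "\<lambda>_. c"] by simp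

text \<open>The bounded-degree parts of the members of a chain are finite-dimensional, so they become
  stationary.\<close>

lemma chain_degree_part_minimal:
  fixes \<C> :: "(('n::finite \<Rightarrow> nat) \<Rightarrow> complex) set set"
  assumes "\<C> \<noteq> {}" and chain: "\<And>M N. M \<in> \<C> \<Longrightarrow> N \<in> \<C> \<Longrightarrow> M \<subseteq> N \<or> N \<subseteq> M"
    and sys: "\<And>N. N \<in> \<C> \<Longrightarrow> inverse_system N"
  shows "\<exists>N\<in>\<C>. \<forall>M\<in>\<C>. \<forall>x\<in>N. deg_le d x \<longrightarrow> x \<in> M"
proof -
  define indep where "indep k f \<longleftrightarrow> (\<forall>c. (\<forall>\<alpha>. (\<Sum>i<k. c i * f i \<alpha>) = 0) \<longrightarrow> (\<forall>i<k. c i = (0::complex)))"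
    for k :: nat and f :: "nat \<Rightarrow> ('n \<Rightarrow> nat) \<Rightarrow> complex"
  define fam where "fam N k f \<longleftrightarrow> indep k f \<and> (\<forall>i<k. f i \<in> N \<and> deg_le d (f i))" for N k f
  define A where "A = {\<alpha> :: 'n \<Rightarrow> nat. sum \<alpha> UNIV \<le> d}"
  have finA: "finite A" unfolding A_def by (rule finite_multi_index)
  have bound: "k \<le> card A" if "fam N k f" for N k f
  proof (rule ccontr)
    assume "\<not> k \<le> card A"
    then obtain c where c: "\<exists>i\<in>{..<k}. c i \<noteq> 0" "\<forall>\<alpha>\<in>A. (\<Sum>i<k. c i * f i \<alpha>) = 0"
      using homogeneous_system_nontrivial[OF finA, of "{..<k}" f] by auto
    have "(\<Sum>i<k. c i * f i \<alpha>) = 0" for \<alpha>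
    proof (cases "\<alpha> \<in> A")
      case False
      then show ?thesis using that by (auto simp: fam_def deg_le_def A_def intro!: sum.neutral)
    qed (use c in auto)
    with c that show False by (auto simp: fam_def indep_def)
  qed
  define rank where "rank N = (GREATEST k. \<exists>f. fam N k f)" for N
  have ex0: "\<exists>f. fam N 0 f" for N by (simp add: fam_def indep_def)
  have rank: "\<exists>f. fam N (rank N) f" for N
    unfolding rank_def by (rule GreatestI_ex_nat[where b = "card A"]) (use ex0 bound in blast)+
  have rank_max: "k \<le> rank N" if "fam N k f" for N k f
    unfolding rank_def by (rule Greatest_le_nat[where b = "card A"]) (use that bound in blast)+
  obtain N where N: "N \<in> \<C>" "\<And>M. M \<in> \<C> \<Longrightarrow> rank N \<le> rank M"
    using ex_has_least_nat[of "\<lambda>N. N \<in> \<C>" _ rank] assms(1) by blast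
  have "x \<in> M" if M: "M \<in> \<C>" and x: "x \<in> N" "deg_le d x" for M x
  proof (cases "N \<subseteq> M")
    case False
    then have MN: "M \<subseteq> N" using chain N M by blast
    obtain f where f: "fam M (rank M) f" using rank by blast
    define k where "k = rank M"
    \<comment> \<open>The rank is minimal at \<open>N\<close>, so \<open>x\<close> cannot enlarge a
      maximal independent family of \<open>M\<close>, all inside \<open>N\<close>; the resulting
      relation expresses \<open>x\<close> through elements of \<open>M\<close>.\<close>
    have "\<not> fam N (Suc k) (f(k := x))"
      using rank_max[of N "Suc k"] N(2)[OF M] by (auto simp: k_def)
    moreover have "\<forall>i<Suc k. (f(k := x)) i \<in> N \<and> deg_le d ((f(k := x)) i)"
      using f x MN by (auto simp: fam_def k_def less_Suc_eq)
    ultimately have "\<not> indep (Suc k) (f(k := x))" unfolding fam_def by blast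
    then obtain c where c: "\<And>\<alpha>. (\<Sum>i<Suc k. c i * (f(k := x)) i \<alpha>) = 0" "\<exists>i<Suc k. c i \<noteq> (0::complex)"
      unfolding indep_def by blast
    have eq: "(\<Sum>i<k. c i * f i \<alpha>) + c k * x \<alpha> = 0" for \<alpha>
      using c(1)[of \<alpha>] by simp
    have ck: "c k \<noteq> 0"
    proof
      assume "c k = 0"
      then have "\<forall>i<k. c i = 0" using eq f by (auto simp: fam_def indep_def k_def)
      with \<open>c k = 0\<close> c(2) show False by (auto simp: less_Suc_eq)
    qed
    have "x = (\<lambda>\<alpha>. \<Sum>i<k. (- c i / c k) * f i \<alpha>)"
    proof
      fix \<alpha>
      have "c k * x \<alpha> = - (\<Sum>i<k. c i * f i \<alpha>)" using eq[of \<alpha>] by (simp add: add_eq_0_iff)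
      then have "x \<alpha> = - (\<Sum>i<k. c i * f i \<alpha>) / c k" using ck by (simp add: field_simps)
      then show "x \<alpha> = (\<Sum>i<k. (- c i / c k) * f i \<alpha>)" by (simp add: sum_divide_distrib sum_negf)
    qed
    moreover have "(\<lambda>\<alpha>. \<Sum>i<k. (- c i / c k) * f i \<alpha>) \<in> M"
      using f by (intro inverse_system_sum sys M) (auto simp: fam_def k_def)
    ultimately show ?thesis by simp
  qed (use x in auto)
  with N(1) show ?thesis by blast
qed

text \<open>Zorn's lemma yields maximal elements, so it is applied to complements. The intersection
  of a chain stays unbounded: were it bounded by \<open>d\<close>, a member that is stationary in
  degree \<open>Suc d\<close> would have an element of exact degree \<open>Suc d\<close>, and this
  element lies in every member.\<close>

lemma minimal_unbounded_system:
  assumes N0: "inverse_system N0" "\<not> bounded_system N0"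
  shows "\<exists>N\<subseteq>N0. inverse_system N \<and> \<not> bounded_system N
    \<and> (\<forall>M\<subseteq>N. inverse_system M \<longrightarrow> \<not> bounded_system M \<longrightarrow> M = N)"
proof -
  define \<A> where "\<A> = {- N | N. inverse_system N \<and> \<not> bounded_system N \<and> N \<subseteq> N0}"
  have "\<exists>M\<in>\<A>. \<forall>X\<in>\<A>. M \<subseteq> X \<longrightarrow> X = M"
  proof (rule subset_Zorn_nonempty)
    show "\<A> \<noteq> {}" using N0 by (auto simp: \<A>_def)
  next
    fix \<K> assume \<K>: "\<K> \<noteq> {}" "subset.chain \<A> \<K>"
    define \<C> where "\<C> = uminus ` \<K>"
    have \<C>: "\<C> \<noteq> {}" "\<And>N. N \<in> \<C> \<Longrightarrow> inverse_system N \<and> \<not> bounded_system N \<and> N \<subseteq> N0"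
      using \<K> by (auto simp: \<C>_def \<A>_def subset.chain_def)
    have chain: "\<And>M N. M \<in> \<C> \<Longrightarrow> N \<in> \<C> \<Longrightarrow> M \<subseteq> N \<or> N \<subseteq> M"
      using \<K>(2) unfolding \<C>_def subset.chain_def by blast
    define I where "I = \<Inter>\<C>"
    have "inverse_system I"
      using \<C> unfolding I_def inverse_system_def by blast
    moreover have "\<not> bounded_system I"
    proof
      assume "bounded_system I"
      then obtain d where d: "\<And>f. f \<in> I \<Longrightarrow> deg_le d f" by (auto simp: bounded_system_def)
      obtain N where N: "N \<in> \<C>" "\<And>M x. M \<in> \<C> \<Longrightarrow> x \<in> N \<Longrightarrow> deg_le (Suc d) x \<Longrightarrow> x \<in> M"
        using chain_degree_part_minimal[of \<C> "Suc d"] \<C> chain by metis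
      obtain f \<alpha> where f: "f \<in> N" "deg_le (Suc d) f" "sum \<alpha> UNIV = Suc d" "f \<alpha> \<noteq> 0"
        using exact_degree_element[of N "Suc d"] \<C>(2)[OF N(1)] by blast
      then have "f \<in> I" using N(2) by (auto simp: I_def)
      from d[OF this] f show False by (auto simp: deg_le_def)
    qed
    moreover have "I \<subseteq> N0" using \<C> by (auto simp: I_def)
    ultimately have "- I \<in> \<A>" by (auto simp: \<A>_def)
    moreover have "\<Union>\<K> = - I" by (auto simp: I_def \<C>_def)
    ultimately show "\<Union>\<K> \<in> \<A>" by simp
  qed
  then obtain N where N: "- N \<in> \<A>" "\<And>X. X \<in> \<A> \<Longrightarrow> - N \<subseteq> X \<Longrightarrow> X = - N"
    by (metis double_compl)
  have mem: "- M \<in> \<A> \<longleftrightarrow> inverse_system M \<and> \<not> bounded_system M \<and> M \<subseteq> N0" for M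
    by (auto simp: \<A>_def)
  show ?thesis
  proof (intro exI[of _ N] conjI allI impI)
    fix M assume M: "M \<subseteq> N" "inverse_system M" "\<not> bounded_system M"
    then have "- M \<in> \<A>" using N(1) by (auto simp: mem)
    from N(2)[OF this] M(1) show "M = N" by auto
  qed (use N(1) in \<open>auto simp: mem\<close>)
qed

section \<open>The coordinates on a minimal system\<close>

lemma deg_le_Suc_of_shifts:
  fixes f :: "('n::finite \<Rightarrow> nat) \<Rightarrow> complex"
  assumes "\<And>j. deg_le d (shift j f)"
  shows "deg_le (Suc d) f"
  unfolding deg_le_def
proof (intro allI impI)
  fix \<alpha> :: "'n \<Rightarrow> nat" assume \<alpha>: "Suc d < sum \<alpha> UNIV"
  then obtain j \<beta> where "\<alpha> = inc j \<beta>" by (metis decrement_multi_index less_zeroE neq0_conv)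
  with assms[of j] \<alpha> show "f \<alpha> = 0" by (auto simp: deg_le_def shift_def )
qed

lemma shift_commute: "shift i (shift j f) = shift j (shift i f)"
  by (simp add: shift_def inc_commute)

lemma shift_linear:
  "shift j (\<lambda>\<alpha>. c * f \<alpha> + g \<alpha>) = (\<lambda>\<alpha>. c * shift j f \<alpha> + shift j g \<alpha>)"
  by (simp add: shift_def)

lemma shift_zero: "shift j (\<lambda>_. 0) = (\<lambda>_. 0)"
  by (simp add: shift_def)

lemma inverse_system_image_shift:
  assumes "inverse_system N"
  shows "inverse_system (shift j ` N)"
  unfolding inverse_system_def
proof (intro conjI ballI allI)
  show "(\<lambda>_. 0) \<in> shift j ` N"
    using assms by (intro image_eqI[of _ _ "\<lambda>_. 0"]) (simp_all add: shift_zero inverse_system_def)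
next
  fix f g c assume "f \<in> shift j ` N" "g \<in> shift j ` N"
  then obtain f' g' where *: "f' \<in> N" "g' \<in> N" "f = shift j f'" "g = shift j g'" by blast
  show "(\<lambda>\<alpha>. c * f \<alpha> + g \<alpha>) \<in> shift j ` N"
    by (rule image_eqI[of _ _ "\<lambda>\<alpha>. c * f' \<alpha> + g' \<alpha>"])
       (use * assms in \<open>simp_all add: shift_linear inverse_system_def\<close>)
next
  fix f i assume "f \<in> shift j ` N"
  then obtain f' where *: "f' \<in> N" "f = shift j f'" by blast
  show "shift i f \<in> shift j ` N"
    by (rule image_eqI[of _ _ "shift i f'"])
       (use * assms in \<open>simp_all add: shift_commute[of i j] inverse_system_def\<close>)
next
  fix f assume "f \<in> shift j ` N"
  then obtain f' where *: "f' \<in> N" "f = shift j f'" by blast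
  then obtain d where "deg_le d f'" using assms by (auto simp: inverse_system_def)
  then have "deg_le d f" unfolding * by (intro deg_le_shift) (auto intro: deg_le_mono)
  then show "\<exists>d. deg_le d f" ..
qed

lemma inverse_system_kernel_shift:
  assumes "inverse_system N"
  shows "inverse_system {f\<in>N. shift j f = (\<lambda>_. 0)}"
proof -
  have "shift j (shift i f) = (\<lambda>_. 0)" if "shift j f = (\<lambda>_. 0)" for i and f :: "('a \<Rightarrow> nat) \<Rightarrow> complex"
    using that by (simp add: shift_commute[of j i] shift_zero)
  with assms show ?thesis unfolding inverse_system_def by (simp add: shift_linear shift_zero)
qed

text \<open>By minimality every subsystem is bounded or everything. The degree of \<open>f\<close>
  exceeds those of its shifts by at most one, so some coordinate has an unbounded image, which is
  then all of \<open>N\<close>. Its kernel is bounded, since otherwise it would be all of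
  \<open>N\<close> and the image would be zero.\<close>

lemma surjective_shift_finite_kernel:
  fixes N0 :: "(('n::finite \<Rightarrow> nat) \<Rightarrow> complex) set"
  assumes "inverse_system N0" "\<not> bounded_system N0"
  obtains N j d where "N \<subseteq> N0" "inverse_system N" "\<not> bounded_system N" "shift j ` N = N"
    "\<And>f. f \<in> N \<Longrightarrow> shift j f = (\<lambda>_. 0) \<Longrightarrow> deg_le d f"
proof -
  obtain N where N: "N \<subseteq> N0" "inverse_system N" "\<not> bounded_system N"
    "\<And>M. M \<subseteq> N \<Longrightarrow> inverse_system M \<Longrightarrow> \<not> bounded_system M \<Longrightarrow> M = N"
    using minimal_unbounded_system[OF assms] by blast
  have sub: "shift j ` N \<subseteq> N" for j using N(2) by (auto simp: inverse_system_def)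
  have "\<exists>j. \<not> bounded_system (shift j ` N)"
  proof (rule ccontr)
    assume "\<not> ?thesis"
    then have "\<forall>j. \<exists>d. \<forall>f\<in>N. deg_le d (shift j f)" by (auto simp: bounded_system_def)
    then obtain d where d: "\<And>j f. f \<in> N \<Longrightarrow> deg_le (d j) (shift j f)" by metis
    have "deg_le (Suc (Max (range d))) f" if "f \<in> N" for f
      by (rule deg_le_Suc_of_shifts) (auto intro: deg_le_mono[OF d[OF that]])
    then show False using N(3) by (auto simp: bounded_system_def)
  qed
  then obtain j where j: "\<not> bounded_system (shift j ` N)" by blast
  have surj: "shift j ` N = N" using N(4)[OF sub inverse_system_image_shift[OF N(2)] j] .
  have "bounded_system {f\<in>N. shift j f = (\<lambda>_. 0)}"
  proof (rule ccontr)
    assume "\<not> ?thesis"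
    from N(4)[OF _ inverse_system_kernel_shift[OF N(2)] this]
    have "\<forall>f\<in>N. shift j f = (\<lambda>_. 0)" by blast
    then have "\<forall>g\<in>shift j ` N. g = (\<lambda>_. 0)" by blast
    then have "N \<subseteq> {\<lambda>_. 0}" unfolding surj by blast
    then show False using N(3) by (auto simp: bounded_system_def deg_le_def)
  qed
  then obtain d where "\<And>f. f \<in> N \<Longrightarrow> shift j f = (\<lambda>_. 0) \<Longrightarrow> deg_le d f"
    by (auto simp: bounded_system_def)
  with that N surj show ?thesis by blast
qed

section \<open>Common eigenvectors\<close>

text \<open>The polynomial \<open>p\<close> evaluated at the operator \<open>shift j\<close>, whose
  \<open>i\<close>-th iterate is composition with \<open>inc j ^^ i\<close>; the scalars are power
  series in \<open>t\<close>.\<close>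

definition act :: "complex fps poly \<Rightarrow> 'n \<Rightarrow> (('n \<Rightarrow> nat) \<Rightarrow> complex fps) \<Rightarrow> ('n \<Rightarrow> nat) \<Rightarrow> complex fps" where
  "act p j L = (\<lambda>\<alpha>. \<Sum>i\<le>degree p. coeff p i * L ((inc j ^^ i) \<alpha>))"

definition ram :: "nat \<Rightarrow> ('a \<Rightarrow> complex fps) \<Rightarrow> 'a \<Rightarrow> complex fps" where
  "ram q L = (\<lambda>\<alpha>. L \<alpha> oo fps_X ^ q)"

text \<open>Reads \<open>L\<close> as a power series in \<open>t\<close> whose coefficients are
  functionals, that is, as an element of \<open>N[[t]]\<close>.\<close>

definition coeffs_in :: "(('n \<Rightarrow> nat) \<Rightarrow> complex) set \<Rightarrow> (('n \<Rightarrow> nat) \<Rightarrow> complex fps) \<Rightarrow> bool" where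
  "coeffs_in N L \<longleftrightarrow> (\<forall>k. (\<lambda>\<alpha>. fps_nth (L \<alpha>) k) \<in> N)"

lemma act_eq_sum:
  "degree p \<le> n \<Longrightarrow> act p j L \<alpha> = (\<Sum>i\<le>n. coeff p i * L ((inc j ^^ i) \<alpha>))"
  unfolding act_def by (rule sum.mono_neutral_left) (auto simp: coeff_eq_0)

lemma inc_funpow_commute: "(inc i ^^ a) ((inc j ^^ b) \<alpha>) = (inc j ^^ b) ((inc i ^^ a) \<alpha>)"
proof -
  have 1: "inc i ((inc j ^^ b) \<beta>) = (inc j ^^ b) (inc i \<beta>)" for \<beta>
    by (induction b) (simp_all add: inc_commute[of i j])
  show ?thesis by (induction a) (simp_all add: 1)
qed

lemma sum_inc_funpow: "sum ((inc j ^^ i) \<alpha>) UNIV = sum \<alpha> (UNIV :: 'n::finite set) + i"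
  by (induction i) simp_all

lemma shift_act: "shift i (act p j L) = act p j (shift i L)"
  using inc_funpow_commute[where i = i and a = 1] by (simp add: act_def shift_def)

lemma act_commute: "act p i (act q j L) = act q j (act p i L)"
  unfolding act_def sum_distrib_left
  by (subst sum.swap) (simp add: mult_ac inc_funpow_commute[where i = i and j = j])

lemma act_scale: "act p j (\<lambda>\<alpha>. y * L \<alpha>) = (\<lambda>\<alpha>. y * act p j L \<alpha>)"
  by (simp add: act_def sum_distrib_left mult_ac)

lemma act_zero: "act p j (\<lambda>_. 0) = (\<lambda>_. 0)"
  by (simp add: act_def)

text \<open>Serves to split off a root: if the product annihilates \<open>L\<close> while
  \<open>p\<close> does not, then \<open>act p j L\<close> is an eigenvector with eigenvalue
  \<open>y\<close>.\<close>

lemma act_linear_factor: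
  "act ([:- y, 1:] * p) j L = (\<lambda>\<alpha>. shift j (act p j L) \<alpha> - y * act p j L \<alpha>)"
proof
  fix \<alpha>
  define n where "n = degree p"
  have deg: "degree ([:- y, 1:] * p) \<le> Suc n"
    using degree_mult_le[of "[:- y, 1:]" p] by (simp add: n_def)
  have co: "coeff ([:- y, 1:] * p) i = coeff (pCons 0 p) i - y * coeff p i" for i
    by simp
  have "act ([:- y, 1:] * p) j L \<alpha> = (\<Sum>i\<le>Suc n. coeff (pCons 0 p) i * L ((inc j ^^ i) \<alpha>))
      - y * (\<Sum>i\<le>Suc n. coeff p i * L ((inc j ^^ i) \<alpha>))"
    unfolding act_eq_sum[OF deg] co by (simp add: left_diff_distrib sum_subtractf sum_distrib_left mult.assoc del: sum.atMost_Suc)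
  also have "(\<Sum>i\<le>Suc n. coeff (pCons 0 p) i * L ((inc j ^^ i) \<alpha>)) = shift j (act p j L) \<alpha>"
    unfolding sum.atMost_Suc_shift by (simp add: act_def shift_def n_def funpow_swap1)
  also have "(\<Sum>i\<le>Suc n. coeff p i * L ((inc j ^^ i) \<alpha>)) = act p j L \<alpha>"
    by (rule act_eq_sum[symmetric]) (simp add: n_def)
  finally show "act ([:- y, 1:] * p) j L \<alpha> = shift j (act p j L) \<alpha> - y * act p j L \<alpha>" .
qed

lemma act_ram:
  assumes "q > 0"
  shows "act (ramify q p) j (ram q L) = ram q (act p j L)"
proof
  fix \<alpha>
  interpret rh: coeff_hom "\<lambda>a :: complex fps. a oo fps_X ^ q" by (rule coeff_hom_ramify) fact
  have "degree (ramify q p) \<le> degree p" by (rule degree_le) (simp add: coeff_map_poly coeff_eq_0)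
  then show "act (ramify q p) j (ram q L) \<alpha> = ram q (act p j L) \<alpha>"
    by (simp add: act_eq_sum) (simp add: ram_def act_def fps_compose_sum_distrib rh.coeff_map rh.hom_mult)
qed

lemma shift_ram: "shift j (ram q L) = ram q (shift j L)"
  by (simp add: shift_def ram_def)

lemma ram_scale: "q > 0 \<Longrightarrow> ram q (\<lambda>\<alpha>. y * L \<alpha>) = (\<lambda>\<alpha>. (y oo fps_X ^ q) * ram q L \<alpha>)"
  by (simp add: ram_def fps_compose_mult_distrib)

lemma ram_zero: "ram q (\<lambda>_. 0) = (\<lambda>_. 0)"
  by (simp add: ram_def)

lemma ram_nonzero: "q > 0 \<Longrightarrow> L \<noteq> (\<lambda>_. 0) \<Longrightarrow> ram q L \<noteq> (\<lambda>_. 0)"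
  by (auto simp: ram_def fun_eq_iff fps_compose_eq_0_iff)

lemma ram_ram: "q > 0 \<Longrightarrow> q' > 0 \<Longrightarrow> ram q' (ram q L) = ram (q * q') L"
  by (simp add: ram_def fps_compose_assoc[symmetric] fps_X_power_compose power_mult[symmetric] mult.commute)

lemma coeffs_in_ram:
  assumes "inverse_system N" "q > 0" "coeffs_in N L"
  shows "coeffs_in N (ram q L)"
  unfolding coeffs_in_def
proof
  fix k
  show "(\<lambda>\<alpha>. fps_nth (ram q L \<alpha>) k) \<in> N"
    using assms by (cases "q dvd k") (auto simp: coeffs_in_def ram_def fps_nth_compose_X_power inverse_system_def)
qed

lemma coeffs_in_sum_fps:
  assumes N: "inverse_system N" and "finite I" "\<And>i. i \<in> I \<Longrightarrow> coeffs_in N (L i)"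
  shows "coeffs_in N (\<lambda>\<alpha>. \<Sum>i\<in>I. c i * L i \<alpha>)"
  unfolding coeffs_in_def fps_sum_nth fps_mult_nth sum.Sigma[OF assms(2) ballI[OF finite_atLeastAtMost]]
proof
  fix k
  have "(\<lambda>\<alpha>. \<Sum>x\<in>(SIGMA i:I. {0..k}). fps_nth (c (fst x)) (snd x) * fps_nth (L (fst x) \<alpha>) (k - snd x)) \<in> N"
    using assms
    by (intro inverse_system_sum[where f = "\<lambda>x \<alpha>. fps_nth (L (fst x) \<alpha>) (k - snd x)"]) (auto simp: coeffs_in_def)
  then show "(\<lambda>\<alpha>. \<Sum>(i, s)\<in>(SIGMA i:I. {0..k}). fps_nth (c i) s * fps_nth (L i \<alpha>) (k - s)) \<in> N"
    by (simp add: case_prod_unfold)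
qed

lemma coeffs_in_shift:
  assumes "inverse_system N" "coeffs_in N L"
  shows "coeffs_in N (shift j L)"
proof -
  have "(\<lambda>\<alpha>. fps_nth (shift j L \<alpha>) k) = shift j (\<lambda>\<alpha>. fps_nth (L \<alpha>) k)" for k by (simp add: shift_def)
  then show ?thesis using assms by (simp add: coeffs_in_def inverse_system_def)
qed

lemma shift_apply: "shift j f \<alpha> = f (inc j \<alpha>)"
  by (simp add: shift_def)

lemma shift_funpow: "(shift j ^^ i) L \<alpha> = L ((inc j ^^ i) \<alpha>)"
proof (induction i arbitrary: \<alpha>)
  case (Suc i)
  have "(shift j ^^ Suc i) L \<alpha> = (shift j ^^ i) L (inc j \<alpha>)" by (simp add: shift_apply)
  also have "\<dots> = L ((inc j ^^ i) (inc j \<alpha>))" by (rule Suc.IH)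
  finally show ?case by (simp add: funpow_swap1)
qed simp

lemma coeffs_in_shift_funpow:
  assumes "inverse_system N" "coeffs_in N L"
  shows "coeffs_in N ((shift j ^^ i) L)"
  by (induction i) (simp_all add: assms coeffs_in_shift)

lemma coeffs_in_act:
  assumes "inverse_system N" "coeffs_in N L"
  shows "coeffs_in N (act p j L)"
  unfolding act_def shift_funpow[symmetric]
  by (intro coeffs_in_sum_fps coeffs_in_shift_funpow assms) simp

text \<open>Take the lowest nonzero coefficient of \<open>L\<close> in \<open>t\<close> and an index
  of top degree in its finite support. The terms with \<open>i > 0\<close> read this coefficient in
  higher degree, where it is zero, so only the constant coefficient of \<open>p\<close> survives.
  This makes the multiplicity passed to \<open>ramified_root\<close> positive.\<close>

lemma act_zero_const_term:
  fixes L :: "('n::finite \<Rightarrow> nat) \<Rightarrow> complex fps"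
  assumes N: "inverse_system N" and L: "coeffs_in N L" "L \<noteq> (\<lambda>_. 0)" and p: "act p j L = (\<lambda>_. 0)"
  shows "fps_nth (coeff p 0) 0 = 0"
proof -
  have "\<exists>k \<alpha>. fps_nth (L \<alpha>) k \<noteq> 0" using L(2) by (auto simp: fun_eq_iff fps_eq_iff)
  define k where "k = (LEAST k. \<exists>\<alpha>. fps_nth (L \<alpha>) k \<noteq> 0)"
  have k: "\<exists>\<alpha>. fps_nth (L \<alpha>) k \<noteq> 0" unfolding k_def by (rule LeastI_ex) fact
  have less: "fps_nth (L \<alpha>) i = 0" if "i < k" for i \<alpha>
    using not_less_Least[of i "\<lambda>k. \<exists>\<alpha>. fps_nth (L \<alpha>) k \<noteq> 0"] that by (auto simp: k_def)
  obtain d where d: "deg_le d (\<lambda>\<alpha>. fps_nth (L \<alpha>) k)" using N L unfolding coeffs_in_def inverse_system_def by blast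
  define S where "S = {\<alpha>. fps_nth (L \<alpha>) k \<noteq> 0}"
  have "finite S"
    by (rule finite_subset[OF _ finite_multi_index[of d]]) (use d in \<open>force simp: S_def deg_le_def not_less[symmetric]\<close>)
  moreover have "S \<noteq> {}" using k by (auto simp: S_def)
  ultimately obtain \<alpha> where \<alpha>: "\<alpha> \<in> S" "\<And>\<beta>. \<beta> \<in> S \<Longrightarrow> sum \<beta> UNIV \<le> sum \<alpha> UNIV"
    using Max_in[of "(\<lambda>\<alpha>. sum \<alpha> UNIV) ` S"] Max_ge[of "(\<lambda>\<alpha>. sum \<alpha> UNIV) ` S"]
    by (metis (no_types, lifting) finite_imageI image_iff image_is_empty)
  have "fps_nth (coeff p i * L ((inc j ^^ i) \<alpha>)) k = (if i = 0 then fps_nth (coeff p 0) 0 * fps_nth (L \<alpha>) k else 0)" for i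
  proof -
    have "fps_nth (coeff p i * L ((inc j ^^ i) \<alpha>)) k
        = (\<Sum>s\<in>{0..k}. if s = 0 then fps_nth (coeff p i) 0 * fps_nth (L ((inc j ^^ i) \<alpha>)) k else 0)"
      unfolding fps_mult_nth by (rule sum.cong) (auto simp: less)
    also have "\<dots> = fps_nth (coeff p i) 0 * fps_nth (L ((inc j ^^ i) \<alpha>)) k" by simp
    also have "fps_nth (L ((inc j ^^ i) \<alpha>)) k = 0" if "i > 0"
      using \<alpha>(2)[of "(inc j ^^ i) \<alpha>"] that by (auto simp: S_def sum_inc_funpow)
    ultimately show ?thesis by auto
  qed
  then have "fps_nth (act p j L \<alpha>) k = fps_nth (coeff p 0) 0 * fps_nth (L \<alpha>) k"
    by (simp add: act_def fps_sum_nth)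
  with p \<alpha>(1) show ?thesis by (simp add: S_def)
qed

text \<open>After ramification \<open>p\<close> has a root \<open>y\<close> without constant term,
  and \<open>x - y\<close> splits off. If the cofactor does not annihilate \<open>L\<close>, it maps
  \<open>L\<close> to an eigenvector; otherwise it replaces \<open>p\<close> and has smaller
  degree.\<close>

lemma eigenvector_step:
  fixes L :: "('n::finite \<Rightarrow> nat) \<Rightarrow> complex fps"
  assumes N: "inverse_system N"
  assumes "coeffs_in N L" "L \<noteq> (\<lambda>_. 0)" "p \<noteq> 0" "act p j L = (\<lambda>_. 0)"
  shows "\<exists>q g y. q > 0 \<and> fps_nth y 0 = 0 \<and> act g j (ram q L) \<noteq> (\<lambda>_. 0)
    \<and> shift j (act g j (ram q L)) = (\<lambda>\<alpha>. y * act g j (ram q L) \<alpha>)"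
  using assms(2-)
proof (induction "degree p" arbitrary: p L rule: less_induct)
  case less
  \<comment> \<open>The largest power of \<open>t\<close> dividing \<open>p\<close> is removed, so
    that the reduction modulo \<open>t\<close> is nonzero, as \<open>ramified_root\<close> requires.
    The annihilation of \<open>L\<close> persists because its values lie in a domain.\<close>
  define k where "k = (LEAST k. \<exists>i. fps_nth (coeff p i) k \<noteq> 0)"
  have "\<exists>k i. fps_nth (coeff p i) k \<noteq> 0" using less.prems by (auto simp: poly_eq_iff fps_eq_iff)
  then have k: "\<exists>i. fps_nth (coeff p i) k \<noteq> 0" unfolding k_def by (rule LeastI_ex)
  have lessk: "fps_nth (coeff p i) s = 0" if "s < k" for i s
    using not_less_Least[of s "\<lambda>k. \<exists>i. fps_nth (coeff p i) k \<noteq> 0"] that by (auto simp: k_def)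
  define p' where "p' = map_poly (fps_shift k) p"
  have p': "coeff p i = fps_X ^ k * coeff p' i" for i
    by (rule fps_ext) (simp add: p'_def coeff_map_poly fps_X_power_mult_nth lessk)
  have degp': "degree p' \<le> degree p" unfolding p'_def by (rule degree_le) (simp add: coeff_map_poly coeff_eq_0)
  have "act p j L = (\<lambda>\<alpha>. fps_X ^ k * act p' j L \<alpha>)"
    by (rule ext) (simp add: act_eq_sum[OF degp'], simp add: act_def p' sum_distrib_left mult_ac)
  then have actp': "act p' j L = (\<lambda>_. 0)" using less.prems(4) by (auto simp: fun_eq_iff)
  interpret ct: coeff_hom "\<lambda>a :: complex fps. fps_nth a 0" by (rule coeff_hom_const_term)
  define m where "m = (LEAST m. coeff (const_terms p') m \<noteq> 0)"
  have ex: "\<exists>m. coeff (const_terms p') m \<noteq> 0"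
    using k by (auto simp: ct.coeff_map p'_def coeff_map_poly)
  then have m: "coeff (const_terms p') m \<noteq> 0" unfolding m_def by (rule LeastI_ex)
  have mless: "\<forall>i<m. coeff (const_terms p') i = 0" using not_less_Least by (auto simp: m_def)
  have "m > 0" using m act_zero_const_term[OF N less.prems(1,2) actp'] by (cases m) (auto simp: ct.coeff_map)
  with ramified_root[of m p'] m mless obtain q y where
    qy: "q > 0" "fps_nth y 0 = 0" "poly (ramify q p') y = 0" by blast
  interpret rh: coeff_hom "\<lambda>a :: complex fps. a oo fps_X ^ q" by (rule coeff_hom_ramify) fact
  obtain p1 where p1: "ramify q p' = [:- y, 1:] * p1" using qy(3) by (auto simp: poly_eq_0_iff_dvd elim: dvdE)
  have "coeff (ramify q p') m \<noteq> 0" using m by (auto simp: rh.coeff_map ct.coeff_map fps_eq_iff intro!: exI[of _ 0])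
  then have "p1 \<noteq> 0" using p1 by auto
  then have "degree (ramify q p') = Suc (degree p1)" unfolding p1 by (subst degree_mult_eq) auto
  moreover have "degree (ramify q p') \<le> degree p'" by (rule degree_le) (simp add: coeff_map_poly coeff_eq_0)
  ultimately have deg: "degree p1 < degree p" using degp' by simp
  have act0: "act (ramify q p') j (ram q L) = (\<lambda>_. 0)"
    unfolding act_ram[OF qy(1)] actp' ram_zero ..
  show ?case
  proof (cases "act p1 j (ram q L) = (\<lambda>_. 0)")
    case False
    have "shift j (act p1 j (ram q L)) = (\<lambda>\<alpha>. y * act p1 j (ram q L) \<alpha>)"
      using act0 unfolding p1 act_linear_factor by (simp add: fun_eq_iff)
    with False qy show ?thesis by blast
  next
    case True
    obtain q' g y' where "q' > 0" "fps_nth y' 0 = 0" "act g j (ram q' (ram q L)) \<noteq> (\<lambda>_. 0)"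
      "shift j (act g j (ram q' (ram q L))) = (\<lambda>\<alpha>. y' * act g j (ram q' (ram q L)) \<alpha>)"
      using less.hyps[OF deg _ _ \<open>p1 \<noteq> 0\<close> True] coeffs_in_ram[OF N qy(1) less.prems(1)]
        ram_nonzero[OF qy(1) less.prems(2)] by blast
    then show ?thesis unfolding ram_ram[OF qy(1) \<open>q' > 0\<close>] using qy(1) by (metis nat_0_less_mult_iff)
  qed
qed

text \<open>The coordinates commute, so applying a polynomial in one of them preserves the
  eigenvector equations and the algebraic relations already at hand. A ramification by
  \<open>q\<close> only substitutes into the eigenvalues and turns the exponent \<open>s\<close>
  into \<open>q * s\<close>.\<close>

lemma simultaneous_eigenvector:
  fixes L0 :: "('n::finite \<Rightarrow> nat) \<Rightarrow> complex fps"
  assumes N: "inverse_system N"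
    and L0: "coeffs_in N L0" "L0 \<noteq> (\<lambda>_. 0)" "shift j0 L0 = (\<lambda>\<alpha>. fps_X * L0 \<alpha>)"
    and alg: "\<And>j. \<exists>p. p \<noteq> 0 \<and> act p j L0 = (\<lambda>_. 0)"
  shows "\<exists>L y s. coeffs_in N L \<and> L \<noteq> (\<lambda>_. 0) \<and> s > 0 \<and> shift j0 L = (\<lambda>\<alpha>. fps_X ^ s * L \<alpha>)
    \<and> (\<forall>j. fps_nth (y j) 0 = 0 \<and> shift j L = (\<lambda>\<alpha>. y j * L \<alpha>))"
proof -
  define good where "good J L y s \<longleftrightarrow> coeffs_in N L \<and> L \<noteq> (\<lambda>_. 0) \<and> s > 0 \<and> shift j0 L = (\<lambda>\<alpha>. fps_X ^ s * L \<alpha>)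
    \<and> (\<forall>j. \<exists>p. p \<noteq> 0 \<and> act p j L = (\<lambda>_. 0)) \<and> (\<forall>j\<in>J. fps_nth (y j) 0 = 0 \<and> shift j L = (\<lambda>\<alpha>. y j * L \<alpha>))"
    for J L y and s :: nat
  have "\<exists>L y s. good J L y s" for J :: "'n set"
  proof (induction J rule: finite_induct[OF finite])
    case 1
    have "good {} L0 (\<lambda>_. 0) 1" using L0 alg by (simp add: good_def)
    then show ?case by blast
  next
    case (2 j J)
    then obtain L y s where L: "good J L y s" by blast
    then obtain p where p: "p \<noteq> 0" "act p j L = (\<lambda>_. 0)" by (auto simp: good_def)
    obtain q g z where q: "q > 0" "fps_nth z 0 = 0" "act g j (ram q L) \<noteq> (\<lambda>_. 0)"
      "shift j (act g j (ram q L)) = (\<lambda>\<alpha>. z * act g j (ram q L) \<alpha>)"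
      using eigenvector_step[OF N _ _ p] L unfolding good_def by blast
    define L' where "L' = act g j (ram q L)"
    interpret rh: coeff_hom "\<lambda>a :: complex fps. a oo fps_X ^ q" by (rule coeff_hom_ramify) fact
    have eig: "shift i L' = (\<lambda>\<alpha>. (w oo fps_X ^ q) * L' \<alpha>)" if "shift i L = (\<lambda>\<alpha>. w * L \<alpha>)" for i w
      using that q(1) by (simp add: L'_def shift_act shift_ram ram_scale act_scale)
    have "\<exists>p. p \<noteq> 0 \<and> act p i L' = (\<lambda>_. 0)" for i
    proof -
      obtain p where p: "p \<noteq> 0" "act p i L = (\<lambda>_. 0)" using L by (auto simp: good_def)
      have "ramify q p \<noteq> 0"
        using p(1) q(1) by (auto simp: poly_eq_iff rh.coeff_map fps_compose_eq_0_iff)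
      moreover have "act (ramify q p) i L' = (\<lambda>_. 0)"
        unfolding L'_def act_commute[of _ i] act_ram[OF q(1)] p(2) ram_zero act_zero ..
      ultimately show ?thesis by blast
    qed
    moreover have "coeffs_in N L'"
      using L q(1) by (auto simp: L'_def good_def intro: coeffs_in_act coeffs_in_ram N)
    moreover have "shift j0 L' = (\<lambda>\<alpha>. fps_X ^ (q * s) * L' \<alpha>)"
      using eig[of j0 "fps_X ^ s"] L q(1) by (simp add: good_def fps_X_power_compose power_mult)
    ultimately have "good (insert j J) L' (\<lambda>i. if i = j then z else y i oo fps_X ^ q) (q * s)"
      using L q eig by (auto simp: good_def L'_def[symmetric])
    then show ?case by blast
  qed
  then obtain L y s where "good UNIV L y s" by blast
  then show ?thesis unfolding good_def by blast
qed

text \<open>An element \<open>L\<close> of \<open>N[[t]]\<close> with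
  \<open>shift j0 L = t L\<close> is determined by its values in degrees up to \<open>d\<close>: if
  these vanish, then each coefficient in turn is annihilated by \<open>shift j0\<close>, so it has
  degree at most \<open>d\<close> and is zero. Thus \<open>card A + 1\<close> iterates of a
  coordinate on \<open>L0\<close>, being dependent on the finite set \<open>A\<close>, are dependent
  everywhere.\<close>

lemma tower_dependence:
  fixes L0 :: "('n::finite \<Rightarrow> nat) \<Rightarrow> complex fps"
  assumes N: "inverse_system N" and ker: "\<And>f. f \<in> N \<Longrightarrow> shift j0 f = (\<lambda>_. 0) \<Longrightarrow> deg_le d f"
    and L0: "coeffs_in N L0" "shift j0 L0 = (\<lambda>\<alpha>. fps_X * L0 \<alpha>)"
  shows "\<exists>p. p \<noteq> 0 \<and> act p j L0 = (\<lambda>_. 0)"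
proof -
  define A where "A = {\<alpha> :: 'n \<Rightarrow> nat. sum \<alpha> UNIV \<le> d}"
  define n where "n = card A"
  have "finite A" unfolding A_def by (rule finite_multi_index)
  then obtain c where c: "\<exists>i\<le>n. c i \<noteq> 0" "\<And>\<alpha>. \<alpha> \<in> A \<Longrightarrow> (\<Sum>i\<le>n. c i * L0 ((inc j ^^ i) \<alpha>)) = 0"
    using homogeneous_system_nontrivial[of A "{..n}" "\<lambda>i \<alpha>. L0 ((inc j ^^ i) \<alpha>)"] by (auto simp: n_def)
  define p where "p = (\<Sum>i\<le>n. monom (c i) i)"
  have cp: "coeff p i = (if i \<le> n then c i else 0)" for i
    by (simp add: p_def coeff_sum coeff_monom)
  have deg: "degree p \<le> n" by (rule degree_le) (simp add: cp)
  have "p \<noteq> 0" using c(1) by (auto simp: poly_eq_iff cp)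
  define L where "L = act p j L0"
  have L: "coeffs_in N L" "shift j0 L = (\<lambda>\<alpha>. fps_X * L \<alpha>)"
    using L0 by (simp_all add: L_def coeffs_in_act N shift_act act_scale)
  have LA: "L \<alpha> = 0" if "\<alpha> \<in> A" for \<alpha>
    using c(2)[OF that] by (simp add: L_def act_eq_sum[OF deg] cp)
  have "\<forall>\<alpha>. fps_nth (L \<alpha>) k = 0" for k
  proof (induction k rule: less_induct)
    case (less k)
    have "shift j0 (\<lambda>\<alpha>. fps_nth (L \<alpha>) k) = (\<lambda>\<alpha>. fps_nth (shift j0 L \<alpha>) k)" by (simp add: shift_def)
    also have "\<dots> = (\<lambda>_. 0)" using less by (auto simp: L(2) fps_mult_fps_X_commute fps_X_mult_nth)
    finally have "deg_le d (\<lambda>\<alpha>. fps_nth (L \<alpha>) k)" using ker L(1) by (auto simp: coeffs_in_def)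
    then show ?case using LA by (auto simp: deg_le_def A_def not_le) (metis fps_zero_nth not_le)
  qed
  then have "L = (\<lambda>_. 0)" by (auto simp: fun_eq_iff fps_eq_iff)
  with \<open>p \<noteq> 0\<close> show ?thesis by (auto simp: L_def)
qed

text \<open>A common eigenvector is determined by its value \<open>u\<close> at the zero
  multi-index, since raising an index multiplies by an eigenvalue. The series \<open>u\<close> may
  fail to be a unit; it is cancelled later, in \<open>isotropic_curve_comp_coeff\<close>.\<close>

theorem inverse_system_contains_curve:
  fixes N0 :: "(('n::finite \<Rightarrow> nat) \<Rightarrow> complex) set"
  assumes "inverse_system N0" "\<not> bounded_system N0"
  shows "\<exists>u \<zeta>. u \<noteq> 0 \<and> (\<forall>j. fps_nth (\<zeta> j) 0 = 0) \<and> (\<exists>j. \<zeta> j \<noteq> 0)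
    \<and> coeffs_in N0 (\<lambda>\<alpha>. u * (\<Prod>j\<in>UNIV. \<zeta> j ^ \<alpha> j))"
proof -
  obtain N j0 d where N: "N \<subseteq> N0" "inverse_system N" "\<not> bounded_system N" "shift j0 ` N = N"
    "\<And>f. f \<in> N \<Longrightarrow> shift j0 f = (\<lambda>_. 0) \<Longrightarrow> deg_le d f"
    using surjective_shift_finite_kernel[OF assms] by metis
  \<comment> \<open>An element of degree 0 is annihilated by every shift. Starting the tower of
    lifts there gives \<open>shift j0 L0 = t L0\<close> in the lowest coefficient as well.\<close>
  obtain f0 \<alpha>0 where f0: "f0 \<in> N" "deg_le 0 f0" "f0 \<alpha>0 \<noteq> 0"
    using exact_degree_element[OF N(2,3), of 0] by blast
  have shift_f0: "shift j0 f0 = (\<lambda>_. 0)" using f0(2) by (auto simp: deg_le_def shift_def)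
  have surj: "\<exists>y. y \<in> N \<and> shift j0 y = x" if "x \<in> N" for x
    using that N(4) by (metis imageE)
  have "\<exists>s. \<forall>n. (s n \<in> N \<and> (n = 0 \<longrightarrow> s n = f0)) \<and> shift j0 (s (Suc n)) = s n"
    by (rule dependent_nat_choice) (use f0(1) surj in auto)
  then obtain s where s: "\<And>n. s n \<in> N" "s 0 = f0" "\<And>n. shift j0 (s (Suc n)) = s n" by blast
  define L0 where "L0 \<alpha> = Abs_fps (\<lambda>i. s i \<alpha>)" for \<alpha>
  have "shift j0 L0 = (\<lambda>\<alpha>. fps_X * L0 \<alpha>)"
  proof (intro ext fps_ext)
    fix \<alpha> n
    have "shift j0 (s n) \<alpha> = (if n = 0 then 0 else s (n - 1) \<alpha>)"
      using s shift_f0 by (cases n) auto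
    then show "fps_nth (shift j0 L0 \<alpha>) n = fps_nth (fps_X * L0 \<alpha>) n"
      by (simp add: L0_def shift_def)
  qed
  moreover have "coeffs_in N L0" using s(1) by (simp add: coeffs_in_def L0_def)
  moreover have "L0 \<noteq> (\<lambda>_. 0)"
  proof
    assume "L0 = (\<lambda>_. 0)"
    then have "fps_nth (L0 \<alpha>0) 0 = 0" by simp
    then show False using f0(3) s(2) by (simp add: L0_def)
  qed
  moreover have "\<exists>p. p \<noteq> 0 \<and> act p j L0 = (\<lambda>_. 0)" for j
    by (rule tower_dependence[where ?j0.0 = j0 and N = N and d = d]) (use N \<open>coeffs_in N L0\<close> \<open>shift j0 L0 = _\<close> in auto)
  ultimately have "\<exists>L y s. coeffs_in N L \<and> L \<noteq> (\<lambda>_. 0) \<and> s > 0 \<and> shift j0 L = (\<lambda>\<alpha>. fps_X ^ s * L \<alpha>)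
    \<and> (\<forall>j. fps_nth (y j) 0 = 0 \<and> shift j L = (\<lambda>\<alpha>. y j * L \<alpha>))"
    by (intro simultaneous_eigenvector[OF N(2)])
  then obtain L y k where L: "coeffs_in N L" "L \<noteq> (\<lambda>_. 0)" "k > 0"
      "shift j0 L = (\<lambda>\<alpha>. fps_X ^ k * L \<alpha>)" "\<And>j. fps_nth (y j) 0 = 0" "\<And>j. shift j L = (\<lambda>\<alpha>. y j * L \<alpha>)"
    by blast
  define u where "u = L (\<lambda>_. 0)"
  have Lu: "L \<alpha> = u * (\<Prod>j\<in>UNIV. y j ^ \<alpha> j)" for \<alpha>
  proof (induction \<alpha> rule: multi_index_induct)
    case (Suc \<beta> j)
    have "L (inc j \<beta>) = y j * L \<beta>" using L(6)[of j] by (simp add: shift_apply[symmetric])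
    moreover have "(\<Prod>i\<in>UNIV. y i ^ inc j \<beta> i) = y j * (\<Prod>i\<in>UNIV. y i ^ \<beta> i)"
    proof -
      have "(\<Prod>i\<in>UNIV. y i ^ inc j \<beta> i) = (\<Prod>i\<in>UNIV. (if i = j then y j else 1) * y i ^ \<beta> i)"
        by (rule prod.cong) (auto simp: inc_def)
      then show ?thesis by (simp add: prod.distrib)
    qed
    ultimately show ?case using Suc by (simp add: mult_ac)
  qed (simp add: u_def)
  have "u \<noteq> 0" using L(2) Lu by (auto simp: fun_eq_iff)
  \<comment> \<open>The eigenvalue of \<open>shift j0\<close> is also \<open>fps_X ^ k\<close>; this
    is what makes the curve nonconstant.\<close>
  moreover have "y j0 \<noteq> 0"
  proof
    assume "y j0 = 0"
    then have "fps_X ^ k * L \<alpha> = 0" for \<alpha> using fun_cong[OF L(4), of \<alpha>] fun_cong[OF L(6)[of j0], of \<alpha>] by simp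
    then show False using L(2) by (auto simp: fun_eq_iff)
  qed
  moreover have "coeffs_in N0 (\<lambda>\<alpha>. u * (\<Prod>j\<in>UNIV. y j ^ \<alpha> j))"
    using L(1) N(1) by (auto simp: coeffs_in_def Lu)
  ultimately show ?thesis using L(5) by blast
qed

section \<open>Limits of isotropic systems\<close>

text \<open>Pairs the double series with coefficients \<open>C\<close> against \<open>f\<close> in
  the holomorphic and the conjugate of \<open>g\<close> in the antiholomorphic variables. The cutoff
  makes the sum finite; by \<open>sesq_form_eq\<close> all cutoffs that bound both degrees
  agree.\<close>

definition sesq_form ::
  "(('n::finite \<Rightarrow> nat) \<Rightarrow> ('n \<Rightarrow> nat) \<Rightarrow> complex) \<Rightarrow> nat \<Rightarrow> (('n \<Rightarrow> nat) \<Rightarrow> complex) \<Rightarrow> (('n \<Rightarrow> nat) \<Rightarrow> complex) \<Rightarrow> complex"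
  where "sesq_form C d f g = (\<Sum>\<alpha>\<in>{\<alpha>. sum \<alpha> UNIV \<le> d}. \<Sum>\<beta>\<in>{\<beta>. sum \<beta> UNIV \<le> d}. C \<alpha> \<beta> * f \<alpha> * cnj (g \<beta>))"

definition isotropic ::
  "(('n::finite \<Rightarrow> nat) \<Rightarrow> ('n \<Rightarrow> nat) \<Rightarrow> complex) \<Rightarrow> (('n \<Rightarrow> nat) \<Rightarrow> complex) set \<Rightarrow> bool"
  where "isotropic C N \<longleftrightarrow> (\<forall>f\<in>N. \<forall>g\<in>N. \<forall>d. deg_le d f \<longrightarrow> deg_le d g \<longrightarrow> sesq_form C d f g = 0)"

lemma sesq_form_truncate:
  assumes "deg_le a f" "deg_le b g" "a \<le> d" "b \<le> d"
  shows "sesq_form C d f g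
    = (\<Sum>\<alpha>\<in>{\<alpha>. sum \<alpha> UNIV \<le> a}. \<Sum>\<beta>\<in>{\<beta>. sum \<beta> UNIV \<le> b}. C \<alpha> \<beta> * f \<alpha> * cnj (g \<beta>))"
proof -
  have "(\<Sum>\<alpha>\<in>{\<alpha>. sum \<alpha> UNIV \<le> a}. \<Sum>\<beta>\<in>{\<beta>. sum \<beta> UNIV \<le> b}. C \<alpha> \<beta> * f \<alpha> * cnj (g \<beta>))
      = (\<Sum>\<alpha>\<in>{\<alpha>. sum \<alpha> UNIV \<le> d}. \<Sum>\<beta>\<in>{\<beta>. sum \<beta> UNIV \<le> b}. C \<alpha> \<beta> * f \<alpha> * cnj (g \<beta>))"
    using assms by (intro sum.mono_neutral_left finite_multi_index) (auto simp: deg_le_def)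
  also have "\<dots> = sesq_form C d f g"
    unfolding sesq_form_def
    using assms by (intro sum.cong refl sum.mono_neutral_left finite_multi_index) (auto simp: deg_le_def)
  finally show ?thesis ..
qed

lemma sesq_form_eq:
  assumes "deg_le a f" "deg_le a g" "a \<le> b"
  shows "sesq_form C a f g = sesq_form C b f g"
  using sesq_form_truncate[OF assms(1,2) assms(3,3)] by (simp add: sesq_form_def)

text \<open>There are \<open>k + 1\<close> elements of exact degrees \<open>0, ..., k\<close>
  against \<open>k\<close> linear conditions, one for each monomial of degree at most
  \<open>d\<close>. The resulting degree bound \<open>k\<close> depends on \<open>d\<close> alone
  and not on \<open>M\<close>, which is what survives a limit.\<close>

lemma normalized_high_order_element:
  fixes M :: "(('n::finite \<Rightarrow> nat) \<Rightarrow> complex) set"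
  assumes M: "inverse_system M"
    and e: "\<And>i. i \<le> k \<Longrightarrow> \<exists>f\<in>M. deg_le i f \<and> (\<exists>\<alpha>. sum \<alpha> UNIV = i \<and> f \<alpha> \<noteq> 0)"
    and k: "card {\<alpha> :: 'n \<Rightarrow> nat. sum \<alpha> UNIV \<le> d} = k"
  shows "\<exists>f\<in>M. deg_le k f \<and> (\<forall>\<alpha>. sum \<alpha> UNIV \<le> d \<longrightarrow> f \<alpha> = 0) \<and> (\<forall>\<alpha>. cmod (f \<alpha>) \<le> 1) \<and> (\<exists>\<alpha>. cmod (f \<alpha>) = 1)"
proof -
  define A where "A = {\<alpha> :: 'n \<Rightarrow> nat. sum \<alpha> UNIV \<le> d}"
  have finA: "finite A" unfolding A_def by (rule finite_multi_index)
  from e have "\<forall>i. \<exists>f \<alpha>. i \<le> k \<longrightarrow> f \<in> M \<and> deg_le i f \<and> sum \<alpha> UNIV = i \<and> f \<alpha> \<noteq> 0" by blast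
  then obtain E a where E: "\<And>i. i \<le> k \<Longrightarrow> E i \<in> M" "\<And>i. i \<le> k \<Longrightarrow> deg_le i (E i)"
    "\<And>i. i \<le> k \<Longrightarrow> sum (a i) UNIV = i" "\<And>i. i \<le> k \<Longrightarrow> E i (a i) \<noteq> 0" by metis
  obtain c where c: "\<exists>i\<le>k. c i \<noteq> 0" "\<And>\<alpha>. \<alpha> \<in> A \<Longrightarrow> (\<Sum>i\<le>k. c i * E i \<alpha>) = 0"
    using homogeneous_system_nontrivial[OF finA, of "{..k}" E] k by (auto simp: A_def)
  define f where "f \<alpha> = (\<Sum>i\<le>k. c i * E i \<alpha>)" for \<alpha>
  have fM: "f \<in> M" unfolding f_def using E(1) by (intro inverse_system_sum M) auto
  have degf: "deg_le k f" using E(2) by (auto simp: deg_le_def f_def intro!: sum.neutral)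
  \<comment> \<open>At the index \<open>a m\<close>, of top degree for the last summand, all earlier
    summands vanish, so \<open>f\<close> is not zero.\<close>
  define m where "m = Max {i. i \<le> k \<and> c i \<noteq> 0}"
  have "finite {i. i \<le> k \<and> c i \<noteq> 0}" "{i. i \<le> k \<and> c i \<noteq> 0} \<noteq> {}" using c(1) by auto
  then have m: "m \<le> k" "c m \<noteq> 0" "\<And>i. i \<le> k \<Longrightarrow> c i \<noteq> 0 \<Longrightarrow> i \<le> m"
    using Max_in[of "{i. i \<le> k \<and> c i \<noteq> 0}"] by (auto simp: m_def)
  have "f (a m) = (\<Sum>i\<le>k. if i = m then c m * E m (a m) else 0)"
    unfolding f_def
  proof (rule sum.cong)
    fix i assume i: "i \<in> {..k}"
    show "c i * E i (a m) = (if i = m then c m * E m (a m) else 0)"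
      using m(3)[of i] E(2)[of i] E(3)[OF m(1)] i by (cases "c i = 0") (auto simp: deg_le_def)
  qed simp
  then have fam: "f (a m) \<noteq> 0" using m E(4) by simp
  define B where "B = {\<alpha> :: 'n \<Rightarrow> nat. sum \<alpha> UNIV \<le> k}"
  define R where "R = Max ((\<lambda>\<alpha>. cmod (f \<alpha>)) ` B)"
  have finB: "finite B" unfolding B_def by (rule finite_multi_index)
  have am: "a m \<in> B" using E(3) m(1) by (simp add: B_def)
  have le: "cmod (f \<alpha>) \<le> R" if "\<alpha> \<in> B" for \<alpha> using that finB by (simp add: R_def)
  then have R: "R > 0" using am fam by (meson less_le_trans zero_less_norm_iff)
  obtain b where b: "b \<in> B" "cmod (f b) = R"
    using Max_in[of "(\<lambda>\<alpha>. cmod (f \<alpha>)) ` B"] finB am unfolding R_def by fastforce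
  define g where "g \<alpha> = complex_of_real (1 / R) * f \<alpha>" for \<alpha>
  have "g \<in> M" unfolding g_def by (rule inverse_system_scale) fact+
  moreover have "deg_le k g" using degf by (simp add: g_def deg_le_def)
  moreover have "g \<alpha> = 0" if "sum \<alpha> UNIV \<le> d" for \<alpha> using c(2)[of \<alpha>] that by (simp add: g_def f_def A_def)
  moreover have "cmod (g \<alpha>) \<le> 1" for \<alpha>
  proof (cases "\<alpha> \<in> B")
    case True
    then show ?thesis using le[of \<alpha>] R by (simp add: g_def norm_mult norm_divide)
  next
    case False
    then show ?thesis using degf by (simp add: g_def deg_le_def B_def)
  qed
  moreover have "cmod (g b) = 1" using R b by (simp add: g_def norm_mult norm_divide)
  ultimately show ?thesis by blast
qed

text \<open>A countable product of closed discs is compact and metrisable, so the diagonal argument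
  is an instance of sequential compactness.\<close>

lemma bounded_functions_convergent_subsequence:
  fixes x :: "nat \<Rightarrow> 'a::countable \<Rightarrow> complex"
  assumes "\<And>k i. cmod (x k i) \<le> 1"
  shows "\<exists>l r. strict_mono r \<and> (\<forall>i. (\<lambda>k. x (r k) i) \<longlonglongrightarrow> l i)"
proof -
  have "compact (PiE (UNIV :: 'a set) (\<lambda>_. cball (0::complex) 1))"
    using compactin_PiE[of "\<lambda>_::'a. euclidean :: complex topology" UNIV "\<lambda>_. cball 0 1"]
    by (simp add: euclidean_product_topology compactin_euclidean_iff)
  moreover have "\<forall>k. x k \<in> PiE UNIV (\<lambda>_. cball 0 1)" using assms by auto
  ultimately obtain l r where "strict_mono r" "(x \<circ> r) \<longlonglongrightarrow> l" unfolding compact_def by blast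
  moreover have "(\<lambda>k. x (r k) i) \<longlonglongrightarrow> l i" if "(x \<circ> r) \<longlonglongrightarrow> l" for i
    using continuous_on_tendsto_compose[OF continuous_on_product_coordinates[of i] that] by simp
  ultimately show ?thesis by blast
qed

text \<open>The limit consists of the pointwise limits, along one subsequence, of elements of
  uniformly bounded degree. The uniform bound keeps each pairing a fixed finite sum, so isotropy
  passes to the limit; the normalised elements of high order keep it unbounded.\<close>

lemma limit_inverse_system:
  fixes M :: "nat \<Rightarrow> (('n::finite \<Rightarrow> nat) \<Rightarrow> complex) set"
  assumes M: "\<And>k. inverse_system (M k)"
    and e: "\<And>k i. i \<le> k \<Longrightarrow> \<exists>f\<in>M k. deg_le i f \<and> (\<exists>\<alpha>. sum \<alpha> UNIV = i \<and> f \<alpha> \<noteq> 0)"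
    and iso: "\<And>k. isotropic C (M k)"
  shows "\<exists>N. inverse_system N \<and> \<not> bounded_system N \<and> isotropic C N"
proof -
  define D where "D d = card {\<alpha> :: 'n \<Rightarrow> nat. sum \<alpha> UNIV \<le> d}" for d
  \<comment> \<open>For the finitely many \<open>k < D d\<close> a normalised element need not
    exist, and zero serves as the default.\<close>
  define Q where "Q k d f \<longleftrightarrow> f \<in> M k \<and> deg_le (D d) f \<and> (\<forall>\<alpha>. sum \<alpha> UNIV \<le> d \<longrightarrow> f \<alpha> = 0)
     \<and> (\<forall>\<alpha>. cmod (f \<alpha>) \<le> 1) \<and> (D d \<le> k \<longrightarrow> (\<exists>\<alpha>. cmod (f \<alpha>) = 1))" for k d f
  have "\<exists>f. Q k d f" for k d
  proof (cases "D d \<le> k")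
    case True
    then show ?thesis
      using normalized_high_order_element[OF M e, of "D d" k d] unfolding D_def Q_def by force
  next
    case False
    then show ?thesis using M[of k] by (intro exI[of _ "\<lambda>_. 0"]) (auto simp: Q_def inverse_system_def deg_le_def)
  qed
  then obtain F where "\<And>k d. Q k d (F k d)" by metis
  then have F: "\<And>k d. F k d \<in> M k" "\<And>k d. deg_le (D d) (F k d)"
    "\<And>k d \<alpha>. sum \<alpha> UNIV \<le> d \<Longrightarrow> F k d \<alpha> = 0" "\<And>k d \<alpha>. cmod (F k d \<alpha>) \<le> 1"
    "\<And>k d. D d \<le> k \<Longrightarrow> \<exists>\<alpha>. cmod (F k d \<alpha>) = 1"
    by (simp_all add: Q_def)
  \<comment> \<open>Indexing by pairs \<open>(d, \<alpha>)\<close> lets one subsequence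
    \<open>r\<close> serve all \<open>d\<close> at once.\<close>
  obtain l r where r: "strict_mono r" and l: "\<And>i. (\<lambda>k. (case i of (d, \<alpha>) \<Rightarrow> F (r k) d \<alpha>)) \<longlonglongrightarrow> l i"
    using bounded_functions_convergent_subsequence[of "\<lambda>k (d, \<alpha>). F k d \<alpha>"] F(4) by auto
  have l: "(\<lambda>k. F (r k) d \<alpha>) \<longlonglongrightarrow> l (d, \<alpha>)" for d \<alpha> using l[of "(d, \<alpha>)"] by simp
  define lim_of where "lim_of f d g \<longleftrightarrow> (\<forall>k. g k \<in> M (r k) \<and> deg_le d (g k)) \<and> (\<forall>\<alpha>. (\<lambda>k. g k \<alpha>) \<longlonglongrightarrow> f \<alpha>)"
    for f d g
  define N where "N = {f. \<exists>d g. lim_of f d g}"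
  have deg_lim: "deg_le d f" if "lim_of f d g" for f d g
    unfolding deg_le_def
  proof (intro allI impI)
    fix \<alpha> :: "'n \<Rightarrow> nat" assume "d < sum \<alpha> UNIV"
    then have "(\<lambda>k. g k \<alpha>) = (\<lambda>k. 0)" using that by (auto simp: lim_of_def deg_le_def)
    moreover have "(\<lambda>k. g k \<alpha>) \<longlonglongrightarrow> f \<alpha>" using that by (simp add: lim_of_def)
    ultimately show "f \<alpha> = 0" using LIMSEQ_unique[OF tendsto_const, of 0 "f \<alpha>"] by simp
  qed
  have "inverse_system N"
    unfolding inverse_system_def
  proof (intro conjI ballI allI)
    have "(\<lambda>_. 0) \<in> M (r k)" for k using M[of "r k"] by (simp add: inverse_system_def)
    then have "lim_of (\<lambda>_. 0) 0 (\<lambda>_ _. 0)" by (simp add: lim_of_def deg_le_def)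
    then show "(\<lambda>_. 0) \<in> N" unfolding N_def by blast
  next
    fix f f' c assume "f \<in> N" "f' \<in> N"
    then obtain d g d' g' where *: "lim_of f d g" "lim_of f' d' g'" by (auto simp: N_def)
    have "lim_of (\<lambda>\<alpha>. c * f \<alpha> + f' \<alpha>) (max d d') (\<lambda>k \<alpha>. c * g k \<alpha> + g' k \<alpha>)"
      unfolding lim_of_def
    proof (intro conjI allI)
      fix k
      show "(\<lambda>\<alpha>. c * g k \<alpha> + g' k \<alpha>) \<in> M (r k)" using * M[of "r k"] by (simp add: lim_of_def inverse_system_def)
      show "deg_le (max d d') (\<lambda>\<alpha>. c * g k \<alpha> + g' k \<alpha>)" using * unfolding lim_of_def deg_le_def by simp
    next
      fix \<alpha>
      show "(\<lambda>k. c * g k \<alpha> + g' k \<alpha>) \<longlonglongrightarrow> c * f \<alpha> + f' \<alpha>"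
        using * by (intro tendsto_intros) (simp_all add: lim_of_def)
    qed
    then show "(\<lambda>\<alpha>. c * f \<alpha> + f' \<alpha>) \<in> N" unfolding N_def by blast
  next
    fix f j assume "f \<in> N"
    then obtain d g where *: "lim_of f d g" by (auto simp: N_def)
    have "lim_of (shift j f) d (\<lambda>k. shift j (g k))"
      unfolding lim_of_def
    proof (intro conjI allI)
      fix k
      show "shift j (g k) \<in> M (r k)" using * M[of "r k"] by (simp add: lim_of_def inverse_system_def)
      show "deg_le d (shift j (g k))"
        by (rule deg_le_shift, rule deg_le_mono[of d]) (use * in \<open>simp_all add: lim_of_def\<close>)
    next
      fix \<alpha>
      show "(\<lambda>k. shift j (g k) \<alpha>) \<longlonglongrightarrow> shift j f \<alpha>" using * by (simp add: lim_of_def shift_def)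
    qed
    then show "shift j f \<in> N" unfolding N_def by blast
  next
    fix f assume "f \<in> N"
    then obtain d g where "lim_of f d g" by (auto simp: N_def)
    then show "\<exists>d. deg_le d f" using deg_lim by blast
  qed
  moreover have "\<not> bounded_system N"
  proof
    assume "bounded_system N"
    then obtain d where d: "\<And>f. f \<in> N \<Longrightarrow> deg_le d f" by (auto simp: bounded_system_def)
    define B where "B = {\<alpha> :: 'n \<Rightarrow> nat. sum \<alpha> UNIV \<le> D d}"
    have finB: "finite B" unfolding B_def by (rule finite_multi_index)
    have "lim_of (\<lambda>\<alpha>. l (d, \<alpha>)) (D d) (\<lambda>k. F (r k) d)" using F l by (simp add: lim_of_def)
    then have "deg_le d (\<lambda>\<alpha>. l (d, \<alpha>))" using d by (auto simp: N_def)
    moreover have "l (d, \<alpha>) = 0" if "sum \<alpha> UNIV \<le> d" for \<alpha>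
      using l[of d \<alpha>] LIMSEQ_unique[OF tendsto_const, of 0 "l (d, \<alpha>)"] by (simp add: F(3)[OF that])
    ultimately have l0: "l (d, \<alpha>) = 0" for \<alpha> by (cases "sum \<alpha> UNIV \<le> d") (auto simp: deg_le_def)
    \<comment> \<open>The entry of modulus 1 may move with \<open>k\<close>, but only inside the
      finite set \<open>B\<close>; the sum over \<open>B\<close> keeps the lower bound 1 in the
      limit.\<close>
    have "(\<lambda>k. \<Sum>\<alpha>\<in>B. cmod (F (r k) d \<alpha>)) \<longlonglongrightarrow> (\<Sum>\<alpha>\<in>B. cmod (l (d, \<alpha>)))"
      by (intro tendsto_intros l)
    moreover have "eventually (\<lambda>k. 1 \<le> (\<Sum>\<alpha>\<in>B. cmod (F (r k) d \<alpha>))) sequentially"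
    proof (rule eventually_sequentiallyI)
      fix k assume "D d \<le> k"
      then have "D d \<le> r k" using seq_suble[OF r, of k] by simp
      then obtain \<alpha> where \<alpha>: "cmod (F (r k) d \<alpha>) = 1" using F(5) by blast
      then have "\<alpha> \<in> B" using F(2)[of d "r k"] by (auto simp: B_def deg_le_def not_less[symmetric])
      with \<alpha> finB show "1 \<le> (\<Sum>\<alpha>\<in>B. cmod (F (r k) d \<alpha>))"
        using member_le_sum[of \<alpha> B "\<lambda>\<alpha>. cmod (F (r k) d \<alpha>)"] by simp
    qed
    ultimately have "1 \<le> (\<Sum>\<alpha>\<in>B. cmod (l (d, \<alpha>)))"
      by (intro tendsto_lowerbound) auto
    then show False by (simp add: l0)
  qed
  moreover have "isotropic C N"
    unfolding isotropic_def
  proof (intro ballI allI impI)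
    fix f f' d assume "f \<in> N" "f' \<in> N" and d: "deg_le d f" "deg_le d f'"
    then obtain a g a' g' where *: "lim_of f a g" "lim_of f' a' g'" by (auto simp: N_def)
    define b where "b = max d (max a a')"
    have "(\<lambda>k. sesq_form C b (g k) (g' k)) \<longlonglongrightarrow> sesq_form C b f f'"
      unfolding sesq_form_def using * by (intro tendsto_intros) (auto simp: lim_of_def)
    moreover have "sesq_form C b (g k) (g' k) = 0" for k
    proof -
      have "deg_le b (g k)" "deg_le b (g' k)" "g k \<in> M (r k)" "g' k \<in> M (r k)"
        using * deg_le_mono[of a "g k" b] deg_le_mono[of a' "g' k" b] by (simp_all add: lim_of_def b_def)
      then show ?thesis using iso[of "r k"] unfolding isotropic_def by blast
    qed
    ultimately have "sesq_form C b f f' = 0" using LIMSEQ_unique[OF tendsto_const, of 0] by simp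
    then show "sesq_form C d f f' = 0" using sesq_form_eq[OF d, of b C] by (simp add: b_def)
  qed
  ultimately show ?thesis by blast
qed

section \<open>Wirtinger derivatives and Taylor expansion\<close>

lemma frechet_derivative_cong_open:
  assumes "open U" "z \<in> U" "\<And>x. x \<in> U \<Longrightarrow> f x = g x"
  shows "frechet_derivative f (at z) = frechet_derivative g (at z)"
proof -
  have "(f has_derivative D) (at z) \<longleftrightarrow> (g has_derivative D) (at z)" for D
  proof
    show "(g has_derivative D) (at z)" if "(f has_derivative D) (at z)"
      using that assms(1,2) by (rule has_derivative_transform_within_open) (rule assms(3))
    show "(f has_derivative D) (at z)" if "(g has_derivative D) (at z)"
      using that assms(1,2) by (rule has_derivative_transform_within_open) (rule assms(3)[symmetric])
  qed
  then show ?thesis by (simp add: frechet_derivative_def)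
qed

lemma differentiable_cong_open:
  assumes "open U" "z \<in> U" "\<And>x. x \<in> U \<Longrightarrow> f x = g x" "f differentiable (at z)"
  shows "g differentiable (at z)"
proof -
  obtain D where "(f has_derivative D) (at z)" using assms(4) by (auto simp: differentiable_def)
  then have "(g has_derivative D) (at z)"
    using assms(1,2) by (rule has_derivative_transform_within_open) (rule assms(3))
  then show ?thesis by (auto simp: differentiable_def)
qed

lemma dd_append: "dd us (dd vs f) = dd (us @ vs) f"
  by (induction us) simp_all

lemma smooth_on_dd: "smooth_on U f \<Longrightarrow> smooth_on U (dd vs f)"
  by (simp add: smooth_on_def dd_append)

lemma dd_cong:
  assumes "open U" "\<And>x. x \<in> U \<Longrightarrow> f x = g x" "z \<in> U"
  shows "dd vs f z = dd vs g z"
  using assms(3)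
proof (induction vs arbitrary: z)
  case (Cons v vs)
  have "frechet_derivative (dd vs f) (at z) = frechet_derivative (dd vs g) (at z)"
    by (rule frechet_derivative_cong_open[OF assms(1) Cons.prems Cons.IH])
  then show ?case by simp
qed (use assms in simp)

lemma frechet_derivative_bounded_linear:
  assumes "bounded_linear T" "f differentiable (at z)"
  shows "frechet_derivative (\<lambda>x. T (f x)) (at z) = (\<lambda>v. T (frechet_derivative f (at z) v))"
    "(\<lambda>x. T (f x)) differentiable (at z)"
proof -
  have "(f has_derivative frechet_derivative f (at z)) (at z)"
    using assms(2) by (simp add: frechet_derivative_works)
  then have *: "((\<lambda>x. T (f x)) has_derivative (\<lambda>v. T (frechet_derivative f (at z) v))) (at z)"
    by (rule bounded_linear.has_derivative[OF assms(1)])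
  then show "frechet_derivative (\<lambda>x. T (f x)) (at z) = (\<lambda>v. T (frechet_derivative f (at z) v))"
    by (rule frechet_derivative_at[symmetric])
  show "(\<lambda>x. T (f x)) differentiable (at z)" using * by (auto simp: differentiable_def)
qed

lemma frechet_derivative_linear_combination:
  fixes c :: "'b::real_normed_algebra"
  assumes "f differentiable (at z)" "g differentiable (at z)"
  shows "frechet_derivative (\<lambda>x. c * f x + g x) (at z)
      = (\<lambda>v. c * frechet_derivative f (at z) v + frechet_derivative g (at z) v)"
    "(\<lambda>x. c * f x + g x) differentiable (at z)"
proof -
  have "((\<lambda>x. c * f x + g x) has_derivative
      (\<lambda>v. c * frechet_derivative f (at z) v + frechet_derivative g (at z) v)) (at z)"
    using assms unfolding frechet_derivative_works
    by (intro has_derivative_add bounded_linear.has_derivative[OF bounded_linear_mult_right])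
  then show "frechet_derivative (\<lambda>x. c * f x + g x) (at z)
      = (\<lambda>v. c * frechet_derivative f (at z) v + frechet_derivative g (at z) v)"
    "(\<lambda>x. c * f x + g x) differentiable (at z)"
    by (auto simp: differentiable_def intro: frechet_derivative_at[symmetric])
qed

lemma dd_bounded_linear:
  assumes "open U" "bounded_linear T" "smooth_on U f" "z \<in> U"
  shows "dd vs (\<lambda>x. T (f x)) z = T (dd vs f z)"
  using assms(4)
proof (induction vs arbitrary: z)
  case (Cons v vs)
  have "frechet_derivative (dd vs (\<lambda>x. T (f x))) (at z) = frechet_derivative (\<lambda>x. T (dd vs f x)) (at z)"
    by (rule frechet_derivative_cong_open[OF assms(1) Cons.prems Cons.IH])
  then show ?case
    using assms(3) Cons.prems by (simp add: frechet_derivative_bounded_linear[OF assms(2)] smooth_on_def)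
qed simp

lemma smooth_on_bounded_linear:
  assumes "open U" "bounded_linear T" "smooth_on U f"
  shows "smooth_on U (\<lambda>x. T (f x))"
  unfolding smooth_on_def
proof (intro allI ballI)
  fix vs z assume z: "z \<in> U"
  show "dd vs (\<lambda>x. T (f x)) differentiable (at z)"
    by (rule differentiable_cong_open[OF assms(1) z, of "\<lambda>x. T (dd vs f x)"])
       (use assms z in \<open>auto simp: dd_bounded_linear smooth_on_def intro: frechet_derivative_bounded_linear\<close>)
qed

lemma dd_linear_combination:
  fixes c :: "'b::real_normed_algebra"
  assumes "open U" "smooth_on U f" "smooth_on U g" "z \<in> U"
  shows "dd vs (\<lambda>x. c * f x + g x) z = c * dd vs f z + dd vs g z"
  using assms(4)
proof (induction vs arbitrary: z)
  case (Cons v vs)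
  have "frechet_derivative (dd vs (\<lambda>x. c * f x + g x)) (at z)
      = frechet_derivative (\<lambda>x. c * dd vs f x + dd vs g x) (at z)"
    by (rule frechet_derivative_cong_open[OF assms(1) Cons.prems Cons.IH])
  then show ?case
    using assms Cons.prems by (simp add: frechet_derivative_linear_combination smooth_on_def)
qed simp

lemma smooth_on_linear_combination:
  fixes c :: "'b::real_normed_algebra"
  assumes "open U" "smooth_on U f" "smooth_on U g"
  shows "smooth_on U (\<lambda>x. c * f x + g x)"
  unfolding smooth_on_def
proof (intro allI ballI)
  fix vs z assume z: "z \<in> U"
  show "dd vs (\<lambda>x. c * f x + g x) differentiable (at z)"
    by (rule differentiable_cong_open[OF assms(1) z, of "\<lambda>x. c * dd vs f x + dd vs g x"])
       (use assms z in \<open>auto simp: dd_linear_combination smooth_on_def intro: frechet_derivative_linear_combination\<close>)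
qed

section \<open>Symmetry of mixed derivatives\<close>

lemma DERIV_along_line:
  fixes g :: "'a::real_normed_vector \<Rightarrow> real"
  assumes "g differentiable (at (w + s *\<^sub>R v))"
  shows "((\<lambda>s. g (w + s *\<^sub>R v)) has_field_derivative frechet_derivative g (at (w + s *\<^sub>R v)) v) (at s)"
proof -
  let ?D = "frechet_derivative g (at (w + s *\<^sub>R v))"
  have g: "(g has_derivative ?D) (at (w + s *\<^sub>R v))" using assms by (simp add: frechet_derivative_works)
  have "((\<lambda>s. w + s *\<^sub>R v) has_derivative (\<lambda>s. s *\<^sub>R v)) (at s)"
    by (auto intro!: derivative_eq_intros)
  from diff_chain_at[OF this g] have "((\<lambda>s. g (w + s *\<^sub>R v)) has_derivative (\<lambda>s. ?D (s *\<^sub>R v))) (at s)"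
    by (simp add: o_def)
  moreover have "?D (s *\<^sub>R v) = ?D v * s" for s
    using linear_frechet_derivative[OF assms] by (simp add: linear_cmul mult.commute)
  ultimately show ?thesis by (simp add: has_field_derivative_def)
qed

text \<open>The mean value theorem is applied twice, first in the direction \<open>u\<close> to the
  difference of two parallel sides, then in the direction \<open>v\<close>. The left-hand side is
  symmetric in \<open>u\<close> and \<open>v\<close>, which \<open>dd_swap_real\<close>
  exploits.\<close>

lemma second_difference:
  fixes f :: "'a::real_normed_vector \<Rightarrow> real"
  assumes f: "smooth_on U f" and h: "h > 0"
    and U: "\<And>s t. 0 \<le> s \<Longrightarrow> s \<le> h \<Longrightarrow> 0 \<le> t \<Longrightarrow> t \<le> h \<Longrightarrow> z + s *\<^sub>R u + t *\<^sub>R v \<in> U"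
  shows "\<exists>s t. 0 < s \<and> s < h \<and> 0 < t \<and> t < h \<and>
    f (z + h *\<^sub>R u + h *\<^sub>R v) - f (z + h *\<^sub>R u) - f (z + h *\<^sub>R v) + f z = h * (h * dd [v, u] f (z + s *\<^sub>R u + t *\<^sub>R v))"
proof -
  have diff: "dd vs f differentiable (at (z + s *\<^sub>R u + t *\<^sub>R v))"
    if "0 \<le> s" "s \<le> h" "0 \<le> t" "t \<le> h" for vs s t
    using f U[OF that] by (simp add: smooth_on_def)
  define G where "G t s = f (z + t *\<^sub>R v + s *\<^sub>R u)" for t s
  have G: "DERIV (G t) s :> dd [u] f (z + s *\<^sub>R u + t *\<^sub>R v)" if "0 \<le> s" "s \<le> h" "0 \<le> t" "t \<le> h" for s t
    unfolding G_def using DERIV_along_line[of f "z + t *\<^sub>R v" s u] diff[OF that, of "[]"]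
    by (simp add: add_ac)
  have "\<exists>s. 0 < s \<and> s < h \<and> (G h h - G 0 h) - (G h 0 - G 0 0)
      = (h - 0) * (dd [u] f (z + s *\<^sub>R u + h *\<^sub>R v) - dd [u] f (z + s *\<^sub>R u + 0 *\<^sub>R v))"
  proof (rule MVT2[OF h])
    fix s assume "0 \<le> s" "s \<le> h"
    then show "DERIV (\<lambda>s. G h s - G 0 s) s :>
        dd [u] f (z + s *\<^sub>R u + h *\<^sub>R v) - dd [u] f (z + s *\<^sub>R u + 0 *\<^sub>R v)"
      using h by (intro DERIV_diff G) auto
  qed
  then obtain s where s: "0 < s" "s < h" "(G h h - G 0 h) - (G h 0 - G 0 0)
      = h * (dd [u] f (z + s *\<^sub>R u + h *\<^sub>R v) - dd [u] f (z + s *\<^sub>R u + 0 *\<^sub>R v))" by auto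
  have "\<exists>t. 0 < t \<and> t < h \<and> dd [u] f (z + s *\<^sub>R u + h *\<^sub>R v) - dd [u] f (z + s *\<^sub>R u + 0 *\<^sub>R v)
      = (h - 0) * dd [v, u] f (z + s *\<^sub>R u + t *\<^sub>R v)"
  proof (rule MVT2[of 0 h "\<lambda>t. dd [u] f (z + s *\<^sub>R u + t *\<^sub>R v)"])
    fix t assume "0 \<le> t" "t \<le> h"
    then show "DERIV (\<lambda>t. dd [u] f (z + s *\<^sub>R u + t *\<^sub>R v)) t :> dd [v, u] f (z + s *\<^sub>R u + t *\<^sub>R v)"
      using DERIV_along_line[of "dd [u] f" "z + s *\<^sub>R u" t v] diff[of s t "[u]"] s by simp
  qed (rule h)
  then obtain t where "0 < t" "t < h" "dd [u] f (z + s *\<^sub>R u + h *\<^sub>R v) - dd [u] f (z + s *\<^sub>R u + 0 *\<^sub>R v)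
      = h * dd [v, u] f (z + s *\<^sub>R u + t *\<^sub>R v)" by auto
  with s show ?thesis by (intro exI[of _ s] exI[of _ t]) (simp add: G_def add_ac)
qed

text \<open>The same second difference is a value of either mixed derivative, at points arbitrarily
  close to \<open>z\<close>, and both derivatives are continuous there.\<close>

lemma dd_swap_real:
  fixes f :: "'a::real_normed_vector \<Rightarrow> real"
  assumes "open U" "z \<in> U" "smooth_on U f"
  shows "dd [v, u] f z = dd [u, v] f z"
proof (rule ccontr)
  assume ne: "dd [v, u] f z \<noteq> dd [u, v] f z"
  define e where "e = \<bar>dd [v, u] f z - dd [u, v] f z\<bar> / 2"
  have e: "e > 0" using ne by (simp add: e_def)
  have cont: "isCont (dd vs f) z" for vs
    using assms by (intro differentiable_imp_continuous_within) (auto simp: smooth_on_def)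
  obtain d1 where d1: "d1 > 0" "\<And>x. dist x z < d1 \<Longrightarrow> dist (dd [v, u] f x) (dd [v, u] f z) < e"
    using cont[of "[v, u]"] e unfolding continuous_at_eps_delta by blast
  obtain d2 where d2: "d2 > 0" "\<And>x. dist x z < d2 \<Longrightarrow> dist (dd [u, v] f x) (dd [u, v] f z) < e"
    using cont[of "[u, v]"] e unfolding continuous_at_eps_delta by blast
  obtain d3 where d3: "d3 > 0" "ball z d3 \<subseteq> U" using assms by (meson open_contains_ball)
  define B where "B = norm u + norm v + 1"
  have B: "B > 0" by (simp add: B_def add_nonneg_pos)
  \<comment> \<open>With this side length the whole parallelogram stays within half the least of the
    three radii around \<open>z\<close>.\<close>
  define h where "h = min d1 (min d2 d3) / (2 * B)"
  have h: "h > 0" using d1 d2 d3 B by (simp add: h_def)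
  have near: "dist (z + s *\<^sub>R u + t *\<^sub>R v) z < min d1 (min d2 d3)" if "0 \<le> s" "s \<le> h" "0 \<le> t" "t \<le> h" for s t
  proof -
    have "dist (z + s *\<^sub>R u + t *\<^sub>R v) z = norm (s *\<^sub>R u + t *\<^sub>R v)" by (simp add: dist_norm add.assoc)
    also have "\<dots> \<le> s * norm u + t * norm v" using that norm_triangle_ineq[of "s *\<^sub>R u" "t *\<^sub>R v"] by simp
    also have "\<dots> \<le> h * norm u + h * norm v" using that by (intro add_mono mult_right_mono) auto
    also have "\<dots> \<le> h * B" using h by (simp add: B_def algebra_simps)
    also have "\<dots> = min d1 (min d2 d3) / 2" using B by (simp add: h_def)
    also have "\<dots> < min d1 (min d2 d3)"
    proof -
      have "0 < min d1 (min d2 d3)" using d1 d2 d3 by simp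
      then show ?thesis by linarith
    qed
    finally show ?thesis .
  qed
  have U1: "z + s *\<^sub>R u + t *\<^sub>R v \<in> U" if "0 \<le> s" "s \<le> h" "0 \<le> t" "t \<le> h" for s t
    using near[OF that] d3(2) by (auto simp: dist_commute)
  have U2: "z + s *\<^sub>R v + t *\<^sub>R u \<in> U" if "0 \<le> s" "s \<le> h" "0 \<le> t" "t \<le> h" for s t
    using U1[OF that(3,4,1,2)] by (simp add: add_ac)
  obtain s t where st: "0 < s" "s < h" "0 < t" "t < h"
    "f (z + h *\<^sub>R u + h *\<^sub>R v) - f (z + h *\<^sub>R u) - f (z + h *\<^sub>R v) + f z = h * (h * dd [v, u] f (z + s *\<^sub>R u + t *\<^sub>R v))"
    using second_difference[OF assms(3) h U1] by blast
  obtain s' t' where st': "0 < s'" "s' < h" "0 < t'" "t' < h"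
    "f (z + h *\<^sub>R v + h *\<^sub>R u) - f (z + h *\<^sub>R v) - f (z + h *\<^sub>R u) + f z = h * (h * dd [u, v] f (z + s' *\<^sub>R v + t' *\<^sub>R u))"
    using second_difference[OF assms(3) h U2] by blast
  have "h * (h * dd [v, u] f (z + s *\<^sub>R u + t *\<^sub>R v)) = h * (h * dd [u, v] f (z + s' *\<^sub>R v + t' *\<^sub>R u))"
    unfolding st(5)[symmetric] st'(5)[symmetric] by (simp add: add_ac)
  then have eq: "dd [v, u] f (z + s *\<^sub>R u + t *\<^sub>R v) = dd [u, v] f (z + t' *\<^sub>R u + s' *\<^sub>R v)"
    using h by (simp add: add_ac del: dd.simps)
  have "dist (dd [v, u] f (z + s *\<^sub>R u + t *\<^sub>R v)) (dd [v, u] f z) < e"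
    using near[of s t] st by (intro d1(2)) auto
  moreover have "dist (dd [u, v] f (z + t' *\<^sub>R u + s' *\<^sub>R v)) (dd [u, v] f z) < e"
    using near[of t' s'] st' by (intro d2(2)) auto
  moreover have "\<bar>a - b\<bar> \<le> \<bar>q - a\<bar> + \<bar>q - b\<bar>" for a b q :: real by arith
  ultimately show False unfolding eq e_def dist_real_def by (smt (verit) field_sum_of_halves)
qed

lemma dd_swap:
  fixes f :: "'a::real_normed_vector \<Rightarrow> complex"
  assumes "open U" "z \<in> U" "smooth_on U f"
  shows "dd [v, u] f z = dd [u, v] f z"
proof (rule complex_eqI)
  show "Re (dd [v, u] f z) = Re (dd [u, v] f z)"
    using dd_swap_real[OF assms(1,2) smooth_on_bounded_linear[OF assms(1) bounded_linear_Re assms(3)], of v u]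
    unfolding dd_bounded_linear[OF assms(1) bounded_linear_Re assms(3,2)] .
  show "Im (dd [v, u] f z) = Im (dd [u, v] f z)"
    using dd_swap_real[OF assms(1,2) smooth_on_bounded_linear[OF assms(1) bounded_linear_Im assms(3)], of v u]
    unfolding dd_bounded_linear[OF assms(1) bounded_linear_Im assms(3,2)] .
qed

section \<open>Wirtinger derivatives and their commutation\<close>

lemma wirt_eq_dd:
  "wirt j b g = (\<lambda>z. (if b then \<i> else - \<i>) / 2 * dd [axis j \<i>] g z + 1 / 2 * dd [axis j 1] g z)"
  by (auto simp: wirt_def fun_eq_iff field_simps)

lemma smooth_on_scale:
  fixes c :: complex
  assumes "open U" "smooth_on U f"
  shows "smooth_on U (\<lambda>x. c * f x)"
  by (rule smooth_on_bounded_linear[OF assms(1) bounded_linear_mult_right assms(2)])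

lemma smooth_on_wirt:
  assumes "open U" "smooth_on U g"
  shows "smooth_on U (wirt j b g)"
  unfolding wirt_eq_dd
  by (intro smooth_on_linear_combination smooth_on_scale smooth_on_dd assms)

lemma smooth_on_wirts: "open U \<Longrightarrow> smooth_on U g \<Longrightarrow> smooth_on U (wirts L g)"
  by (induction L) (auto simp: wirts_def intro: smooth_on_wirt)

lemma wirt_cong:
  assumes "open U" "z \<in> U" "\<And>x. x \<in> U \<Longrightarrow> f x = g x"
  shows "wirt j b f z = wirt j b g z"
  using frechet_derivative_cong_open[OF assms] by (simp add: wirt_def)

lemma dd_wirt:
  assumes "open U" "smooth_on U g" "z \<in> U"
  shows "dd vs (wirt j b g) z
    = (if b then \<i> else - \<i>) / 2 * dd (vs @ [axis j \<i>]) g z + 1 / 2 * dd (vs @ [axis j 1]) g z"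
proof -
  have s: "smooth_on U (dd [v] g)" "smooth_on U (\<lambda>x. 1 / 2 * dd [v] g x)" for v
    by (intro smooth_on_scale smooth_on_dd assms)+
  show ?thesis
    unfolding wirt_eq_dd dd_linear_combination[OF assms(1) s assms(3)]
      dd_bounded_linear[OF assms(1) bounded_linear_mult_right s(1) assms(3)] dd_append ..
qed

lemma wirt_commute:
  assumes "open U" "smooth_on U g" "z \<in> U"
  shows "wirt j b (wirt j' b' g) z = wirt j' b' (wirt j b g) z"
  unfolding wirt_eq_dd[of j b "wirt j' b' g"] wirt_eq_dd[of j' b' "wirt j b g"] dd_wirt[OF assms]
  using dd_swap[OF assms(1,3,2), of "axis j \<i>" "axis j' \<i>"] dd_swap[OF assms(1,3,2), of "axis j \<i>" "axis j' 1"]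
    dd_swap[OF assms(1,3,2), of "axis j 1" "axis j' \<i>"] dd_swap[OF assms(1,3,2), of "axis j 1" "axis j' 1"]
  by (simp add: algebra_simps del: dd.simps)

lemma wirts_Cons: "wirts (x # L) g = wirt (fst x) (snd x) (wirts L g)"
  by (simp add: wirts_def case_prod_unfold)

lemma wirts_move:
  assumes "open U" "smooth_on U g" "z \<in> U"
  shows "wirts (A @ x # B) g z = wirts (x # A @ B) g z"
  using assms(3)
proof (induction A arbitrary: z)
  case (Cons y A)
  have "wirts ((y # A) @ x # B) g z = wirt (fst y) (snd y) (wirts (x # A @ B) g) z"
    using wirt_cong[OF assms(1) Cons.prems Cons.IH] by (simp add: wirts_Cons)
  also have "\<dots> = wirts (x # (y # A) @ B) g z"
    using wirt_commute[OF assms(1) smooth_on_wirts[OF assms(1,2)] Cons.prems] by (simp add: wirts_Cons)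
  finally show ?case .
qed simp

text \<open>Makes the arbitrary choice in \<open>mixed_list\<close> harmless. The equality holds on
  all of \<open>U\<close>, which is what allows it to be differentiated again in the
  induction.\<close>

lemma wirts_permute:
  assumes "open U" "smooth_on U g" "z \<in> U" "mset L = mset L'"
  shows "wirts L g z = wirts L' g z"
  using assms(3,4)
proof (induction L arbitrary: L' z)
  case (Cons x L)
  then have "x \<in> set L'" by (metis list.set_intros(1) mset_eq_setD)
  then obtain A B where L': "L' = A @ x # B" by (meson split_list)
  then have "mset L = mset (A @ B)" using Cons.prems by simp
  have "wirts (x # L) g z = wirts (x # A @ B) g z"
    unfolding wirts_Cons
    by (rule wirt_cong[OF assms(1) Cons.prems(1)]) (rule Cons.IH[OF _ \<open>mset L = mset (A @ B)\<close>])
  then show ?case using wirts_move[OF assms(1,2) Cons.prems(1), of A x B] L' by simp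
qed simp

definition dir_coord :: "complex^'n \<Rightarrow> 'n \<times> bool \<Rightarrow> complex" where
  "dir_coord h x = (if snd x then cnj (h $ fst x) else h $ fst x)"

text \<open>A real-linear map splits into its \<open>dz_j\<close> and \<open>d cnj z_j\<close>
  parts; \<open>dir_coord h\<close> lists the values of these forms at \<open>h\<close>.\<close>

lemma frechet_derivative_eq_wirt:
  fixes g :: "complex^'n::finite \<Rightarrow> complex"
  assumes "g differentiable (at z)"
  shows "frechet_derivative g (at z) h = (\<Sum>x\<in>UNIV. dir_coord h x * wirt (fst x) (snd x) g z)"
proof -
  let ?D = "frechet_derivative g (at z)"
  have lin: "linear ?D" by (rule linear_frechet_derivative[OF assms])
  have "h = (\<Sum>j\<in>UNIV. Re (h $ j) *\<^sub>R axis j 1 + Im (h $ j) *\<^sub>R axis j \<i>)"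
  proof (subst vec_eq_iff, rule allI)
    fix i
    have "(\<Sum>j\<in>UNIV. Re (h $ j) *\<^sub>R axis j 1 + Im (h $ j) *\<^sub>R axis j \<i>) $ i
        = (\<Sum>j\<in>UNIV. if j = i then h $ i else 0)"
      unfolding sum_component
      by (rule sum.cong) (auto simp: axis_def complex_eq_iff)
    then show "h $ i = (\<Sum>j\<in>UNIV. Re (h $ j) *\<^sub>R axis j 1 + Im (h $ j) *\<^sub>R axis j \<i>) $ i" by simp
  qed
  then have "?D h = ?D (\<Sum>j\<in>UNIV. Re (h $ j) *\<^sub>R axis j 1 + Im (h $ j) *\<^sub>R axis j \<i>)" by simp
  also have "\<dots> = (\<Sum>j\<in>UNIV. Re (h $ j) *\<^sub>R ?D (axis j 1) + Im (h $ j) *\<^sub>R ?D (axis j \<i>))"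
    by (simp add: linear_sum[OF lin] linear_add[OF lin] linear_cmul[OF lin])
  also have "\<dots> = (\<Sum>j\<in>UNIV. \<Sum>b\<in>UNIV. dir_coord h (j, b) * wirt j b g z)"
  proof (rule sum.cong)
    fix j :: 'n
    show "Re (h $ j) *\<^sub>R ?D (axis j 1) + Im (h $ j) *\<^sub>R ?D (axis j \<i>) = (\<Sum>b\<in>UNIV. dir_coord h (j, b) * wirt j b g z)"
      by (simp add: UNIV_bool dir_coord_def wirt_def complex_eq_iff field_simps)
  qed simp
  also have "\<dots> = (\<Sum>x\<in>UNIV. dir_coord h x * wirt (fst x) (snd x) g z)"
    by (simp add: sum.cartesian_product UNIV_Times_UNIV case_prod_unfold)
  finally show ?thesis .
qed

section \<open>Taylor's formula as a sum over words of Wirtinger derivations\<close>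

definition word_monom :: "('n \<times> bool) list \<Rightarrow> complex^'n \<Rightarrow> complex" where
  "word_monom L h = prod_list (map (dir_coord h) L)"

lemma finite_words: "finite {L :: 'a::finite list. length L = k}"
  using finite_lists_length_eq[of "UNIV :: 'a set" k] by simp

lemma sum_words_Suc:
  fixes f :: "'a::finite list \<Rightarrow> 'b::comm_monoid_add"
  shows "(\<Sum>L | length L = Suc k. f L) = (\<Sum>x\<in>UNIV. \<Sum>L | length L = k. f (x # L))"
proof -
  have "{L :: 'a list. length L = Suc k} = (\<lambda>(x, L). x # L) ` (UNIV \<times> {L. length L = k})"
    by (auto simp: length_Suc_conv image_iff)
  moreover have "inj_on (\<lambda>(x, L). x # L) (UNIV \<times> {L :: 'a list. length L = k})" by (auto simp: inj_on_def)
  note sum.reindex[OF this, of f]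
  ultimately have "(\<Sum>L | length L = Suc k. f L) = sum (f \<circ> (\<lambda>(x, L). x # L)) (UNIV \<times> {L. length L = k})"
    by simp
  then show ?thesis by (simp add: sum.cartesian_product case_prod_unfold)
qed

text \<open>Each derivative along \<open>h\<close> prepends one letter, so every word occurs exactly
  once and no multinomial coefficients arise until words are collected by type.\<close>

lemma iterated_derivative_eq_words:
  fixes r :: "complex^'n::finite \<Rightarrow> real"
  assumes "open U" "smooth_on U r" "z \<in> U"
  shows "complex_of_real (dd (replicate k h) r z)
    = (\<Sum>L | length L = k. word_monom L h * wirts L (\<lambda>z. complex_of_real (r z)) z)"
  using assms(3)
proof (induction k arbitrary: z)
  case 0
  then show ?case by (simp add: word_monom_def wirts_def)
next
  case (Suc k)
  define R where "R = (\<lambda>z. complex_of_real (r z))"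
  have smR: "smooth_on U R"
    unfolding R_def by (rule smooth_on_bounded_linear[OF assms(1) bounded_linear_of_real assms(2)])
  have dW: "wirts L R differentiable (at z)" for L
    using smooth_on_wirts[OF assms(1) smR, of L] Suc.prems unfolding smooth_on_def by (metis dd.simps(1))
  have dS: "dd (replicate k h) r differentiable (at z)" using assms Suc.prems by (simp add: smooth_on_def)
  let ?S = "\<lambda>z. \<Sum>L | length L = k. word_monom L h * wirts L R z"
  have "(?S has_derivative (\<lambda>v. \<Sum>L | length L = k. word_monom L h * frechet_derivative (wirts L R) (at z) v)) (at z)"
    by (intro has_derivative_sum bounded_linear.has_derivative[OF bounded_linear_mult_right])
       (use dW in \<open>simp add: frechet_derivative_works\<close>)
  then have "frechet_derivative ?S (at z) = (\<lambda>v. \<Sum>L | length L = k. word_monom L h * frechet_derivative (wirts L R) (at z) v)"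
    by (rule frechet_derivative_at[symmetric])
  moreover have "frechet_derivative (\<lambda>x. complex_of_real (dd (replicate k h) r x)) (at z) = frechet_derivative ?S (at z)"
    by (rule frechet_derivative_cong_open[OF assms(1) Suc.prems]) (simp add: Suc.IH R_def)
  moreover have "frechet_derivative (\<lambda>x. complex_of_real (dd (replicate k h) r x)) (at z) h
      = complex_of_real (dd (replicate (Suc k) h) r z)"
    by (simp add: frechet_derivative_bounded_linear(1)[OF bounded_linear_of_real dS])
  ultimately have "complex_of_real (dd (replicate (Suc k) h) r z)
      = (\<Sum>L | length L = k. word_monom L h * frechet_derivative (wirts L R) (at z) h)" by metis
  also have "\<dots> = (\<Sum>L | length L = k. \<Sum>x\<in>UNIV. word_monom (x # L) h * wirts (x # L) R z)"
    by (simp add: frechet_derivative_eq_wirt[OF dW] sum_distrib_left word_monom_def wirts_Cons mult_ac)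
  also have "\<dots> = (\<Sum>L | length L = Suc k. word_monom L h * wirts L R z)"
    unfolding sum_words_Suc by (rule sum.swap)
  finally show ?case by (simp add: R_def)
qed

lemma word_monom_bound:
  "cmod (word_monom L h) \<le> norm h ^ length L"
proof (induction L)
  case (Cons x L)
  have "cmod (dir_coord h x) \<le> norm h" using Finite_Cartesian_Product.norm_nth_le[of h "fst x"] by (simp add: dir_coord_def)
  with Cons show ?case by (simp add: word_monom_def norm_mult mult_mono)
qed (simp add: word_monom_def)

text \<open>Taylor's theorem on the segment from \<open>p\<close> to \<open>p + h\<close>. The
  remainder is again a sum over words, now of length \<open>K\<close>, whose derivatives are bounded
  on a closed ball by compactness; so the constant is uniform in \<open>h\<close>.\<close>

lemma taylor_words:
  fixes r :: "complex^'n::finite \<Rightarrow> real"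
  assumes U: "open U" "p \<in> U" and r: "smooth_on U r" and K: "K > 0"
  shows "\<exists>C d. d > 0 \<and> (\<forall>h. norm h < d \<longrightarrow>
    cmod (complex_of_real (r (p + h)) - (\<Sum>k<K. (\<Sum>L | length L = k. word_monom L h * wirts L (\<lambda>z. complex_of_real (r z)) p) / fact k))
      \<le> C * norm h ^ K)"
proof -
  define R where "R = (\<lambda>z. complex_of_real (r z))"
  define W where "W = {L :: ('n \<times> bool) list. length L = K}"
  have finW: "finite W" unfolding W_def by (rule finite_words)
  have smR: "smooth_on U R"
    unfolding R_def by (rule smooth_on_bounded_linear[OF U(1) bounded_linear_of_real r])
  obtain d where d: "d > 0" "cball p d \<subseteq> U" using U by (meson open_contains_cball)
  have "\<exists>B. \<forall>z\<in>cball p d. cmod (wirts L R z) \<le> B" for L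
  proof -
    have "wirts L R differentiable (at z)" if "z \<in> cball p d" for z
      using smooth_on_wirts[OF U(1) smR, of L] d(2) that unfolding smooth_on_def by (metis dd.simps(1) subsetD)
    then have "continuous_on (cball p d) (wirts L R)"
      by (auto intro!: continuous_at_imp_continuous_on differentiable_imp_continuous_within)
    then have "bounded (wirts L R ` cball p d)"
      by (intro compact_imp_bounded compact_continuous_image compact_cball)
    then show ?thesis by (auto simp: bounded_iff)
  qed
  then obtain B where B: "\<And>L z. z \<in> cball p d \<Longrightarrow> cmod (wirts L R z) \<le> B L" by metis
  have "cmod (R (p + h) - (\<Sum>k<K. (\<Sum>L | length L = k. word_monom L h * wirts L R p) / fact k)) \<le> (\<Sum>L\<in>W. B L) * norm h ^ K"
    if h: "norm h < d" for h
  proof -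
    have inU: "p + s *\<^sub>R h \<in> cball p d" if "0 \<le> s" "s \<le> 1" for s
    proof -
      have "s * norm h \<le> 1 * norm h" using that by (intro mult_right_mono) auto
      then show ?thesis using that h by (simp add: dist_norm)
    qed
    define D where "D m s = dd (replicate m h) r (p + s *\<^sub>R h)" for m s
    have "\<exists>t>0. t < 1 \<and> r (p + 1 *\<^sub>R h) = (\<Sum>m<K. D m 0 / fact m * 1 ^ m) + D K t / fact K * 1 ^ K"
    proof (rule Maclaurin)
      show "D 0 = (\<lambda>s. r (p + s *\<^sub>R h))" by (simp add: D_def fun_eq_iff)
      show "\<forall>m t. m < K \<and> 0 \<le> t \<and> t \<le> 1 \<longrightarrow> (D m has_real_derivative D (Suc m) t) (at t)"
      proof (intro allI impI)
        fix m t assume t: "m < K \<and> 0 \<le> t \<and> t \<le> (1::real)"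
        then have "p + t *\<^sub>R h \<in> U" using inU d(2) by blast
        then have "dd (replicate m h) r differentiable (at (p + t *\<^sub>R h))" using r by (simp add: smooth_on_def)
        from DERIV_along_line[OF this] show "(D m has_real_derivative D (Suc m) t) (at t)"
          unfolding D_def by simp
      qed
    qed (use K in auto)
    then obtain t where t: "0 < t" "t < 1" "r (p + h) = (\<Sum>m<K. D m 0 / fact m) + D K t / fact K" by auto
    have words: "complex_of_real (D m s) = (\<Sum>L | length L = m. word_monom L h * wirts L R (p + s *\<^sub>R h))"
      if "0 \<le> s" "s \<le> 1" for m s
      unfolding D_def R_def
      by (rule iterated_derivative_eq_words[OF U(1) r]) (use inU[OF that] d(2) in blast)
    have "R (p + h) - (\<Sum>k<K. (\<Sum>L | length L = k. word_monom L h * wirts L R p) / fact k) = of_real (D K t) / fact K"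
      using words[of 0] by (simp add: R_def t(3))
    also have "cmod \<dots> \<le> cmod (of_real (D K t))"
      by (simp add: norm_divide divide_le_eq mult_le_cancel_left1 fact_ge_1)
    also have "of_real (D K t) = (\<Sum>L\<in>W. word_monom L h * wirts L R (p + t *\<^sub>R h))"
      using words[of t K] t by (simp add: W_def)
    also have "cmod \<dots> \<le> (\<Sum>L\<in>W. norm h ^ K * B L)"
    proof (rule sum_norm_le)
      fix L assume "L \<in> W"
      then have "cmod (word_monom L h) \<le> norm h ^ K" using word_monom_bound[of L h] by (simp add: W_def)
      moreover have "cmod (wirts L R (p + t *\<^sub>R h)) \<le> B L" using t by (intro B inU) auto
      ultimately show "cmod (word_monom L h * wirts L R (p + t *\<^sub>R h)) \<le> norm h ^ K * B L"
        unfolding norm_mult by (intro mult_mono) auto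
    qed
    finally show ?thesis by (simp add: sum_distrib_right mult.commute)
  qed
  with d(1) show ?thesis unfolding R_def by blast
qed

section \<open>From words to multi-indices\<close>

lemma mixed_list_count:
  "count_list (mixed_list \<alpha> \<beta>) (j, False) = \<alpha> j \<and> count_list (mixed_list \<alpha> \<beta>) (j, True) = \<beta> j"
proof -
  define f where "f x = (if snd x then \<beta> (fst x) else \<alpha> (fst x))" for x
  obtain L where "mset L = Abs_multiset f" using ex_mset by blast
  then have "count_list L x = f x" for x
    using count_Abs_multiset[of f] by (metis count_mset finite)
  then have "\<exists>L. \<forall>j. count_list L (j, False) = \<alpha> j \<and> count_list L (j, True) = \<beta> j"
    by (intro exI[of _ L]) (auto simp: f_def)
  then show ?thesis unfolding mixed_list_def by (rule someI2_ex) blast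
qed

definition word_type :: "('n \<times> bool) list \<Rightarrow> ('n \<Rightarrow> nat) \<times> ('n \<Rightarrow> nat)" where
  "word_type L = (\<lambda>j. count_list L (j, False), \<lambda>j. count_list L (j, True))"

lemma word_type_eq_iff: "word_type L = (\<alpha>, \<beta>) \<longleftrightarrow> mset L = mset (mixed_list \<alpha> \<beta>)"
proof -
  have "word_type L = (\<alpha>, \<beta>) \<longleftrightarrow> (\<forall>x. count_list L x = count_list (mixed_list \<alpha> \<beta>) x)"
    using mixed_list_count[of \<alpha> \<beta>] by (auto simp: word_type_def fun_eq_iff) (metis (full_types))+
  then show ?thesis by (simp add: multiset_eq_iff count_mset)
qed

lemma sum_count_list: "(\<Sum>x\<in>UNIV. count_list L x) = length (L :: 'a::finite list)"
  using sum_count_set[of L UNIV] by simp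

lemma sum_pair_bool:
  fixes f :: "'n::finite \<times> bool \<Rightarrow> 'b::comm_monoid_add"
  shows "(\<Sum>x\<in>UNIV. f x) = (\<Sum>j\<in>UNIV. f (j, False)) + (\<Sum>j\<in>UNIV. f (j, True))"
proof -
  have "(\<Sum>x\<in>(UNIV :: ('n \<times> bool) set). f x) = (\<Sum>j\<in>UNIV. \<Sum>b\<in>UNIV. f (j, b))"
    by (simp add: sum.cartesian_product UNIV_Times_UNIV)
  then show ?thesis by (simp add: UNIV_bool sum.distrib)
qed

lemma prod_pair_bool:
  fixes f :: "'n::finite \<times> bool \<Rightarrow> 'b::comm_monoid_mult"
  shows "(\<Prod>x\<in>UNIV. f x) = (\<Prod>j\<in>UNIV. f (j, False)) * (\<Prod>j\<in>UNIV. f (j, True))"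
proof -
  have "(\<Prod>x\<in>(UNIV :: ('n \<times> bool) set). f x) = (\<Prod>j\<in>UNIV. \<Prod>b\<in>UNIV. f (j, b))"
    by (simp add: prod.cartesian_product UNIV_Times_UNIV)
  then show ?thesis by (simp add: UNIV_bool prod.distrib)
qed

lemma word_monom_eq:
  assumes "word_type L = (\<alpha>, \<beta>)"
  shows "word_monom L h = (\<Prod>j\<in>UNIV. (h $ j) ^ \<alpha> j) * (\<Prod>j\<in>UNIV. cnj (h $ j) ^ \<beta> j)"
proof -
  have "word_monom L h = (\<Prod>x\<in>UNIV. dir_coord h x ^ count_list L x)"
    unfolding word_monom_def
  proof (induction L)
    case (Cons y L)
    have "(\<Prod>x\<in>UNIV. dir_coord h x ^ count_list (y # L) x)
        = (\<Prod>x\<in>UNIV. (if x = y then dir_coord h y else 1) * dir_coord h x ^ count_list L x)"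
      by (rule prod.cong) auto
    with Cons show ?case by (simp add: prod.distrib)
  qed simp
  then show ?thesis using assms by (auto simp: prod_pair_bool dir_coord_def word_type_def)
qed

text \<open>The words of one type are the permutations of a single multiset. Their number turns
  \<open>1 / fact k\<close> into the factorials of \<open>taylor_coeff\<close>.\<close>

lemma card_word_type:
  fixes \<alpha> \<beta> :: "'n::finite \<Rightarrow> nat"
  shows "card {L. word_type L = (\<alpha>, \<beta>)} * ((\<Prod>j\<in>UNIV. fact (\<alpha> j)) * (\<Prod>j\<in>UNIV. fact (\<beta> j))) = fact (sum \<alpha> UNIV + sum \<beta> UNIV)"
proof -
  define M where "M = mset (mixed_list \<alpha> \<beta>)"
  have cM: "count M (j, False) = \<alpha> j" "count M (j, True) = \<beta> j" for j
    using mixed_list_count[of \<alpha> \<beta>] by (simp_all add: M_def count_mset)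
  have "{L. word_type L = (\<alpha>, \<beta>)} = permutations_of_multiset M"
    by (auto simp: word_type_eq_iff permutations_of_multiset_def M_def)
  moreover have "(\<Prod>x\<in>set_mset M. fact (count M x)) = (\<Prod>x\<in>UNIV. fact (count M x) :: nat)"
    by (rule prod.mono_neutral_left) (auto simp: not_in_iff)
  moreover have "size M = (\<Sum>x\<in>UNIV. count M x)"
    unfolding M_def using sum_count_list[of "mixed_list \<alpha> \<beta>"] by (simp add: count_mset)
  ultimately show ?thesis
    using card_permutations_of_multiset_aux[of M] by (simp add: prod_pair_bool sum_pair_bool cM)
qed

text \<open>Words of the same type contribute equal terms, since the derivations commute, and
  \<open>card_word_type\<close> counts them.\<close>

lemma words_eq_taylor:
  fixes r :: "complex^'n::finite \<Rightarrow> real"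
  assumes U: "open U" "p \<in> U" and r: "smooth_on U r"
  shows "(\<Sum>L | length L = k. word_monom L h * wirts L (\<lambda>z. complex_of_real (r z)) p) / fact k
    = (\<Sum>(\<alpha>, \<beta>) | sum \<alpha> UNIV + sum \<beta> UNIV = k. taylor_coeff r p \<alpha> \<beta> * (\<Prod>j\<in>UNIV. (h $ j) ^ \<alpha> j) * (\<Prod>j\<in>UNIV. cnj (h $ j) ^ \<beta> j))"
proof -
  define R where "R = (\<lambda>z. complex_of_real (r z))"
  have smR: "smooth_on U R"
    unfolding R_def by (rule smooth_on_bounded_linear[OF U(1) bounded_linear_of_real r])
  define I where "I = {(\<alpha> :: 'n \<Rightarrow> nat, \<beta> :: 'n \<Rightarrow> nat). sum \<alpha> UNIV + sum \<beta> UNIV = k}"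
  define W where "W = {L :: ('n \<times> bool) list. length L = k}"
  have len: "length L = sum \<alpha> UNIV + sum \<beta> UNIV" if "word_type L = (\<alpha>, \<beta>)" for L :: "('n \<times> bool) list" and \<alpha> \<beta>
    using sum_count_list[of L] that by (auto simp: sum_pair_bool word_type_def)
  have type_mixed: "word_type (mixed_list \<alpha> \<beta>) = (\<alpha>, \<beta>)" for \<alpha> \<beta> :: "'n \<Rightarrow> nat"
    by (simp add: word_type_eq_iff)
  have img: "word_type ` W = I"
  proof
    show "word_type ` W \<subseteq> I"
    proof
      fix y assume "y \<in> word_type ` W"
      then obtain L where L: "length L = k" "y = word_type L" by (auto simp: W_def)
      obtain \<alpha> \<beta> where y: "y = (\<alpha>, \<beta>)" by (cases y)
      have "sum \<alpha> UNIV + sum \<beta> UNIV = k" using len[of L \<alpha> \<beta>] L y by simp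
      then show "y \<in> I" by (simp add: I_def y)
    qed
    show "I \<subseteq> word_type ` W"
    proof
      fix y assume "y \<in> I"
      then obtain \<alpha> \<beta> where y: "y = (\<alpha>, \<beta>)" "sum \<alpha> UNIV + sum \<beta> UNIV = k" by (auto simp: I_def)
      then have "mixed_list \<alpha> \<beta> \<in> W" using len[OF type_mixed] by (simp add: W_def)
      then show "y \<in> word_type ` W" using type_mixed[of \<alpha> \<beta>] y(1) by (metis imageI)
    qed
  qed
  have finW: "finite W" unfolding W_def by (rule finite_words)
  have "(\<Sum>L\<in>W. word_monom L h * wirts L R p) = (\<Sum>y\<in>word_type ` W. \<Sum>L\<in>{L\<in>W. word_type L = y}. word_monom L h * wirts L R p)"
    by (rule sum.image_gen[OF finW])
  also have "\<dots> = (\<Sum>(\<alpha>, \<beta>)\<in>I. fact k * (taylor_coeff r p \<alpha> \<beta> * (\<Prod>j\<in>UNIV. (h $ j) ^ \<alpha> j) * (\<Prod>j\<in>UNIV. cnj (h $ j) ^ \<beta> j)))"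
    unfolding img
  proof (rule sum.cong, simp, clarify)
    fix \<alpha> \<beta> :: "'n \<Rightarrow> nat" assume "(\<alpha>, \<beta>) \<in> I"
    then have k: "sum \<alpha> UNIV + sum \<beta> UNIV = k" by (simp add: I_def)
    define mon where "mon = (\<Prod>j\<in>UNIV. (h $ j) ^ \<alpha> j) * (\<Prod>j\<in>UNIV. cnj (h $ j) ^ \<beta> j)"
    define F where "F = (\<Prod>j\<in>UNIV. fact (\<alpha> j)) * (\<Prod>j\<in>UNIV. fact (\<beta> j) :: nat)"
    have "L \<in> W" if "word_type L = (\<alpha>, \<beta>)" for L using len[OF that] k by (simp add: W_def)
    then have S: "{L\<in>W. word_type L = (\<alpha>, \<beta>)} = {L. word_type L = (\<alpha>, \<beta>)}" by blast
    have "(\<Sum>L\<in>{L\<in>W. word_type L = (\<alpha>, \<beta>)}. word_monom L h * wirts L R p)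
        = (\<Sum>L\<in>{L. word_type L = (\<alpha>, \<beta>)}. mon * wirts (mixed_list \<alpha> \<beta>) R p)"
      unfolding S
    proof (rule sum.cong)
      fix L assume "L \<in> {L. word_type L = (\<alpha>, \<beta>)}"
      then have L: "word_type L = (\<alpha>, \<beta>)" by simp
      have "wirts L R p = wirts (mixed_list \<alpha> \<beta>) R p"
        by (rule wirts_permute[OF U(1) smR U(2)]) (use L word_type_eq_iff in blast)
      then show "word_monom L h * wirts L R p = mon * wirts (mixed_list \<alpha> \<beta>) R p"
        by (simp add: word_monom_eq[OF L] mon_def)
    qed simp
    also have "\<dots> = of_nat (card {L. word_type L = (\<alpha>, \<beta>)}) * (mon * wirts (mixed_list \<alpha> \<beta>) R p)" by simp
    also have "of_nat (card {L. word_type L = (\<alpha>, \<beta>)}) * (mon * wirts (mixed_list \<alpha> \<beta>) R p)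
        = of_nat (card {L. word_type L = (\<alpha>, \<beta>)} * F) * (mon * wirts (mixed_list \<alpha> \<beta>) R p / of_nat F)"
      by (simp add: F_def)
    also have "card {L. word_type L = (\<alpha>, \<beta>)} * F = fact k" using card_word_type[of \<alpha> \<beta>] by (simp add: F_def k)
    also have "mon * wirts (mixed_list \<alpha> \<beta>) R p / of_nat F = taylor_coeff r p \<alpha> \<beta> * mon"
      by (simp add: taylor_coeff_def R_def F_def)
    finally show "(\<Sum>L\<in>{L\<in>W. word_type L = (\<alpha>, \<beta>)}. word_monom L h * wirts L R p)
      = fact k * (taylor_coeff r p \<alpha> \<beta> * (\<Prod>j\<in>UNIV. (h $ j) ^ \<alpha> j) * (\<Prod>j\<in>UNIV. cnj (h $ j) ^ \<beta> j))"
      by (simp add: mon_def mult.assoc)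
  qed
  finally show ?thesis
    by (simp add: W_def I_def R_def case_prod_unfold sum_distrib_left[symmetric])
qed

section \<open>Composition with a curve\<close>

text \<open>After the subtraction the expansion is divisible by \<open>t^K\<close>, and the quotient
  has a limit at 0.\<close>

lemma fps_expansion_remainder:
  fixes f :: "complex \<Rightarrow> complex"
  assumes f: "f has_fps_expansion F"
  shows "(\<lambda>t. f t - (\<Sum>i<K. fps_nth F i * t ^ i)) \<in> O[at 0](\<lambda>t. t ^ K)"
proof -
  define R where "R t = f t - (\<Sum>i<K. fps_nth F i * t ^ i)" for t
  define G where "G = F - (\<Sum>i<K. fps_const (fps_nth F i) * fps_X ^ i)"
  have R: "R has_fps_expansion G"
    unfolding R_def G_def by (intro fps_expansion_intros f)
  have "fps_nth G n = 0" if "n < K" for n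
  proof -
    have "fps_nth (fps_const (fps_nth F i) * fps_X ^ i) n = (if i = n then fps_nth F n else 0)" for i
      by auto
    then show ?thesis using that by (simp add: G_def fps_sum_nth)
  qed
  then have sub: "K \<le> subdegree G" if "G \<noteq> 0" using that by (intro subdegree_geI)
  have "R \<in> O[at 0](\<lambda>t. t ^ K)"
  proof (cases "G = 0")
    \<comment> \<open>The zero series has \<open>subdegree\<close> 0, so the division argument does
      not cover it.\<close>
    case True
    have "eventually (\<lambda>t. eval_fps G t = R t) (nhds 0)" using R by (simp add: has_fps_expansion_def)
    then have "eventually (\<lambda>t. R t = 0) (at 0)"
      unfolding eventually_nhds_conv_at by (elim conjE eventually_mono) (simp add: True eval_fps_def)
    then show ?thesis by (intro bigoI[of _ 0], elim eventually_mono) simp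
  next
    case False
    have "(\<lambda>x. if x = 0 then fps_nth G K else R x / x ^ K) has_fps_expansion fps_shift K G"
      by (rule has_fps_expansion_shift[OF R sub[OF False] refl])
    from has_fps_expansion_imp_continuous[OF this, of UNIV]
    have "((\<lambda>x. if x = 0 then fps_nth G K else R x / x ^ K) \<longlongrightarrow> fps_nth G K) (at 0)"
      unfolding continuous_within by simp
    then have "((\<lambda>x. R x / x ^ K) \<longlongrightarrow> fps_nth G K) (at 0)"
      by (rule Lim_transform_eventually) (unfold eventually_at_filter, simp)
    moreover have "eventually (\<lambda>t :: complex. t ^ K \<noteq> 0) (at 0)" unfolding eventually_at_filter by simp
    ultimately show ?thesis by (rule bigoI_tendsto)
  qed
  then show ?thesis by (simp add: R_def[abs_def])
qed

section \<open>Expansion of \<open>r\<close> along a holomorphic curve\<close>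

lemma bigo_power_mono:
  assumes "b \<le> a"
  shows "(\<lambda>t :: complex. t ^ a) \<in> O[at 0](\<lambda>t. t ^ b)"
proof (rule bigoI[of _ 1])
  have "eventually (\<lambda>t :: complex. norm t < 1) (at 0)"
    unfolding eventually_at by (intro exI[of _ 1]) (simp add: dist_norm)
  then show "eventually (\<lambda>t :: complex. norm (t ^ a) \<le> 1 * norm (t ^ b)) (at 0)"
    by eventually_elim (use assms in \<open>simp add: norm_power power_decreasing\<close>)
qed

lemma bigo_cnj: "f \<in> O[F](g) \<Longrightarrow> (\<lambda>t. cnj (f t)) \<in> O[F](g)"
  unfolding landau_o.big.norm_iff[of "\<lambda>t. cnj (f t)", symmetric] landau_o.big.norm_iff[of f, symmetric] by simp

lemma bigo_monomial:
  assumes "K \<le> a + b"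
  shows "(\<lambda>t. c * t ^ a * cnj t ^ b) \<in> O[at 0](\<lambda>t :: complex. t ^ K)"
proof -
  have "(\<lambda>t :: complex. t ^ (a + b)) \<in> O[at 0](\<lambda>t. t ^ K)" by (rule bigo_power_mono) fact
  moreover have "(\<lambda>t. c * t ^ a * cnj t ^ b) \<in> O[at 0](\<lambda>t. t ^ (a + b))"
    by (intro bigoI[of _ "norm c"] always_eventually) (simp add: norm_mult norm_power power_add)
  ultimately show ?thesis by (rule landau_o.big.trans[rotated])
qed

text \<open>Each factor is replaced by its Taylor polynomial below order \<open>K\<close> while the
  other one stays bounded; in the product of the polynomials the terms with
  \<open>a + b \<ge> K\<close> are themselves \<open>O(t^K)\<close>.\<close>

lemma hermitian_product_expansion:
  fixes f g :: "complex \<Rightarrow> complex"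
  assumes f: "f has_fps_expansion F" and g: "g has_fps_expansion G"
  shows "(\<lambda>t. f t * cnj (g t) - (\<Sum>(a, b) | a + b < K. fps_nth F a * cnj (fps_nth G b) * t ^ a * cnj t ^ b))
    \<in> O[at 0](\<lambda>t. t ^ K)"
proof -
  define E where "E H t = (\<Sum>i<K. fps_nth H i * t ^ i)" for H and t :: complex
  have bounded: "h \<in> O[at 0](\<lambda>_. 1)" if "h has_fps_expansion H" for h :: "complex \<Rightarrow> complex" and H
    using has_fps_expansion_imp_continuous[OF that, of UNIV] by (intro bigoI_tendsto[of _ _ "h 0"]) (auto simp: continuous_within)
  have E1: "E H \<in> O[at 0](\<lambda>_. 1)" for H
    unfolding E_def
  proof (rule big_sum_in_bigo)
    fix i
    show "(\<lambda>t. fps_nth H i * t ^ i) \<in> O[at 0](\<lambda>_. 1)" using bigo_monomial[of 0 i 0 "fps_nth H i"] by simp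
  qed
  have f': "(\<lambda>t. f t - E F t) \<in> O[at 0](\<lambda>t. t ^ K)" and g': "(\<lambda>t. g t - E G t) \<in> O[at 0](\<lambda>t. t ^ K)"
    unfolding E_def by (intro fps_expansion_remainder f g)+
  have "(\<lambda>t. (f t - E F t) * cnj (g t)) \<in> O[at 0](\<lambda>t. t ^ K * 1)"
    by (intro landau_o.big.mult f' bigo_cnj bounded[OF g])
  moreover have "(\<lambda>t. E F t * cnj (g t - E G t)) \<in> O[at 0](\<lambda>t. 1 * t ^ K)"
    by (intro landau_o.big.mult bigo_cnj g' E1)
  moreover have "(\<lambda>t. \<Sum>(a, b)\<in>{x \<in> {..<K} \<times> {..<K}. \<not> fst x + snd x < K}. fps_nth F a * cnj (fps_nth G b) * t ^ a * cnj t ^ b)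
      \<in> O[at 0](\<lambda>t. t ^ K)"
    by (intro big_sum_in_bigo) (auto simp: case_prod_unfold intro!: bigo_monomial)
  ultimately have "(\<lambda>t. (f t - E F t) * cnj (g t) + E F t * cnj (g t - E G t)
      + (\<Sum>(a, b)\<in>{x \<in> {..<K} \<times> {..<K}. \<not> fst x + snd x < K}. fps_nth F a * cnj (fps_nth G b) * t ^ a * cnj t ^ b))
      \<in> O[at 0](\<lambda>t. t ^ K)" by (intro sum_in_bigo) simp_all
  moreover have "E F t * cnj (E G t) = (\<Sum>(a, b)\<in>{x \<in> {..<K} \<times> {..<K}. \<not> fst x + snd x < K}. fps_nth F a * cnj (fps_nth G b) * t ^ a * cnj t ^ b)
      + (\<Sum>(a, b) | a + b < K. fps_nth F a * cnj (fps_nth G b) * t ^ a * cnj t ^ b)" for t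
  proof -
    have "E F t * cnj (E G t) = (\<Sum>(a, b)\<in>{..<K} \<times> {..<K}. fps_nth F a * cnj (fps_nth G b) * t ^ a * cnj t ^ b)"
      by (simp add: E_def sum_product sum.cartesian_product mult_ac)
    also have "{..<K} \<times> {..<K} = {x \<in> {..<K} \<times> {..<K}. \<not> fst x + snd x < K} \<union> {(a, b). a + b < K}" by auto
    also have "(\<Sum>(a, b)\<in>\<dots>. fps_nth F a * cnj (fps_nth G b) * t ^ a * cnj t ^ b)
       = (\<Sum>(a, b)\<in>{x \<in> {..<K} \<times> {..<K}. \<not> fst x + snd x < K}. fps_nth F a * cnj (fps_nth G b) * t ^ a * cnj t ^ b)
        + (\<Sum>(a, b) | a + b < K. fps_nth F a * cnj (fps_nth G b) * t ^ a * cnj t ^ b)"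
    proof (rule sum.union_disjoint)
      show "finite {(a, b). a + b < K}" by (rule finite_subset[of _ "{..<K} \<times> {..<K}"]) auto
    qed auto
    finally show ?thesis .
  qed
  ultimately show ?thesis by (simp add: algebra_simps)
qed

text \<open>Every \<open>Z j\<close> is divisible by \<open>t^m\<close>. With \<open>m = 1\<close>
  this bounds the degree of the coefficient functionals; with \<open>m\<close> the multiplicity it
  gives the sharp bound used in \<open>isotropic_system_of_curve\<close>.\<close>

lemma fps_nth_prod_power_eq_0:
  fixes Z :: "'n::finite \<Rightarrow> complex fps"
  assumes "\<And>j i. i < m \<Longrightarrow> fps_nth (Z j) i = 0" "a < m * sum \<alpha> UNIV"
  shows "fps_nth (\<Prod>j\<in>UNIV. Z j ^ \<alpha> j) a = 0"
proof -
  define W where "W j = fps_shift m (Z j)" for j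
  have "Z j = fps_X ^ m * W j" for j
    by (rule fps_ext) (simp add: W_def fps_X_power_mult_nth assms(1))
  then have "(\<Prod>j\<in>UNIV. Z j ^ \<alpha> j) = fps_X ^ (m * sum \<alpha> UNIV) * (\<Prod>j\<in>UNIV. W j ^ \<alpha> j)"
    by (simp add: power_mult_distrib prod.distrib power_mult[symmetric] power_sum sum_distrib_left)
  then show ?thesis using assms(2) by (simp add: fps_X_power_mult_nth)
qed

definition comp_coeff ::
  "(('n::finite \<Rightarrow> nat) \<Rightarrow> ('n \<Rightarrow> nat) \<Rightarrow> complex) \<Rightarrow> ('n \<Rightarrow> complex fps) \<Rightarrow> nat \<Rightarrow> nat \<Rightarrow> complex" where
  "comp_coeff C Z a b = (\<Sum>\<alpha>\<in>{\<alpha>. sum \<alpha> UNIV \<le> a}. \<Sum>\<beta>\<in>{\<beta>. sum \<beta> UNIV \<le> b}.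
     C \<alpha> \<beta> * fps_nth (\<Prod>j\<in>UNIV. Z j ^ \<alpha> j) a * cnj (fps_nth (\<Prod>j\<in>UNIV. Z j ^ \<beta> j) b))"

lemma formal_comp_coeff_eq:
  "formal_comp_coeff r p \<zeta> = comp_coeff (taylor_coeff r p) (\<lambda>j. \<zeta> j - fps_const (p $ j))"
  by (simp add: fun_eq_iff formal_comp_coeff_def comp_coeff_def)

text \<open>As \<open>h t = O(t)\<close>, the Taylor remainder of order \<open>K\<close> is
  \<open>O(t^K)\<close>, and the finitely many Taylor monomials are expanded by
  \<open>hermitian_product_expansion\<close>.\<close>

lemma composition_expansion:
  fixes r :: "complex^'n::finite \<Rightarrow> real" and h :: "complex \<Rightarrow> complex^'n"
  assumes U: "open U" "p \<in> U" and r: "smooth_on U r" and K: "K > 0"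
    and h: "\<And>j. (\<lambda>t. h t $ j) has_fps_expansion Z j" and Z0: "\<And>j. fps_nth (Z j) 0 = 0"
  shows "(\<lambda>t. complex_of_real (r (p + h t)) - (\<Sum>(a, b) | a + b < K. comp_coeff (taylor_coeff r p) Z a b * t ^ a * cnj t ^ b))
    \<in> O[at 0](\<lambda>t. t ^ K)"
proof -
  define C where "C = taylor_coeff r p"
  define I where "I k = {(\<alpha> :: 'n \<Rightarrow> nat, \<beta> :: 'n \<Rightarrow> nat). sum \<alpha> UNIV + sum \<beta> UNIV = k}" for k
  define J where "J = {(\<alpha> :: 'n \<Rightarrow> nat, \<beta> :: 'n \<Rightarrow> nat). sum \<alpha> UNIV + sum \<beta> UNIV < K}"
  define mon where "mon \<alpha> t = (\<Prod>j\<in>UNIV. (h t $ j) ^ \<alpha> j)" for \<alpha> t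
  define Zm where "Zm \<alpha> = (\<Prod>j\<in>UNIV. Z j ^ \<alpha> j)" for \<alpha>
  define P where "P t = (\<Sum>(\<alpha>, \<beta>)\<in>J. C \<alpha> \<beta> * (mon \<alpha> t * cnj (mon \<beta> t)))" for t
  have J_sub: "J \<subseteq> {\<alpha>. sum \<alpha> UNIV \<le> K} \<times> {\<beta>. sum \<beta> UNIV \<le> K}" by (auto simp: J_def)
  have finJ: "finite J" by (rule finite_subset[OF J_sub]) (intro finite_cartesian_product finite_multi_index)
  have J_eq: "J = (\<Union>k\<in>{..<K}. I k)" by (auto simp: J_def I_def)
  have finI: "finite (I k)" if "k < K" for k
    by (rule finite_subset[OF _ finJ]) (use that in \<open>auto simp: J_def I_def\<close>)
  obtain B d where B: "d > 0" "\<And>v. norm v < d \<Longrightarrow>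
     cmod (complex_of_real (r (p + v)) - (\<Sum>k<K. (\<Sum>L | length L = k. word_monom L v * wirts L (\<lambda>z. complex_of_real (r z)) p) / fact k))
      \<le> B * norm v ^ K"
    using taylor_words[OF U r K] by blast
  have taylor: "cmod (complex_of_real (r (p + h t)) - P t) \<le> B * norm (h t) ^ K" if "norm (h t) < d" for t
  proof -
    have "(\<Sum>k<K. (\<Sum>L | length L = k. word_monom L (h t) * wirts L (\<lambda>z. complex_of_real (r z)) p) / fact k)
       = (\<Sum>k<K. \<Sum>(\<alpha>, \<beta>)\<in>I k. C \<alpha> \<beta> * (mon \<alpha> t * cnj (mon \<beta> t)))"
      unfolding words_eq_taylor[OF U r] by (simp add: I_def C_def mon_def mult.assoc)
    also have "\<dots> = P t"
      unfolding P_def J_eq by (rule sum.UNION_disjoint[symmetric]) (use finI in \<open>auto simp: I_def\<close>)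
    finally show ?thesis using B(2)[OF that] by simp
  qed
  have hO: "(\<lambda>t. h t $ j) \<in> O[at 0](\<lambda>t. t)" for j
    using fps_expansion_remainder[OF h[of j], of 1] Z0[of j] by simp
  have normO: "(\<lambda>t. complex_of_real (norm (h t))) \<in> O[at 0](\<lambda>t. t)"
  proof -
    have "(\<lambda>t. \<Sum>j\<in>UNIV. complex_of_real (cmod (h t $ j))) \<in> O[at 0](\<lambda>t. t)"
    proof (rule big_sum_in_bigo)
      fix j
      show "(\<lambda>t. complex_of_real (cmod (h t $ j))) \<in> O[at 0](\<lambda>t. t)"
        using hO[of j] unfolding landau_o.big.norm_iff[of "\<lambda>t. complex_of_real (cmod (h t $ j))", symmetric]
          landau_o.big.norm_iff[of "\<lambda>t. h t $ j", symmetric] by simp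
    qed
    moreover have "(\<lambda>t. complex_of_real (norm (h t))) \<in> O[at 0](\<lambda>t. \<Sum>j\<in>UNIV. complex_of_real (cmod (h t $ j)))"
    proof (intro bigoI[of _ 1] always_eventually allI)
      fix t
      have "norm (h t) \<le> (\<Sum>j\<in>UNIV. cmod (h t $ j))" unfolding norm_vec_def by (rule L2_set_le_sum) simp
      then show "norm (complex_of_real (norm (h t))) \<le> 1 * norm (\<Sum>j\<in>UNIV. complex_of_real (cmod (h t $ j)))"
        by (simp flip: of_real_sum add: sum_nonneg)
    qed
    ultimately show ?thesis by (rule landau_o.big.trans[rotated])
  qed
  have h0: "eventually (\<lambda>t. norm (h t) < d) (at 0)"
  proof -
    obtain c where c: "c > 0" "eventually (\<lambda>t. norm (complex_of_real (norm (h t))) \<le> c * norm t) (at 0)"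
      using landau_o.bigE[OF normO] by blast
    have "eventually (\<lambda>t :: complex. norm t < d / c) (at 0)"
      unfolding eventually_at using B(1) c(1) by (intro exI[of _ "d / c"]) (simp add: dist_norm)
    with c(2) show ?thesis
      by eventually_elim (use c(1) in \<open>simp add: field_simps\<close>)
  qed
  have main: "(\<lambda>t. complex_of_real (r (p + h t)) - P t) \<in> O[at 0](\<lambda>t. t ^ K)"
  proof (rule landau_o.big.trans)
    show "(\<lambda>t. complex_of_real (r (p + h t)) - P t) \<in> O[at 0](\<lambda>t. complex_of_real (norm (h t)) ^ K)"
      by (rule bigoI[of _ B]) (use h0 in eventually_elim, use taylor in \<open>simp add: norm_power\<close>)
    show "(\<lambda>t. complex_of_real (norm (h t)) ^ K) \<in> O[at 0](\<lambda>t. t ^ K)"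
      using landau_o.big_power[OF normO, of K] by simp
  qed
  define c where "c \<alpha> \<beta> a b = fps_nth (Zm \<alpha>) a * cnj (fps_nth (Zm \<beta>) b)" for \<alpha> \<beta> a b
  have mon: "mon \<alpha> has_fps_expansion Zm \<alpha>" for \<alpha>
    unfolding mon_def Zm_def by (intro has_fps_expansion_prod has_fps_expansion_power h)
  have "(\<lambda>t. P t - (\<Sum>(\<alpha>, \<beta>)\<in>J. C \<alpha> \<beta> * (\<Sum>(a, b) | a + b < K. c \<alpha> \<beta> a b * t ^ a * cnj t ^ b))) \<in> O[at 0](\<lambda>t. t ^ K)"
  proof -
    have "(\<lambda>t. \<Sum>x\<in>J. C (fst x) (snd x) * (mon (fst x) t * cnj (mon (snd x) t)
        - (\<Sum>(a, b) | a + b < K. c (fst x) (snd x) a b * t ^ a * cnj t ^ b))) \<in> O[at 0](\<lambda>t. t ^ K)"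
    proof (rule big_sum_in_bigo)
      fix x
      have "(\<lambda>t. C (fst x) (snd x) * (mon (fst x) t * cnj (mon (snd x) t)
        - (\<Sum>(a, b) | a + b < K. c (fst x) (snd x) a b * t ^ a * cnj t ^ b))) \<in> O[at 0](\<lambda>t. 1 * t ^ K)"
        unfolding c_def by (intro landau_o.big.mult bigo_const hermitian_product_expansion mon)
      then show "(\<lambda>t. C (fst x) (snd x) * (mon (fst x) t * cnj (mon (snd x) t)
        - (\<Sum>(a, b) | a + b < K. c (fst x) (snd x) a b * t ^ a * cnj t ^ b))) \<in> O[at 0](\<lambda>t. t ^ K)"
        by (simp only: mult_1)
    qed
    then show ?thesis unfolding P_def by (simp add: case_prod_unfold right_diff_distrib sum_subtractf)
  qed
  moreover have "(\<Sum>(\<alpha>, \<beta>)\<in>J. C \<alpha> \<beta> * (\<Sum>(a, b) | a + b < K. c \<alpha> \<beta> a b * t ^ a * cnj t ^ b))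
      = (\<Sum>(a, b) | a + b < K. comp_coeff C Z a b * t ^ a * cnj t ^ b)" for t
  proof -
    have "(\<Sum>(\<alpha>, \<beta>)\<in>J. C \<alpha> \<beta> * (\<Sum>(a, b) | a + b < K. c \<alpha> \<beta> a b * t ^ a * cnj t ^ b))
        = (\<Sum>(a, b) | a + b < K. (\<Sum>(\<alpha>, \<beta>)\<in>J. C \<alpha> \<beta> * c \<alpha> \<beta> a b) * t ^ a * cnj t ^ b)"
      unfolding case_prod_unfold sum_distrib_left sum_distrib_right by (subst sum.swap) (simp add: mult.assoc)
    also have "\<dots> = (\<Sum>(a, b) | a + b < K. comp_coeff C Z a b * t ^ a * cnj t ^ b)"
    proof (rule sum.cong, simp, clarify)
      fix a b assume ab: "a + b < K"
      have nz: "sum \<alpha> UNIV \<le> a" if "fps_nth (\<Prod>j\<in>UNIV. Z j ^ \<alpha> j) a \<noteq> 0" for \<alpha> a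
      proof (rule ccontr)
        assume "\<not> sum \<alpha> UNIV \<le> a"
        then have "fps_nth (\<Prod>j\<in>UNIV. Z j ^ \<alpha> j) a = 0"
          by (intro fps_nth_prod_power_eq_0[of 1]) (use Z0 in auto)
        with that show False by contradiction
      qed
      \<comment> \<open>For \<open>a + b < K\<close> a nonzero term has
        \<open>sum \<alpha> UNIV \<le> a\<close> and \<open>sum \<beta> UNIV \<le> b\<close>, so the
        triangle \<open>J\<close> and the rectangle of \<open>comp_coeff\<close> give the same
        sum.\<close>
      have "(\<Sum>(\<alpha>, \<beta>)\<in>J. C \<alpha> \<beta> * c \<alpha> \<beta> a b) = (\<Sum>(\<alpha>, \<beta>)\<in>{\<alpha>. sum \<alpha> UNIV \<le> a} \<times> {\<beta>. sum \<beta> UNIV \<le> b}. C \<alpha> \<beta> * c \<alpha> \<beta> a b)"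
        by (rule sum.mono_neutral_right[OF finJ])
           (use ab in \<open>auto simp: J_def c_def Zm_def dest!: nz\<close>)
      also have "\<dots> = comp_coeff C Z a b"
        by (simp add: comp_coeff_def sum.cartesian_product[symmetric] c_def Zm_def mult.assoc)
      finally show "(\<Sum>(\<alpha>, \<beta>)\<in>J. C \<alpha> \<beta> * c \<alpha> \<beta> a b) * t ^ a * cnj t ^ b = comp_coeff C Z a b * t ^ a * cnj t ^ b" by simp
    qed
    finally show ?thesis .
  qed
  ultimately have "(\<lambda>t. P t - (\<Sum>(a, b) | a + b < K. comp_coeff C Z a b * t ^ a * cnj t ^ b)) \<in> O[at 0](\<lambda>t. t ^ K)" by simp
  from sum_in_bigo(1)[OF main this] show ?thesis by (simp add: C_def)
qed

section \<open>Uniqueness of the coefficients of a polynomial in \<open>t\<close> and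
  \<open>cnj t\<close>\<close>

lemma power_sum_vanishing_order:
  fixes f :: "nat \<Rightarrow> complex"
  assumes "eventually (\<lambda>s. cmod (\<Sum>e<K. f e * of_real s ^ e) \<le> B * s ^ K) (at_right (0::real))" "e < K"
  shows "f e = 0"
  using assms
proof (induction K arbitrary: f e)
  case (Suc K)
  \<comment> \<open>The limit at 0 removes the constant term; dividing the rest by \<open>s\<close>
    lowers \<open>K\<close> by one.\<close>
  have split: "(\<Sum>e<Suc K. f e * of_real s ^ e) = f 0 + of_real s * (\<Sum>e<K. f (Suc e) * of_real s ^ e)" for s
    unfolding sum.lessThan_Suc_shift by (simp add: sum_distrib_left mult_ac)
  have "((\<lambda>s. \<Sum>e<Suc K. f e * complex_of_real s ^ e) \<longlongrightarrow> f 0 + of_real 0 * (\<Sum>e<K. f (Suc e) * of_real 0 ^ e)) (at_right 0)"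
    unfolding split by (intro tendsto_intros)
  moreover have "((\<lambda>s. \<Sum>e<Suc K. f e * complex_of_real s ^ e) \<longlongrightarrow> 0) (at_right 0)"
  proof (rule Lim_null_comparison[OF Suc.prems(1)])
    have "((\<lambda>s::real. B * s ^ Suc K) \<longlongrightarrow> B * 0 ^ Suc K) (at_right 0)" by (intro tendsto_intros)
    then show "((\<lambda>s::real. B * s ^ Suc K) \<longlongrightarrow> 0) (at_right 0)" by simp
  qed
  ultimately have f0: "f 0 = 0" using tendsto_unique[OF trivial_limit_at_right_real] by fastforce
  have ev: "eventually (\<lambda>s. cmod (\<Sum>e<K. f (Suc e) * of_real s ^ e) \<le> B * s ^ K) (at_right (0::real))"
    using Suc.prems(1) eventually_at_right_less[of "0::real"]
  proof eventually_elim
    case (elim s)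
    then have "s * cmod (\<Sum>e<K. f (Suc e) * of_real s ^ e) \<le> s * (B * s ^ K)"
      unfolding split f0 by (simp add: norm_mult mult_ac)
    with elim show ?case by simp
  qed
  show ?case
    using Suc.IH[OF ev] Suc.prems(2) f0 by (cases e) auto
qed simp

lemma infinite_unit_circle: "infinite {w :: complex. cmod w = 1}"
proof
  assume fin: "finite {w :: complex. cmod w = 1}"
  have "{w :: complex. cmod w = 1} = sphere 0 1" by (auto simp: dist_norm)
  moreover have "connected (sphere (0::complex) 1)" by (rule connected_sphere) simp
  ultimately have "{w :: complex. cmod w = 1} = {} \<or> (\<exists>a. {w :: complex. cmod w = 1} = {a})"
    using fin connected_finite_iff_sing by metis
  moreover have "1 \<in> {w :: complex. cmod w = 1}" "-1 \<in> {w :: complex. cmod w = 1}" by simp_all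
  ultimately have "(1::complex) = -1" by (metis empty_iff singletonD)
  then show False by simp
qed

text \<open>On a ray \<open>t = s w\<close> with \<open>cmod w = 1\<close> the powers of
  \<open>s\<close> separate the homogeneous parts. On the unit circle \<open>cnj w = 1 / w\<close>,
  so the part of degree \<open>e\<close> times \<open>w^e\<close> is an ordinary polynomial in
  \<open>w\<close> with exponents \<open>2 * i\<close>; having infinitely many zeros, it is
  zero.\<close>

lemma hermitian_poly_vanishing_order:
  assumes "(\<lambda>t. \<Sum>(a, b) | a + b < K. c a b * t ^ a * cnj t ^ b) \<in> O[at 0](\<lambda>t. t ^ K)" and "a + b < K"
  shows "c a b = 0"
proof -
  obtain B where B: "eventually (\<lambda>t. cmod (\<Sum>(a, b) | a + b < K. c a b * t ^ a * cnj t ^ b) \<le> B * cmod (t ^ K)) (at 0)"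
    using landau_o.bigE[OF assms(1)] by blast
  define e where "e = a + b"
  have H: "(\<Sum>i\<le>e. c i (e - i) * w ^ i * cnj w ^ (e - i)) = 0" if w: "cmod w = 1" for w
  proof (rule power_sum_vanishing_order[where f = "\<lambda>e. \<Sum>i\<le>e. c i (e - i) * w ^ i * cnj w ^ (e - i)"])
    have "filterlim (\<lambda>s. complex_of_real s * w) (at 0) (at_right 0)"
      unfolding filterlim_at
    proof
      show "eventually (\<lambda>s. complex_of_real s * w \<in> UNIV \<and> complex_of_real s * w \<noteq> 0) (at_right 0)"
        using eventually_at_right_less[of "0::real"] by eventually_elim (use w in auto)
      have "((\<lambda>s. complex_of_real s * w) \<longlongrightarrow> of_real 0 * w) (at_right 0)" by (intro tendsto_intros)
      then show "((\<lambda>s. complex_of_real s * w) \<longlongrightarrow> 0) (at_right 0)" by simp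
    qed
    from eventually_compose_filterlim[OF B this] eventually_at_right_less[of "0::real"]
    show "eventually (\<lambda>s. cmod (\<Sum>e<K. (\<Sum>i\<le>e. c i (e - i) * w ^ i * cnj w ^ (e - i)) * of_real s ^ e) \<le> B * s ^ K) (at_right 0)"
    proof eventually_elim
      case (elim s)
      have "(\<Sum>(a, b) | a + b < K. c a b * (of_real s * w) ^ a * cnj (of_real s * w) ^ b)
          = (\<Sum>e<K. \<Sum>i\<le>e. c i (e - i) * (of_real s * w) ^ i * cnj (of_real s * w) ^ (e - i))"
        by (rule sum.triangle_reindex)
      also have "\<dots> = (\<Sum>e<K. (\<Sum>i\<le>e. c i (e - i) * w ^ i * cnj w ^ (e - i)) * of_real s ^ e)"
        unfolding sum_distrib_right
      proof (intro sum.cong refl)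
        fix e i :: nat assume "i \<in> {..e}"
        then have "complex_of_real s ^ e = of_real s ^ i * of_real s ^ (e - i)" by (simp flip: power_add)
        then show "c i (e - i) * (of_real s * w) ^ i * cnj (of_real s * w) ^ (e - i)
            = c i (e - i) * w ^ i * cnj w ^ (e - i) * of_real s ^ e"
          by (simp add: power_mult_distrib)
      qed
      finally show ?case using elim w by (simp add: norm_mult norm_power)
    qed
    show "e < K" using assms(2) by (simp add: e_def)
  qed
  define P where "P = (\<Sum>i\<le>e. monom (c i (e - i)) (2 * i))"
  have "poly P w = 0" if w: "cmod w = 1" for w
  proof -
    have ww: "w * cnj w = 1" using w complex_norm_square[of w] by simp
    have "poly P w = (\<Sum>i\<le>e. w ^ e * (c i (e - i) * w ^ i * cnj w ^ (e - i)))"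
      unfolding P_def poly_sum poly_monom
    proof (intro sum.cong refl)
      fix i assume "i \<in> {..e}"
      then have "w ^ e = w ^ i * w ^ (e - i)" by (simp flip: power_add)
      moreover have "w ^ (e - i) * cnj w ^ (e - i) = 1" using ww by (simp flip: power_mult_distrib)
      then have "w ^ i * (w ^ (e - i) * cnj w ^ (e - i)) * w ^ i = w ^ (2 * i)"
        by (simp flip: power_add mult_2)
      ultimately show "c i (e - i) * w ^ (2 * i) = w ^ e * (c i (e - i) * w ^ i * cnj w ^ (e - i))"
        by (simp add: mult_ac)
    qed
    then show ?thesis using H[OF w] by (simp add: sum_distrib_left[symmetric])
  qed
  then have "infinite {w. poly P w = 0}" using infinite_unit_circle by (metis (mono_tags, lifting) finite_subset mem_Collect_eq subsetI)
  then have "P = 0" using poly_roots_finite by blast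
  then have "coeff P (2 * a) = 0" by simp
  moreover have "coeff P (2 * a) = (\<Sum>i\<le>e. if i = a then c i (e - i) else 0)"
    unfolding P_def coeff_sum coeff_monom by (intro sum.cong) auto
  ultimately show ?thesis by (simp add: e_def)
qed

section \<open>The isotropic system of a curve, and the curve of an isotropic system\<close>

lemma sesq_form_bilinear:
  "sesq_form C d (\<lambda>\<alpha>. \<Sum>i\<in>I. x i * f i \<alpha>) (\<lambda>\<beta>. \<Sum>k\<in>J. y k * g k \<beta>)
    = (\<Sum>i\<in>I. \<Sum>k\<in>J. x i * cnj (y k) * sesq_form C d (f i) (g k))"
proof -
  have left: "sesq_form C d (\<lambda>\<alpha>. \<Sum>i\<in>I. x i * f i \<alpha>) v = (\<Sum>i\<in>I. x i * sesq_form C d (f i) v)" for v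
    unfolding sesq_form_def sum_distrib_left sum_distrib_right
    by (subst sum.swap[of _ _ I], subst sum.swap[of _ I]) (simp add: sum.swap[of _ _ I] mult_ac)
  have right: "sesq_form C d u (\<lambda>\<beta>. \<Sum>k\<in>J. y k * g k \<beta>) = (\<Sum>k\<in>J. cnj (y k) * sesq_form C d u (g k))" for u
    unfolding sesq_form_def cnj_sum complex_cnj_mult sum_distrib_left sum_distrib_right
    by (subst sum.swap[of _ _ J]) (simp add: sum.swap[of _ _ J] mult_ac)
  show ?thesis unfolding left right by (simp add: sum_distrib_left mult_ac)
qed

definition curve_functional :: "('n::finite \<Rightarrow> complex fps) \<Rightarrow> nat \<Rightarrow> ('n \<Rightarrow> nat) \<Rightarrow> complex" where
  "curve_functional Z a \<alpha> = fps_nth (\<Prod>j\<in>UNIV. Z j ^ \<alpha> j) a"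

lemma deg_le_curve_functional:
  assumes "\<And>j. fps_nth (Z j) 0 = 0"
  shows "deg_le a (curve_functional Z a)"
  unfolding deg_le_def curve_functional_def
  using fps_nth_prod_power_eq_0[of 1 Z a] assms by simp

lemma comp_coeff_eq_sesq_form:
  assumes "\<And>j. fps_nth (Z j) 0 = 0" "a \<le> d" "b \<le> d"
  shows "comp_coeff C Z a b = sesq_form C d (curve_functional Z a) (curve_functional Z b)"
  using sesq_form_truncate[OF deg_le_curve_functional deg_le_curve_functional, of Z Z a d b C] assms
  by (simp add: comp_coeff_def curve_functional_def)

text \<open>Multiplication by \<open>z_j\<close> becomes multiplication by \<open>Z j\<close>, and a
  Cauchy product involves no higher orders. Hence the functionals of order at most \<open>L\<close>
  span a shift-invariant space.\<close>

lemma shift_curve_functional: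
  "shift j (curve_functional Z a) \<alpha> = (\<Sum>i\<le>a. fps_nth (Z j) i * curve_functional Z (a - i) \<alpha>)"
proof -
  have "(\<Prod>i\<in>UNIV. Z i ^ inc j \<alpha> i) = (\<Prod>i\<in>UNIV. (if i = j then Z j else 1) * Z i ^ \<alpha> i)"
    by (rule prod.cong) (auto simp: inc_def)
  also have "\<dots> = Z j * (\<Prod>i\<in>UNIV. Z i ^ \<alpha> i)" by (simp add: prod.distrib)
  finally show ?thesis by (simp add: shift_def curve_functional_def fps_mult_nth atLeast0AtMost)
qed

text \<open>A monomial of degree \<open>e\<close> vanishes along the curve to order at least
  \<open>e * m\<close>, so the functional of order \<open>i * m\<close> has degree at most
  \<open>i\<close>. The degree is attained: on the \<open>i\<close>-th power of the coordinate
  \<open>j0\<close> its value is the \<open>i\<close>-th power of the leading coefficient of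
  \<open>Z j0\<close>.\<close>

lemma isotropic_system_of_curve:
  fixes Z :: "'n::finite \<Rightarrow> complex fps"
  assumes Z0: "\<And>j. fps_nth (Z j) 0 = 0"
    and m: "\<And>j i. i < m \<Longrightarrow> fps_nth (Z j) i = 0" "fps_nth (Z j0) m \<noteq> 0"
    and L: "k * m \<le> L"
    and vanish: "\<And>a b. a \<le> L \<Longrightarrow> b \<le> L \<Longrightarrow> comp_coeff C Z a b = 0"
  shows "\<exists>N. inverse_system N \<and> isotropic C N
    \<and> (\<forall>i\<le>k. \<exists>f\<in>N. deg_le i f \<and> (\<exists>\<alpha>. sum \<alpha> UNIV = i \<and> f \<alpha> \<noteq> 0))"
proof -
  define N where "N = {f. \<exists>c. f = (\<lambda>\<alpha>. \<Sum>a\<le>L. c a * curve_functional Z a \<alpha>)}"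
  have degN: "deg_le L f" if "f \<in> N" for f
  proof -
    obtain c where "f = (\<lambda>\<alpha>. \<Sum>a\<le>L. c a * curve_functional Z a \<alpha>)" using \<open>f \<in> N\<close> by (auto simp: N_def)
    moreover have "curve_functional Z a \<alpha> = 0" if "a \<le> L" "L < sum \<alpha> UNIV" for a \<alpha>
      using deg_le_curve_functional[of Z a, OF Z0] that by (simp add: deg_le_def)
    ultimately show ?thesis by (simp add: deg_le_def)
  qed
  have "inverse_system N"
    unfolding inverse_system_def
  proof (intro conjI ballI allI)
    show "(\<lambda>_. 0) \<in> N" unfolding N_def by (auto intro!: exI[of _ "\<lambda>_. 0"])
  next
    fix f g c assume "f \<in> N" "g \<in> N"
    then obtain x y where "f = (\<lambda>\<alpha>. \<Sum>a\<le>L. x a * curve_functional Z a \<alpha>)" "g = (\<lambda>\<alpha>. \<Sum>a\<le>L. y a * curve_functional Z a \<alpha>)"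
      by (auto simp: N_def)
    then show "(\<lambda>\<alpha>. c * f \<alpha> + g \<alpha>) \<in> N"
      unfolding N_def by (auto intro!: exI[of _ "\<lambda>a. c * x a + y a"] simp: sum.distrib sum_distrib_left algebra_simps)
  next
    fix f j assume "f \<in> N"
    then obtain c where c: "f = (\<lambda>\<alpha>. \<Sum>a\<le>L. c a * curve_functional Z a \<alpha>)" by (auto simp: N_def)
    \<comment> \<open>Collects the Cauchy products of all shifted functionals by the order
      \<open>b = a - i\<close> that remains.\<close>
    define x where "x b = (\<Sum>i\<le>L. if i + b \<le> L then c (i + b) * fps_nth (Z j) i else 0)" for b
    have "shift j f \<alpha> = (\<Sum>b\<le>L. x b * curve_functional Z b \<alpha>)" for \<alpha>
    proof -
      define g where "g i b = c (i + b) * fps_nth (Z j) i * curve_functional Z b \<alpha>" for i b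
      have "shift j f \<alpha> = (\<Sum>a\<le>L. c a * shift j (curve_functional Z a) \<alpha>)" by (simp add: c shift_def)
      also have "\<dots> = (\<Sum>a\<le>L. \<Sum>i\<le>a. g i (a - i))"
        unfolding shift_curve_functional sum_distrib_left by (intro sum.cong) (auto simp: g_def)
      also have "\<dots> = (\<Sum>(i, b) | i + b \<le> L. g i b)" by (rule sum.triangle_reindex_eq[symmetric])
      also have "\<dots> = (\<Sum>(i, b)\<in>{..L} \<times> {..L}. if i + b \<le> L then g i b else 0)"
        by (rule sum.mono_neutral_cong_left) (auto split: if_splits)
      also have "\<dots> = (\<Sum>b\<le>L. \<Sum>i\<le>L. if i + b \<le> L then g i b else 0)"
        unfolding sum.cartesian_product[symmetric] by (rule sum.swap)
      also have "\<dots> = (\<Sum>b\<le>L. x b * curve_functional Z b \<alpha>)"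
        unfolding x_def sum_distrib_right by (intro sum.cong refl) (simp add: g_def)
      finally show ?thesis .
    qed
    then show "shift j f \<in> N" unfolding N_def by (auto simp: fun_eq_iff)
  next
    fix f assume "f \<in> N"
    then show "\<exists>d. deg_le d f" using degN by blast
  qed
  moreover have "isotropic C N"
    unfolding isotropic_def
  proof (intro ballI allI impI)
    fix f g d assume fg: "f \<in> N" "g \<in> N" and d: "deg_le d f" "deg_le d g"
    obtain x y where xy: "f = (\<lambda>\<alpha>. \<Sum>a\<le>L. x a * curve_functional Z a \<alpha>)" "g = (\<lambda>\<alpha>. \<Sum>a\<le>L. y a * curve_functional Z a \<alpha>)"
      using fg by (auto simp: N_def)
    have "sesq_form C d f g = sesq_form C (max d L) f g" by (rule sesq_form_eq[OF d]) simp
    also have "\<dots> = (\<Sum>a\<le>L. \<Sum>b\<le>L. x a * cnj (y b) * sesq_form C (max d L) (curve_functional Z a) (curve_functional Z b))"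
      unfolding xy by (rule sesq_form_bilinear)
    also have "\<dots> = (\<Sum>a\<le>L. \<Sum>b\<le>L. x a * cnj (y b) * comp_coeff C Z a b)"
      by (intro sum.cong refl) (simp add: comp_coeff_eq_sesq_form[OF Z0, of _ "max d L"])
    also have "\<dots> = 0" using vanish by simp
    finally show "sesq_form C d f g = 0" .
  qed
  moreover have "\<exists>f\<in>N. deg_le i f \<and> (\<exists>\<alpha>. sum \<alpha> UNIV = i \<and> f \<alpha> \<noteq> 0)" if i: "i \<le> k" for i
  proof (intro bexI conjI exI)
    have iL: "i * m \<le> L" by (rule order_trans[OF mult_le_mono1[OF i] L])
    have "curve_functional Z (i * m) = (\<lambda>\<alpha>. \<Sum>a\<le>L. (if a = i * m then 1 else 0) * curve_functional Z a \<alpha>)"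
    proof
      fix \<alpha>
      have "(\<Sum>a\<le>L. (if a = i * m then 1 else 0) * curve_functional Z a \<alpha>)
          = (\<Sum>a\<le>L. if a = i * m then curve_functional Z a \<alpha> else 0)" by (intro sum.cong) auto
      then show "curve_functional Z (i * m) \<alpha> = (\<Sum>a\<le>L. (if a = i * m then 1 else 0) * curve_functional Z a \<alpha>)"
        using iL by simp
    qed
    then show "curve_functional Z (i * m) \<in> N"
      unfolding N_def mem_Collect_eq by (rule exI[of _ "\<lambda>a. if a = i * m then 1 else 0"])
    have "m > 0" using m(2) Z0 by (metis gr0I)
    then show "deg_le i (curve_functional Z (i * m))"
      unfolding deg_le_def curve_functional_def
      by (intro allI impI fps_nth_prod_power_eq_0[of m]) (use m(1) in \<open>auto simp: mult.commute\<close>)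
    define \<alpha> where "\<alpha> = (\<lambda>j. if j = j0 then i else 0)"
    show "sum \<alpha> UNIV = i" by (simp add: \<alpha>_def)
    have "(\<Prod>j\<in>UNIV. Z j ^ \<alpha> j) = (\<Prod>j\<in>UNIV. if j = j0 then Z j0 ^ i else 1)"
      by (rule prod.cong) (auto simp: \<alpha>_def)
    also have "\<dots> = Z j0 ^ i" by simp
    also have "Z j0 = fps_X ^ m * fps_shift m (Z j0)"
      by (rule fps_ext) (simp add: fps_X_power_mult_nth m(1))
    finally have "(\<Prod>j\<in>UNIV. Z j ^ \<alpha> j) = fps_X ^ (i * m) * fps_shift m (Z j0) ^ i"
      by (simp add: power_mult_distrib power_mult[symmetric] mult.commute)
    then show "curve_functional Z (i * m) \<alpha> \<noteq> 0"
      using m(2) by (simp add: curve_functional_def fps_X_power_mult_nth fps_nth_power_0)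
  qed
  ultimately show ?thesis by blast
qed

text \<open>Isotropy says that the double series with coefficients \<open>comp_coeff C Z a b\<close>
  vanishes after multiplication by \<open>u\<close> in \<open>t\<close> and by the conjugate series
  of \<open>u\<close> in \<open>cnj t\<close>. Power series form a domain, so the two factors are
  cancelled, one variable at a time.\<close>

lemma isotropic_curve_comp_coeff:
  fixes Z :: "'n::finite \<Rightarrow> complex fps"
  assumes Z0: "\<And>j. fps_nth (Z j) 0 = 0" and u: "u \<noteq> 0" and iso: "isotropic C N"
    and N: "coeffs_in N (\<lambda>\<alpha>. u * (\<Prod>j\<in>UNIV. Z j ^ \<alpha> j))"
  shows "comp_coeff C Z a b = 0"
proof -
  define G where "G b = Abs_fps (\<lambda>a. \<Sum>k\<in>{0..b}. cnj (fps_nth u k) * comp_coeff C Z a (b - k))" for b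
  define H where "H a = Abs_fps (\<lambda>b. comp_coeff C Z a b)" for a
  define V where "V = Abs_fps (\<lambda>k. cnj (fps_nth u k))"
  have "V \<noteq> 0" using u by (auto simp: V_def fps_eq_iff)
  have "u * G b = 0" for b
  proof (rule fps_ext)
    fix a
    define d where "d = max a b"
    have elt: "(\<lambda>\<alpha>. \<Sum>i\<in>{0..a}. fps_nth u i * curve_functional Z (a - i) \<alpha>) \<in> N" for a
      using N by (simp add: coeffs_in_def fps_mult_nth curve_functional_def)
    have deg: "deg_le d (\<lambda>\<alpha>. \<Sum>i\<in>{0..a}. fps_nth u i * curve_functional Z (a - i) \<alpha>)" if "a \<le> d" for a
      unfolding deg_le_def
    proof (intro allI impI sum.neutral ballI)
      fix \<alpha> :: "'n \<Rightarrow> nat" and i assume "d < sum \<alpha> UNIV"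
      then have "curve_functional Z (a - i) \<alpha> = 0"
        using deg_le_curve_functional[of Z "a - i", OF Z0] that by (simp add: deg_le_def)
      then show "fps_nth u i * curve_functional Z (a - i) \<alpha> = 0" by simp
    qed
    have "fps_nth (u * G b) a = (\<Sum>i\<in>{0..a}. \<Sum>k\<in>{0..b}. fps_nth u i * cnj (fps_nth u k) * comp_coeff C Z (a - i) (b - k))"
      by (simp add: fps_mult_nth G_def sum_distrib_left mult.assoc)
    also have "\<dots> = (\<Sum>i\<in>{0..a}. \<Sum>k\<in>{0..b}. fps_nth u i * cnj (fps_nth u k) *
        sesq_form C d (curve_functional Z (a - i)) (curve_functional Z (b - k)))"
      by (intro sum.cong refl) (simp add: comp_coeff_eq_sesq_form[OF Z0, of _ d] d_def)
    also have "\<dots> = sesq_form C d (\<lambda>\<alpha>. \<Sum>i\<in>{0..a}. fps_nth u i * curve_functional Z (a - i) \<alpha>)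
        (\<lambda>\<alpha>. \<Sum>k\<in>{0..b}. fps_nth u k * curve_functional Z (b - k) \<alpha>)"
      by (rule sesq_form_bilinear[symmetric])
    also have "\<dots> = 0"
      using iso elt deg[of a] deg[of b] unfolding isotropic_def by (simp add: d_def)
    finally show "fps_nth (u * G b) a = fps_nth 0 a" by simp
  qed
  then have G: "fps_nth (G b) a = 0" for a b using u by (metis fps_zero_nth mult_eq_0_iff)
  have "V * H a = 0" for a
  proof (rule fps_ext)
    fix b
    show "fps_nth (V * H a) b = fps_nth 0 b" using G[of b a] by (simp add: G_def V_def H_def fps_mult_nth)
  qed
  then have "fps_nth (H a) b = 0" using \<open>V \<noteq> 0\<close> by (metis fps_zero_nth mult_eq_0_iff)
  then show ?thesis by (simp add: H_def)
qed

section \<open>Orders of vanishing and multiplicities of germs\<close>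

lemma bigo_of_real_iff:
  fixes f :: "complex \<Rightarrow> real"
  shows "f \<in> O[at 0](\<lambda>t. cmod t ^ k) \<longleftrightarrow> (\<lambda>t. complex_of_real (f t)) \<in> O[at 0](\<lambda>t. t ^ k)"
proof -
  have "f \<in> O[at 0](\<lambda>t. cmod t ^ k) \<longleftrightarrow> (\<lambda>t. norm (f t)) \<in> O[at 0](\<lambda>t. norm (cmod t ^ k))"
    by (rule landau_o.big.norm_iff[symmetric])
  also have "\<dots> \<longleftrightarrow> (\<lambda>t. norm (complex_of_real (f t))) \<in> O[at 0](\<lambda>t. norm (t ^ k))"
    by (simp only: norm_of_real real_norm_def norm_power abs_norm_cancel power_abs)
  also have "\<dots> \<longleftrightarrow> (\<lambda>t. complex_of_real (f t)) \<in> O[at 0](\<lambda>t. t ^ k)"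
    by (rule landau_o.big.norm_iff)
  finally show ?thesis .
qed

text \<open>A Taylor polynomial is a polynomial in \<open>t\<close> and \<open>cnj t\<close> in
  which \<open>cnj t\<close> is absent, so \<open>hermitian_poly_vanishing_order\<close>
  applies.\<close>

lemma fps_expansion_order_bound:
  fixes f :: "complex \<Rightarrow> complex"
  assumes f: "f has_fps_expansion F" "fps_nth F m \<noteq> 0" and O: "f \<in> O[at 0](\<lambda>t. t ^ k)"
  shows "k \<le> m"
proof (rule ccontr)
  assume "\<not> k \<le> m"
  define c where "c a b = (if b = 0 then fps_nth F a else 0)" for a b :: nat
  have "(\<Sum>(a, b) | a + b < k. c a b * t ^ a * cnj t ^ b) = (\<Sum>a<k. fps_nth F a * t ^ a)" for t
  proof -
    have "(\<Sum>a<k. fps_nth F a * t ^ a) = (\<Sum>(a, b)\<in>(\<lambda>a. (a, 0)) ` {..<k}. c a b * t ^ a * cnj t ^ b)"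
      by (subst sum.reindex) (auto simp: inj_on_def c_def)
    also have "\<dots> = (\<Sum>(a, b) | a + b < k. c a b * t ^ a * cnj t ^ b)"
    proof (rule sum.mono_neutral_left)
      show "finite {(a, b). a + b < k}" by (rule finite_subset[of _ "{..<k} \<times> {..<k}"]) auto
    qed (auto simp: c_def)
    finally show ?thesis ..
  qed
  moreover have "(\<lambda>t. \<Sum>a<k. fps_nth F a * t ^ a) \<in> O[at 0](\<lambda>t. t ^ k)"
    using sum_in_bigo(2)[OF O fps_expansion_remainder[OF f(1), of k]] by simp
  ultimately have "(\<lambda>t. \<Sum>(a, b) | a + b < k. c a b * t ^ a * cnj t ^ b) \<in> O[at 0](\<lambda>t. t ^ k)" by simp
  from hermitian_poly_vanishing_order[OF this, of m 0] \<open>\<not> k \<le> m\<close> f(2) show False by (simp add: c_def)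
qed

lemma hol_curve_germ_expansion:
  fixes \<zeta> :: "complex \<Rightarrow> complex^'n::finite"
  assumes "\<zeta> \<in> hol_curve_germs p"
  obtains Z where "\<And>j. (\<lambda>t. (\<zeta> t - p) $ j) has_fps_expansion Z j" "\<And>j. fps_nth (Z j) 0 = 0" "\<exists>j. Z j \<noteq> 0"
proof -
  define Z where "Z j = fps_expansion (\<lambda>t. (\<zeta> t - p) $ j) 0" for j
  have Z: "(\<lambda>t. (\<zeta> t - p) $ j) has_fps_expansion Z j" for j
    unfolding Z_def
  proof (rule analytic_at_imp_has_fps_expansion_0)
    have "(\<lambda>t. \<zeta> t $ j - p $ j) analytic_on {0}"
      using assms by (intro analytic_intros) (simp add: hol_curve_germs_def)
    then show "(\<lambda>t. (\<zeta> t - p) $ j) analytic_on {0}" by simp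
  qed
  moreover have "fps_nth (Z j) 0 = 0" for j
    using has_fps_expansion_imp_0_eq_fps_nth_0[OF Z[of j]] assms by (simp add: hol_curve_germs_def)
  moreover have "\<exists>j. Z j \<noteq> 0"
  proof (rule ccontr)
    assume "\<not> ?thesis"
    then have "eventually (\<lambda>t. (\<zeta> t - p) $ j = 0) (nhds 0)" for j
    proof -
      have "eventually (\<lambda>t. eval_fps (Z j) t = (\<zeta> t - p) $ j) (nhds 0)" using Z by (simp add: has_fps_expansion_def)
      then show ?thesis by eventually_elim (use \<open>\<not> (\<exists>j. Z j \<noteq> 0)\<close> in \<open>simp add: eval_fps_def\<close>)
    qed
    then have "eventually (\<lambda>t. \<forall>j. (\<zeta> t - p) $ j = 0) (nhds 0)" by (rule eventually_all_finite)
    then have "eventually (\<lambda>t. \<zeta> t = p) (nhds 0)" by eventually_elim (simp add: vec_eq_iff)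
    with assms show False by (simp add: hol_curve_germs_def)
  qed
  ultimately show ?thesis using that by blast
qed

lemma nu_curve_ge:
  fixes \<zeta> :: "complex \<Rightarrow> complex^'n::finite"
  assumes "\<zeta> 0 = p" "\<And>j. (\<lambda>t. (\<zeta> t - p) $ j) has_fps_expansion Z j"
    and "\<And>j i. i < m \<Longrightarrow> fps_nth (Z j) i = 0"
  shows "enat m \<le> nu_curve \<zeta>"
proof -
  have "(\<lambda>t. \<Sum>j\<in>UNIV. cmod (\<zeta> t $ j - \<zeta> 0 $ j)) \<in> O[at 0](\<lambda>t. cmod t ^ m)"
  proof (rule big_sum_in_bigo)
    fix j
    have "(\<lambda>t. (\<zeta> t - p) $ j) \<in> O[at 0](\<lambda>t. t ^ m)"
      using fps_expansion_remainder[OF assms(2)[of j], of m] assms(3)[of _ j] by simp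
    then show "(\<lambda>t. cmod (\<zeta> t $ j - \<zeta> 0 $ j)) \<in> O[at 0](\<lambda>t. cmod t ^ m)"
      using landau_o.big.norm_iff[of "\<lambda>t. (\<zeta> t - p) $ j" "at 0" "\<lambda>t. t ^ m"] assms(1) by (simp add: norm_power)
  qed
  then show ?thesis unfolding nu_curve_def ord_vanish_def by (intro Sup_upper) blast
qed

lemma nu_curve_le:
  fixes \<zeta> :: "complex \<Rightarrow> complex^'n::finite"
  assumes "\<zeta> 0 = p" "(\<lambda>t. (\<zeta> t - p) $ j) has_fps_expansion F" "fps_nth F m \<noteq> 0"
  shows "nu_curve \<zeta> \<le> enat m"
  unfolding nu_curve_def ord_vanish_def
proof (rule Sup_least)
  fix x assume "x \<in> {enat k |k. (\<lambda>t. \<Sum>j\<in>UNIV. cmod (\<zeta> t $ j - \<zeta> 0 $ j)) \<in> O[at 0](\<lambda>t. cmod t ^ k)}"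
  then obtain k where k: "x = enat k" "(\<lambda>t. \<Sum>j\<in>UNIV. cmod (\<zeta> t $ j - \<zeta> 0 $ j)) \<in> O[at 0](\<lambda>t. cmod t ^ k)" by blast
  have "(\<lambda>t. cmod ((\<zeta> t - p) $ j)) \<in> O[at 0](\<lambda>t. \<Sum>j\<in>UNIV. cmod (\<zeta> t $ j - \<zeta> 0 $ j))"
  proof (intro bigoI[of _ 1] always_eventually allI)
    fix t
    have "cmod (\<zeta> t $ j - \<zeta> 0 $ j) \<le> (\<Sum>j\<in>UNIV. cmod (\<zeta> t $ j - \<zeta> 0 $ j))" by (rule member_le_sum) auto
    then show "norm (cmod ((\<zeta> t - p) $ j)) \<le> 1 * norm (\<Sum>j\<in>UNIV. cmod (\<zeta> t $ j - \<zeta> 0 $ j))"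
      using assms(1) by (simp add: sum_nonneg)
  qed
  then have "(\<lambda>t. cmod ((\<zeta> t - p) $ j)) \<in> O[at 0](\<lambda>t. cmod t ^ k)" using k(2) by (rule landau_o.big.trans)
  then have "(\<lambda>t. (\<zeta> t - p) $ j) \<in> O[at 0](\<lambda>t. t ^ k)"
    using landau_o.big.norm_iff[of "\<lambda>t. (\<zeta> t - p) $ j" "at 0" "\<lambda>t. t ^ k"] by (simp add: norm_power)
  from fps_expansion_order_bound[OF assms(2,3) this] show "x \<le> enat m" by (simp add: k)
qed

section \<open>Curves of infinite type\<close>

text \<open>The multiplicity \<open>m\<close> of the chosen curve is not controlled by
  \<open>k\<close>, but the conclusion mentions only \<open>k\<close>; this is what the passage to
  the limit relies on.\<close>

lemma infinite_type_isotropic_system: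
  fixes r :: "complex^'n::finite \<Rightarrow> real"
  assumes U: "open U" "p \<in> U" and r: "smooth_on U r" and type: "DAngelo_type r p = \<infinity>"
  shows "\<exists>N. inverse_system N \<and> isotropic (taylor_coeff r p) N
    \<and> (\<forall>i\<le>k. \<exists>f\<in>N. deg_le i f \<and> (\<exists>\<alpha>. sum \<alpha> UNIV = i \<and> f \<alpha> \<noteq> 0))"
proof -
  have "ereal (real (2 * k)) < DAngelo_type r p" by (simp add: type)
  then obtain \<zeta> where \<zeta>: "\<zeta> \<in> hol_curve_germs p"
    "ereal (real (2 * k)) < ereal_of_enat (ord_vanish (\<lambda>t. r (\<zeta> t))) / ereal_of_enat (nu_curve \<zeta>)"
    unfolding DAngelo_type_def less_SUP_iff by blast
  obtain Z where Z: "\<And>j. (\<lambda>t. (\<zeta> t - p) $ j) has_fps_expansion Z j" "\<And>j. fps_nth (Z j) 0 = 0" "\<exists>j. Z j \<noteq> 0"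
    using hol_curve_germ_expansion[OF \<zeta>(1)] by blast
  have \<zeta>0: "\<zeta> 0 = p" using \<zeta>(1) by (simp add: hol_curve_germs_def)
  define m where "m = (LEAST m. \<exists>j. fps_nth (Z j) m \<noteq> 0)"
  have "\<exists>m j. fps_nth (Z j) m \<noteq> 0" using Z(3) by (auto simp: fps_eq_iff)
  then have "\<exists>j. fps_nth (Z j) m \<noteq> 0" unfolding m_def by (rule LeastI_ex)
  then obtain j0 where j0: "fps_nth (Z j0) m \<noteq> 0" by blast
  have less: "fps_nth (Z j) i = 0" if "i < m" for i j
    using not_less_Least[of i "\<lambda>m. \<exists>j. fps_nth (Z j) m \<noteq> 0"] that by (auto simp: m_def)
  have "m > 0" using j0 Z(2) by (metis gr0I)
  have \<nu>: "enat m \<le> nu_curve \<zeta>" by (rule nu_curve_ge[OF \<zeta>0 Z(1) less])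
  define v where "v = ord_vanish (\<lambda>t. r (\<zeta> t))"
  have "enat (2 * k * m) < v"
  proof (cases "nu_curve \<zeta>")
    case (enat n)
    then have n: "m \<le> n" "n > 0" using \<nu> \<open>m > 0\<close> by auto
    show ?thesis
    proof (cases v)
      case (enat q)
      have "real (2 * k) < real q / real n"
        using \<zeta>(2) n(2) unfolding v_def[symmetric] enat \<open>nu_curve \<zeta> = enat n\<close> by simp
      then have "real (2 * k * n) < real q" using n(2) by (simp add: field_simps)
      moreover have "2 * k * m \<le> 2 * k * n" using n(1) by simp
      ultimately have "2 * k * m < q" by linarith
      then show ?thesis by (simp add: enat)
    qed simp
  next
    \<comment> \<open>Excluded by the convention that a quotient by \<open>\<infinity>\<close> is 0,
      which does not exceed \<open>2 * k\<close>.\<close>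
    case infinity
    then have "ereal_of_enat v / ereal_of_enat (nu_curve \<zeta>) = 0" by (simp add: divide_ereal_def)
    with \<zeta>(2) show ?thesis by (simp add: v_def)
  qed
  then obtain K' where K': "2 * k * m < K'" "(\<lambda>t. r (\<zeta> t)) \<in> O[at 0](\<lambda>t. cmod t ^ K')"
    unfolding v_def ord_vanish_def less_Sup_iff by auto
  \<comment> \<open>With this \<open>K\<close>, \<open>a \<le> k * m\<close> and
    \<open>b \<le> k * m\<close> imply \<open>a + b < K\<close>.\<close>
  define K where "K = Suc (2 * k * m)"
  have O: "(\<lambda>t. complex_of_real (r (p + (\<zeta> t - p)))) \<in> O[at 0](\<lambda>t. t ^ K)"
    using K'(2)[unfolded bigo_of_real_iff] bigo_power_mono[of K K'] K'(1)
    by (simp add: K_def) (metis K_def Suc_leI landau_o.big.trans)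
  have "(\<lambda>t. \<Sum>(a, b) | a + b < K. comp_coeff (taylor_coeff r p) Z a b * t ^ a * cnj t ^ b) \<in> O[at 0](\<lambda>t. t ^ K)"
    using sum_in_bigo(2)[OF O composition_expansion[OF U r, of K "\<lambda>t. \<zeta> t - p" Z]] Z by (simp add: K_def)
  from hermitian_poly_vanishing_order[OF this]
  have "comp_coeff (taylor_coeff r p) Z a b = 0" if "a \<le> k * m" "b \<le> k * m" for a b
    using that by (simp add: K_def)
  from isotropic_system_of_curve[OF Z(2) less j0 order_refl this] show ?thesis by blast
qed

section \<open>Truncations of a formal curve\<close>

lemma fps_nth_prod_power_cong:
  fixes Z :: "'n::finite \<Rightarrow> complex fps"
  assumes "\<And>j i. i \<le> a \<Longrightarrow> fps_nth (Z j) i = fps_nth (Z' j) i"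
  shows "fps_nth (\<Prod>j\<in>UNIV. Z j ^ \<alpha> j) a = fps_nth (\<Prod>j\<in>UNIV. Z' j ^ \<alpha> j) a"
proof -
  define low where "low F G \<longleftrightarrow> (\<forall>i\<le>a. fps_nth F i = fps_nth G i)" for F G :: "complex fps"
  have mult: "low (F * F') (G * G')" if "low F G" "low F' G'" for F F' G G'
    using that by (auto simp: low_def fps_mult_nth intro!: sum.cong)
  have power: "low (F ^ n) (G ^ n)" if "low F G" for F G n
    by (induction n) (use that mult in \<open>auto simp: low_def\<close>)
  have "low (\<Prod>j\<in>J. Z j ^ \<alpha> j) (\<Prod>j\<in>J. Z' j ^ \<alpha> j)" if "finite J" for J
    using that
  proof (induction J rule: finite_induct)
    case (insert j J)
    moreover have "low (Z j ^ \<alpha> j) (Z' j ^ \<alpha> j)" using assms by (intro power) (simp add: low_def)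
    ultimately show ?case by (simp add: mult)
  qed (simp add: low_def)
  from this[OF finite] show ?thesis by (simp add: low_def)
qed

lemma comp_coeff_cong:
  assumes "\<And>j i. i \<le> max a b \<Longrightarrow> fps_nth (Z j) i = fps_nth (Z' j) i"
  shows "comp_coeff C Z a b = comp_coeff C Z' a b"
proof -
  have "fps_nth (\<Prod>j\<in>UNIV. Z j ^ \<alpha> j) a = fps_nth (\<Prod>j\<in>UNIV. Z' j ^ \<alpha> j) a"
    "fps_nth (\<Prod>j\<in>UNIV. Z j ^ \<alpha> j) b = fps_nth (\<Prod>j\<in>UNIV. Z' j ^ \<alpha> j) b" for \<alpha>
    by (rule fps_nth_prod_power_cong, rule assms, simp)+
  then show ?thesis by (simp add: comp_coeff_def)
qed

text \<open>Truncation below order \<open>K\<close> leaves every \<open>comp_coeff\<close> with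
  \<open>a + b < K\<close> unchanged, so \<open>r\<close> vanishes to order \<open>K\<close> along
  the polynomial curve, while the coefficient of order \<open>m < K\<close> survives and bounds the
  multiplicity by \<open>m\<close>.\<close>

lemma truncated_curve_ratio:
  fixes r :: "complex^'n::finite \<Rightarrow> real"
  assumes U: "open U" "p \<in> U" and r: "smooth_on U r"
    and Z0: "\<And>j. fps_nth (Z j) 0 = 0" and m: "fps_nth (Z j0) m \<noteq> 0" and K: "m < K"
    and vanish: "\<And>a b. comp_coeff (taylor_coeff r p) Z a b = 0"
  shows "ereal (real K / real m) \<le> DAngelo_type r p"
proof -
  have m0: "m > 0" using m Z0 by (metis gr0I)
  define Y where "Y j = (\<Sum>i<K. fps_const (fps_nth (Z j) i) * fps_X ^ i)" for j
  define h where "h t = (\<chi> j. \<Sum>i<K. fps_nth (Z j) i * t ^ i)" for t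
  define \<zeta> where "\<zeta> t = p + h t" for t
  have Y: "fps_nth (Y j) i = fps_nth (Z j) i" if "i < K" for j i
  proof -
    have "fps_nth (fps_const (fps_nth (Z j) l) * fps_X ^ l) i = (if l = i then fps_nth (Z j) i else 0)" for l
      by auto
    then show ?thesis using that by (simp add: Y_def fps_sum_nth)
  qed
  have h: "(\<lambda>t. h t $ j) has_fps_expansion Y j" for j
    unfolding h_def Y_def by (simp, intro fps_expansion_intros)
  have \<zeta>h: "\<zeta> t - p = h t" for t by (simp add: \<zeta>_def)
  have h0: "h 0 = 0"
    using Z0 by (auto simp: h_def vec_eq_iff power_0_left intro!: sum.neutral)
  then have \<zeta>0: "\<zeta> 0 = p" by (simp add: \<zeta>_def)
  have germ: "\<zeta> \<in> hol_curve_germs p"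
    unfolding hol_curve_germs_def
  proof (intro CollectI conjI allI notI)
    fix j
    have "(\<lambda>t. p $ j + (\<Sum>i<K. fps_nth (Z j) i * t ^ i)) analytic_on {0}" by (intro analytic_intros)
    then show "(\<lambda>t. \<zeta> t $ j) analytic_on {0}" by (simp add: \<zeta>_def h_def)
  next
    assume "eventually (\<lambda>t. \<zeta> t = p) (nhds 0)"
    then have "eventually (\<lambda>t. \<zeta> t = p) (at 0)" by (simp add: eventually_nhds_conv_at)
    then have "(\<lambda>t. h t $ j0) \<in> O[at 0](\<lambda>t. t ^ Suc m)"
      by (intro bigoI[of _ 0], elim eventually_mono) (simp add: \<zeta>_def)
    with fps_expansion_order_bound[OF h, of j0 m "Suc m"] m Y[OF K] show False by simp
  qed (rule \<zeta>0)
  have "(\<lambda>t. complex_of_real (r (p + h t)) - (\<Sum>(a, b) | a + b < K. comp_coeff (taylor_coeff r p) Y a b * t ^ a * cnj t ^ b))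
    \<in> O[at 0](\<lambda>t. t ^ K)"
    by (rule composition_expansion[OF U r _ h]) (use Y Z0 K in auto)
  moreover have "comp_coeff (taylor_coeff r p) Y a b = 0" if "a + b < K" for a b
    using comp_coeff_cong[of a b Y Z] Y vanish that by simp
  then have "(\<Sum>(a, b) | a + b < K. comp_coeff (taylor_coeff r p) Y a b * t ^ a * cnj t ^ b) = 0" for t
    by (intro sum.neutral) auto
  ultimately have "(\<lambda>t. r (\<zeta> t)) \<in> O[at 0](\<lambda>t. cmod t ^ K)" by (simp add: bigo_of_real_iff \<zeta>_def)
  then have ord: "enat K \<le> ord_vanish (\<lambda>t. r (\<zeta> t))" unfolding ord_vanish_def by (intro Sup_upper) blast
  have nu: "nu_curve \<zeta> \<le> enat m"
    by (rule nu_curve_le[where p = p and j = j0 and F = "Y j0"])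
       (use h m Y[OF K] in \<open>simp_all add: \<zeta>0 \<zeta>h\<close>)
  have "ereal (real K / real m) \<le> ereal_of_enat (ord_vanish (\<lambda>t. r (\<zeta> t))) / ereal_of_enat (nu_curve \<zeta>)"
  proof -
    obtain n where n: "nu_curve \<zeta> = enat n" "n \<le> m" using nu by (cases "nu_curve \<zeta>") auto
    show ?thesis
    proof (cases "ord_vanish (\<lambda>t. r (\<zeta> t))")
      case (enat q)
      then have q: "K \<le> q" using ord by simp
      show ?thesis
      \<comment> \<open>\<open>nu_curve_le\<close> gives only an upper bound and leaves
        \<open>n = 0\<close> open; there the \<open>ereal\<close> quotient \<open>q / 0\<close> is
        \<open>\<infinity>\<close>, because \<open>q > 0\<close>.\<close>
      proof (cases "n = 0")
        case True
        then show ?thesis using q K by (simp add: enat n divide_ereal_def zero_ereal_def[symmetric] zero_enat_def[symmetric])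
      next
        case False
        then have "real K / real m \<le> real q / real n" using q n(2) by (intro frac_le) auto
        then show ?thesis using False by (simp add: enat n)
      qed
    next
      case infinity
      then show ?thesis by (simp add: n divide_ereal_def)
    qed
  qed
  also have "\<dots> \<le> DAngelo_type r p" unfolding DAngelo_type_def by (rule SUP_upper[OF germ])
  finally show ?thesis .
qed

theorem theorem2:
  fixes r :: "complex^'n::finite \<Rightarrow> real" and p :: "complex^'n" and U :: "(complex^'n) set"
  assumes "open U" and "p \<in> U" and "smooth_on U r"
    and "r p = 0" and "frechet_derivative r (at p) \<noteq> (\<lambda>v. 0)"
  shows "DAngelo_type r p = \<infinity> \<longleftrightarrow>
    (\<exists>\<zeta>::'n \<Rightarrow> complex fps. formal_curve_through \<zeta> p \<and> formal_nonconstant \<zeta>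
        \<and> (\<forall>a b. formal_comp_coeff r p \<zeta> a b = 0))"
proof
  assume type: "DAngelo_type r p = \<infinity>"
  have "\<forall>k. \<exists>N. inverse_system N \<and> isotropic (taylor_coeff r p) N
    \<and> (\<forall>i\<le>k. \<exists>f\<in>N. deg_le i f \<and> (\<exists>\<alpha>. sum \<alpha> UNIV = i \<and> f \<alpha> \<noteq> 0))"
    using infinite_type_isotropic_system[OF assms(1-3) type] by blast
  then obtain M where M: "\<And>k. inverse_system (M k)" "\<And>k. isotropic (taylor_coeff r p) (M k)"
    "\<And>k i. i \<le> k \<Longrightarrow> \<exists>f\<in>M k. deg_le i f \<and> (\<exists>\<alpha>. sum \<alpha> UNIV = i \<and> f \<alpha> \<noteq> 0)"
    by metis
  have "\<exists>N. inverse_system N \<and> \<not> bounded_system N \<and> isotropic (taylor_coeff r p) N"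
    by (rule limit_inverse_system[where M = M]) (rule M, assumption?)+
  then obtain N where N: "inverse_system N" "\<not> bounded_system N" "isotropic (taylor_coeff r p) N"
    by blast
  obtain u Z where Z: "u \<noteq> 0" "\<And>j. fps_nth (Z j) 0 = 0" "\<exists>j. Z j \<noteq> 0"
    "coeffs_in N (\<lambda>\<alpha>. u * (\<Prod>j\<in>UNIV. Z j ^ \<alpha> j))"
    using inverse_system_contains_curve[OF N(1,2)] by blast
  define \<zeta> where "\<zeta> j = fps_const (p $ j) + Z j" for j
  have "formal_curve_through \<zeta> p" using Z(2) by (simp add: formal_curve_through_def \<zeta>_def)
  moreover have "formal_nonconstant \<zeta>"
  proof -
    obtain j k where "fps_nth (Z j) k \<noteq> 0" using Z(3) by (auto simp: fps_eq_iff)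
    moreover from this have "k > 0" using Z(2) by (metis gr0I)
    ultimately show ?thesis unfolding formal_nonconstant_def \<zeta>_def by (intro exI[of _ j] exI[of _ k]) simp
  qed
  moreover have "formal_comp_coeff r p \<zeta> a b = 0" for a b
    using isotropic_curve_comp_coeff[OF Z(2,1) N(3) Z(4), of a b] by (simp add: formal_comp_coeff_eq \<zeta>_def)
  ultimately show "\<exists>\<zeta>::'n \<Rightarrow> complex fps. formal_curve_through \<zeta> p \<and> formal_nonconstant \<zeta>
      \<and> (\<forall>a b. formal_comp_coeff r p \<zeta> a b = 0)" by blast
next
  assume "\<exists>\<zeta>::'n \<Rightarrow> complex fps. formal_curve_through \<zeta> p \<and> formal_nonconstant \<zeta>
      \<and> (\<forall>a b. formal_comp_coeff r p \<zeta> a b = 0)"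
  then obtain \<zeta> :: "'n \<Rightarrow> complex fps" where \<zeta>: "formal_curve_through \<zeta> p" "formal_nonconstant \<zeta>"
    "\<And>a b. formal_comp_coeff r p \<zeta> a b = 0" by blast
  define Z where "Z j = \<zeta> j - fps_const (p $ j)" for j
  have Z0: "fps_nth (Z j) 0 = 0" for j using \<zeta>(1) by (simp add: Z_def formal_curve_through_def)
  obtain j0 m where m: "m > 0" "fps_nth (\<zeta> j0) m \<noteq> 0" using \<zeta>(2) by (auto simp: formal_nonconstant_def)
  then have Zm: "fps_nth (Z j0) m \<noteq> 0" by (simp add: Z_def)
  have vanish: "comp_coeff (taylor_coeff r p) Z a b = 0" for a b
    using \<zeta>(3)[of a b] by (simp add: formal_comp_coeff_eq Z_def[abs_def])
  show "DAngelo_type r p = \<infinity>"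
  proof (rule ereal_top)
    fix B :: real
    \<comment> \<open>\<open>K > m\<close> keeps the nonzero coefficient inside the truncation, and
      \<open>K > B * m\<close> makes the ratio exceed \<open>B\<close>.\<close>
    obtain K :: nat where K: "max (real m) (B * real m) < real K" using reals_Archimedean2 by blast
    then have "ereal B \<le> ereal (real K / real m)" using m(1) by (simp add: field_simps)
    also have "\<dots> \<le> DAngelo_type r p"
      by (rule truncated_curve_ratio[OF assms(1-3) Z0 Zm _ vanish]) (use K in simp)
    finally show "ereal B \<le> DAngelo_type r p" .
  qed
qed

end
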